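(* Let $d\ge1$ and let $t\in\mathbb{R}$, $t\neq0$. The Fourier multiplier $K'(t)=\cos(t\Delta)$, with symbol $\sigma_0(\xi)=\cos(4\pi^2t|\xi|^2)$, $\xi\in\mathbb{R}^d$, is unbounded on $W(\mathcal{F}L^p,L^q)(\mathbb{R}^d)$ for all $1\le p,q\le\infty$ with $p\neq q$; that is, there is no constant $C>0$ such that $\|K'(t)f\|_{W(\mathcal{F}L^p,L^q)}\le C\|f\|_{W(\mathcal{F}L^p,L^q)}$ for all $f\in\mathcal{S}(\mathbb{R}^d)$.
   Context: Fourier transform: $\hat f(\xi)=\int_{\mathbb{R}^d} f(y)e^{-2\pi i y\xi}\,dy$. The Fourier multiplier with symbol $\sigma$ is $H_\sigma f(x)=\int_{\mathbb{R}^d} e^{2\pi i x\xi}\sigma(\xi)\hat f(\xi)\,d\xi$, $f\in\mathcal{S}(\mathbb{R}^d)$. (The function $K'(t)u_0$ is the solution of the homogeneous vibrating plate equation $\partial_t^2u+\Delta_x^2u=0$ with $u(0,\cdot)=u_0$, $\partial_tu(0,\cdot)=0$.) Short-time Fourier transform: for a fixed non-zero $g\in\mathcal{S}(\mathbb{R}^d)$, $V_gf(z,\zeta)=\int e^{-2\pi i\zeta y}f(y)\overline{g(y-z)}\,dy$. Wiener amalgam space: for $1\le p,q\le\infty$, $W(\mathcal{F}L^p,L^q)(\mathbb{R}^d)$ is the closure of $\mathcal{S}(\mathbb{R}^d)$ with respect to the norm $$\|f\|_{W(\mathcal{F}L^p,L^q)}=\Big(\int_{\mathbb{R}^d}\Big(\int_{\mathbb{R}^d}|V_gf(z,\zeta)|^p\,d\zeta\Big)^{q/p}\,dz\Big)^{1/q}$$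 (with the usual modifications if $p=\infty$ or $q=\infty$); different windows $g$ give equivalent norms. *)

theory Defs
  imports "HOL-Analysis.Analysis" "HOL-Probability.Essential_Supremum"
begin

definition partial_deriv :: "'n::finite \<Rightarrow> (real ^ 'n \<Rightarrow> complex) \<Rightarrow> real ^ 'n \<Rightarrow> complex" where
  "partial_deriv i f = (\<lambda>x. frechet_derivative f (at x) (axis i 1))"

text \<open>A derivative of arbitrary order is given by the list of coordinates in which one
  differentiates; lists containing each \<open>i\<close> exactly \<open>\<beta> i\<close> times represent the multi-index \<open>\<beta>\<close>.\<close>

fun iter_partial :: "'n::finite list \<Rightarrow> (real ^ 'n \<Rightarrow> complex) \<Rightarrow> real ^ 'n \<Rightarrow> complex" where
  "iter_partial [] f = f"
| "iter_partial (i # is) f = partial_deriv i (iter_partial is f)"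

text \<open>The first conjunct is equivalent to \<open>f\<close> being of class \<open>C\<^sup>\<infinity>\<close>, since differentiability
  of all iterated partial derivatives implies their continuity.\<close>

definition schwartz :: "(real ^ 'n::finite \<Rightarrow> complex) \<Rightarrow> bool" where
  "schwartz f \<longleftrightarrow>
     (\<forall>is x. iter_partial is f differentiable (at x)) \<and>
     (\<forall>(\<alpha> :: 'n \<Rightarrow> nat) is. \<exists>C. \<forall>x. \<bar>\<Prod>i\<in>UNIV. (x $ i) ^ \<alpha> i\<bar> * norm (iter_partial is f x) \<le> C)"

definition fourier :: "(real ^ 'n::finite \<Rightarrow> complex) \<Rightarrow> real ^ 'n \<Rightarrow> complex" where
  "fourier f \<xi> = (\<integral>y. f y * cis (- 2 * pi * (y \<bullet> \<xi>)) \<partial>lborel)"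

definition fourier_multiplier ::
  "(real ^ 'n::finite \<Rightarrow> complex) \<Rightarrow> (real ^ 'n \<Rightarrow> complex) \<Rightarrow> real ^ 'n \<Rightarrow> complex" where
  "fourier_multiplier \<sigma> f x = (\<integral>\<xi>. cis (2 * pi * (x \<bullet> \<xi>)) * \<sigma> \<xi> * fourier f \<xi> \<partial>lborel)"

definition stft ::
  "(real ^ 'n::finite \<Rightarrow> complex) \<Rightarrow> (real ^ 'n \<Rightarrow> complex) \<Rightarrow> real ^ 'n \<Rightarrow> real ^ 'n \<Rightarrow> complex" where
  "stft g f z \<zeta> = (\<integral>y. cis (- 2 * pi * (\<zeta> \<bullet> y)) * f y * cnj (g (y - z)) \<partial>lborel)"

text \<open>Only positive exponents are used.\<close>

definition ennreal_powr :: "ennreal \<Rightarrow> real \<Rightarrow> ennreal" where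
  "ennreal_powr x a = (if x = \<infinity> then \<infinity> else ennreal (enn2real x powr a))"

definition Lp_norm :: "ennreal \<Rightarrow> ('a::euclidean_space \<Rightarrow> ennreal) \<Rightarrow> ennreal" where
  "Lp_norm p h =
     (if p = \<infinity> then esssup lborel h
      else ennreal_powr (\<integral>\<^sup>+x. ennreal_powr (h x) (enn2real p) \<partial>lborel) (1 / enn2real p))"

text \<open>The norm of \<open>W(\<F>L\<^sup>p, L\<^sup>q)\<close> with window \<open>g\<close>: an \<open>L\<^sup>p\<close> norm in the frequency \<open>\<zeta>\<close>,
  followed by an \<open>L\<^sup>q\<close> norm in the position \<open>z\<close>.\<close>

definition amalgam_norm ::
  "(real ^ 'n::finite \<Rightarrow> complex) \<Rightarrow> ennreal \<Rightarrow> ennreal \<Rightarrow> (real ^ 'n \<Rightarrow> complex) \<Rightarrow> ennreal" where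
  "amalgam_norm g p q f =
     Lp_norm q (\<lambda>z. Lp_norm p (\<lambda>\<zeta>. ennreal (norm (stft g f z \<zeta>))))"

definition plate_symbol :: "real \<Rightarrow> real ^ 'n::finite \<Rightarrow> complex" where
  "plate_symbol t \<xi> = of_real (cos (4 * pi\<^sup>2 * t * (norm \<xi>)\<^sup>2))"

end

(* The chirp exp(i tau |xi|^2) with tau = 4 pi^2 t moves a wave packet of frequency xi0 by
   -(tau/pi) xi0 in position and turns Gaussians into Gaussians, so cos(t Delta) splits a packet
   into two packets moving in opposite directions, without changing its frequency.  N packets
   with well separated frequencies have norm of order N^(1/p) if they share their position and
   of order N^(1/q) if their positions are separated as well.
   If q < p, packets with a common position are driven apart.  If p < q, packets placed so that
   one half of each is brought back to a common position are gathered.  In both cases the norm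
   grows by a factor N^|1/p - 1/q|.
   The Gaussians are chosen so that the half used for the lower bound consists of real, narrow
   Gaussians; for these the short-time Fourier transform with an arbitrary window g is seen not
   to vanish by an approximate identity argument. *)
theory Submission
  imports Defs "HOL-Probability.Sinc_Integral"
begin

section \<open>Norms and weights\<close>

text \<open>The obstacle is the lower bound: it has to hold pointwise, for an arbitrary window and
  with constants independent of \<open>N\<close>, although the \<open>2 N\<close> output packets may
  cancel. Therefore the spacing \<open>L\<close> of the frequencies is fixed before
  \<open>N\<close>. The contributions of the other frequencies add up to a convergent sum of inverse
  squares and are O(1 / L^2). The unwanted half of the observed packet has the same frequency, but
  its position is off by \<open>2 * j * \<kappa> * L\<close> along the axis with \<kappa> = 4 pi t,
  which again costs only O(1 / L^2). All decay is measured by a product weight that is quadratic in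
  every coordinate. The upper bounds need no orthogonality: a supremum bound and an L^1 bound for
  sums of weights yield all exponents at once, infinity included. Gaussian integrals with complex
  parameter are never evaluated, since w^(-d/2) would require a choice of branch; only the fact that
  they do not vanish matters.\<close>

definition recip_exp :: "ennreal \<Rightarrow> real" where
  "recip_exp p = (if p = \<infinity> then 0 else 1 / enn2real p)"

lemma recip_exp_less: "recip_exp p < recip_exp q" if "1 \<le> q" "q < p"
proof -
  have q: "q \<noteq> \<infinity>" using that by auto
  then have q1: "1 \<le> enn2real q" using that by (metis enn2real_1 enn2real_mono ennreal_less_top infinity_ennreal_def top.not_eq_extremum)
  show ?thesis
  proof (cases "p = \<infinity>")
    case True then show ?thesis using q q1 by (simp add: recip_exp_def)
  next
    case False
    then have "enn2real q < enn2real p" using that q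
      by (metis enn2real_less_iff enn2real_nonneg ennreal_enn2real infinity_ennreal_def less_top)
    then show ?thesis using q q1 False by (simp add: recip_exp_def frac_less2)
  qed
qed

lemma ennreal_powr_ennreal: "0 \<le> r \<Longrightarrow> ennreal_powr (ennreal r) a = ennreal (r powr a)"
  by (simp add: ennreal_powr_def)

lemma ennreal_powr_mono: "x \<le> y \<Longrightarrow> 0 \<le> a \<Longrightarrow> ennreal_powr x a \<le> ennreal_powr y a"
  by (cases x; cases y) (auto simp: ennreal_powr_def top_unique intro!: ennreal_leI powr_mono2)

lemma measurable_ennreal_powr [measurable]: "(\<lambda>x. ennreal_powr x a) \<in> borel_measurable borel"
  unfolding ennreal_powr_def by measurable

lemma ge_one_enn2real: "1 \<le> p \<Longrightarrow> p \<noteq> \<infinity> \<Longrightarrow> 1 \<le> enn2real p"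
  by (cases p) auto

text \<open>Interpolation between L^1 and L^infinity: h^P <= B^(P-1) H. One constant
  \<open>B\<close> controls both the supremum and the integral, so that the result scales linearly
  in it. For finite \<open>p\<close> monotonicity of the integral applies to any \<open>h\<close>;
  for \<open>p = \<infinity>\<close> the rule \<open>esssup_I\<close> asks for
  measurability.\<close>

lemma Lp_norm_upper:
  fixes h :: "'a::euclidean_space \<Rightarrow> ennreal"
  assumes p: "1 \<le> p" and h: "p = \<infinity> \<Longrightarrow> h \<in> borel_measurable lborel"
    and H [measurable]: "H \<in> borel_measurable lborel"
    and hH: "\<And>x. h x \<le> ennreal (H x)" and H0: "\<And>x. 0 \<le> H x" and HB: "\<And>x. H x \<le> B"
    and I: "0 < I" and int: "(\<integral>\<^sup>+x. ennreal (H x) \<partial>lborel) \<le> ennreal (B * I)"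
  shows "Lp_norm p h \<le> ennreal (B * I powr recip_exp p)"
proof (cases "p = \<infinity>")
  case True
  have "h x \<le> ennreal B" for x using hH[of x] HB[of x] by (meson ennreal_leI order_trans)
  then have "esssup lborel h \<le> ennreal B" using h[OF True] by (intro esssup_I) auto
  then show ?thesis using True I by (simp add: Lp_norm_def recip_exp_def)
next
  case False
  define P where "P = enn2real p"
  have P: "1 \<le> P" using ge_one_enn2real[OF p False] by (simp add: P_def)
  have B: "0 \<le> B" using H0[of 0] HB[of 0] by linarith
  have pt: "ennreal_powr (h x) P \<le> ennreal (B powr (P - 1)) * ennreal (H x)" for x
  proof -
    have "ennreal_powr (h x) P \<le> ennreal (H x powr P)"
      using ennreal_powr_mono[OF hH[of x], of P] P by (simp add: ennreal_powr_ennreal H0)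
    also have "H x powr P = H x powr (P - 1) * H x"
      using H0[of x] by (cases "H x = 0") (auto simp: powr_diff)
    also have "ennreal \<dots> \<le> ennreal (B powr (P - 1) * H x)"
      using H0[of x] HB[of x] P by (intro ennreal_leI mult_right_mono powr_mono2) auto
    finally show ?thesis by (simp add: ennreal_mult H0)
  qed
  have "(\<integral>\<^sup>+x. ennreal_powr (h x) P \<partial>lborel) \<le> (\<integral>\<^sup>+x. ennreal (B powr (P - 1)) * ennreal (H x) \<partial>lborel)"
    by (intro nn_integral_mono pt)
  also have "\<dots> = ennreal (B powr (P - 1)) * (\<integral>\<^sup>+x. ennreal (H x) \<partial>lborel)"
    by (rule nn_integral_cmult) measurable
  also have "\<dots> \<le> ennreal (B powr (P - 1)) * ennreal (B * I)" by (intro mult_left_mono int) simp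
  also have "\<dots> = ennreal (B powr P * I)"
    using B I by (cases "B = 0") (auto simp: ennreal_mult[symmetric] powr_diff)
  finally have "ennreal_powr (\<integral>\<^sup>+x. ennreal_powr (h x) P \<partial>lborel) (1 / P) \<le> ennreal_powr (ennreal (B powr P * I)) (1 / P)"
    using P by (intro ennreal_powr_mono) auto
  also have "\<dots> = ennreal (B * I powr (1 / P))"
    using B I P by (subst ennreal_powr_ennreal) (auto simp: powr_mult powr_powr)
  finally show ?thesis using False by (simp add: Lp_norm_def recip_exp_def P_def)
qed

text \<open>Chebyshev's inequality read backwards. No measurability of \<open>h\<close> enters:
  \<open>esssup_AE\<close> and monotonicity of the integral hold for every function.\<close>

lemma Lp_norm_lower:
  fixes h :: "'a::euclidean_space \<Rightarrow> ennreal"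
  assumes p: "1 \<le> p" and S [measurable]: "S \<in> sets lborel" and m: "emeasure lborel S = ennreal m" "0 < m"
    and c: "0 \<le> c" "\<And>x. x \<in> S \<Longrightarrow> ennreal c \<le> h x"
  shows "ennreal (c * m powr recip_exp p) \<le> Lp_norm p h"
proof (cases "p = \<infinity>")
  case True
  have "ennreal c \<le> esssup lborel h"
  proof (rule ccontr)
    assume "\<not> ennreal c \<le> esssup lborel h"
    have "AE x in lborel. x \<notin> S"
    proof (rule AE_mp[OF esssup_AE[of h lborel]], intro AE_I2 impI notI)
      fix x assume "h x \<le> esssup lborel h" "x \<in> S"
      then have "ennreal c \<le> esssup lborel h" using c(2) order_trans by blast
      then show False using \<open>\<not> ennreal c \<le> esssup lborel h\<close> by simp
    qed
    then have "emeasure lborel S = 0" by (simp add: AE_iff_measurable[OF S] )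
    then show False using m by simp
  qed
  then show ?thesis using True m by (simp add: Lp_norm_def recip_exp_def)
next
  case False
  define P where "P = enn2real p"
  have P: "1 \<le> P" using ge_one_enn2real[OF p False] by (simp add: P_def)
  have "ennreal (c powr P * m) = (\<integral>\<^sup>+x. ennreal (c powr P) * indicator S x \<partial>lborel)"
    using m nn_integral_cmult_indicator[OF S, of "ennreal (c powr P)"] by (simp add: ennreal_mult)
  also have "\<dots> \<le> (\<integral>\<^sup>+x. ennreal_powr (h x) P \<partial>lborel)"
  proof (intro nn_integral_mono)
    fix x show "ennreal (c powr P) * indicator S x \<le> ennreal_powr (h x) P"
      using ennreal_powr_mono[OF c(2)[of x], of P] P c(1) by (cases "x \<in> S") (auto simp: ennreal_powr_ennreal)
  qed
  finally have "ennreal_powr (ennreal (c powr P * m)) (1 / P) \<le> ennreal_powr (\<integral>\<^sup>+x. ennreal_powr (h x) P \<partial>lborel) (1 / P)"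
    using P by (intro ennreal_powr_mono) auto
  moreover have "ennreal_powr (ennreal (c powr P * m)) (1 / P) = ennreal (c * m powr (1 / P))"
    using c(1) m P by (subst ennreal_powr_ennreal) (auto simp: powr_mult powr_powr)
  ultimately show ?thesis using False by (simp add: Lp_norm_def recip_exp_def P_def)
qed

section \<open>Product weights and sums of inverse squares\<close>

definition weight :: "real ^ 'n::finite \<Rightarrow> real" where
  "weight x = (\<Prod>i\<in>UNIV. inverse (1 + (x $ i)\<^sup>2))"

lemma weight_pos: "0 < weight x"
  unfolding weight_def by (intro prod_pos) (auto simp: add_pos_nonneg)

lemma weight_nonneg [simp]: "0 \<le> weight x"
  by (simp add: less_imp_le weight_pos)

lemma measurable_weight [measurable]: "weight \<in> borel_measurable borel"
  unfolding weight_def by measurable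

lemma weight_le: "weight x \<le> inverse (1 + (x $ i)\<^sup>2)"
proof -
  have "weight x = inverse (1 + (x $ i)\<^sup>2) * (\<Prod>j\<in>UNIV - {i}. inverse (1 + (x $ j)\<^sup>2))"
    unfolding weight_def by (rule prod.remove) auto
  also have "\<dots> \<le> inverse (1 + (x $ i)\<^sup>2) * 1"
    by (intro mult_left_mono prod_le_1) (auto simp: inverse_le_1_iff add_nonneg_nonneg)
  finally show ?thesis by simp
qed

lemma weight_le_1: "weight x \<le> 1"
  unfolding weight_def by (intro prod_le_1) (auto simp: inverse_le_1_iff add_nonneg_nonneg)

text \<open>The weight is a product of one-variable functions rather than a power of the norm
  precisely for this: the integral factors into copies of the integral of 1 / (1 + x^2).\<close>

lemma nn_integral_weight_finite: "(\<integral>\<^sup>+x. ennreal (weight (x :: real ^ 'n::finite)) \<partial>lborel) < \<infinity>"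
proof -
  have B: "(Basis :: (real ^ 'n) set) = (\<lambda>i. axis i 1) ` UNIV" by (auto simp: Basis_vec_def)
  have inj: "inj (\<lambda>i :: 'n. axis i (1::real))" by (auto simp: inj_on_def axis_eq_axis)
  have w: "weight x = (\<Prod>b\<in>Basis. inverse (1 + (x \<bullet> b)\<^sup>2))" for x :: "real ^ 'n"
    unfolding B weight_def by (subst prod.reindex[OF inj]) (simp add: inner_axis)
  have "(\<integral>\<^sup>+x. ennreal (weight (x :: real ^ 'n)) \<partial>lborel)
      = (\<integral>\<^sup>+x. (\<Prod>b\<in>Basis. ennreal (inverse (1 + ((x :: real ^ 'n) \<bullet> b)\<^sup>2))) \<partial>lborel)"
    unfolding w by (intro nn_integral_cong prod_ennreal[symmetric]) (auto intro: add_nonneg_nonneg)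
  also have "\<dots> = (\<Prod>b\<in>(Basis :: (real ^ 'n) set). (\<integral>\<^sup>+x. ennreal (inverse (1 + x\<^sup>2)) \<partial>lborel))"
    by (rule nn_integral_lborel_prod) auto
  also have "\<dots> < \<infinity>"
  proof -
    have "integrable lborel (\<lambda>x::real. inverse (1 + x\<^sup>2))"
      using integrable_inverse_1_plus_square by (simp add: set_integrable_def)
    then have "(\<integral>\<^sup>+x. ennreal (inverse (1 + x\<^sup>2)) \<partial>lborel) < \<infinity>"
      by (subst nn_integral_eq_integral) (auto intro: add_nonneg_nonneg)
    then show ?thesis by (simp add: power_less_top_ennreal)
  qed
  finally show ?thesis .
qed

lemma weight_shift_integral:
  obtains I where "0 < I" "\<And>a. (\<integral>\<^sup>+x. ennreal (weight (x - a :: real ^ 'n::finite)) \<partial>lborel) = ennreal I"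
proof -
  obtain I where I: "(\<integral>\<^sup>+x. ennreal (weight (x :: real ^ 'n)) \<partial>lborel) = ennreal I" "0 \<le> I"
    using nn_integral_weight_finite by (metis infinity_ennreal_def less_top_ennreal)
  have "I \<noteq> 0"
  proof
    assume "I = 0"
    then have "AE x :: real ^ 'n in lborel. weight x = 0"
      using I(1) by (simp add: nn_integral_0_iff_AE ennreal_eq_0_iff order_antisym_conv)
    then have "AE x :: real ^ 'n in lborel. False" by (simp add: weight_pos less_imp_neq[symmetric])
    then show False
      using AE_iff_measurable[of UNIV lborel "\<lambda>x :: real ^ 'n. False"] by simp
  qed
  moreover have "(\<integral>\<^sup>+x. ennreal (weight (x - a :: real ^ 'n)) \<partial>lborel) = ennreal I" for a
  proof -
    have "(\<integral>\<^sup>+x. ennreal (weight (x :: real ^ 'n)) \<partial>lborel) = (\<integral>\<^sup>+x. ennreal (weight x) \<partial>distr lborel borel ((+) (- a)))"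
      by (simp add: lborel_distr_plus)
    also have "\<dots> = (\<integral>\<^sup>+x. ennreal (weight (x - a)) \<partial>lborel)"
      by (subst nn_integral_distr) auto
    finally show ?thesis using I by simp
  qed
  ultimately show ?thesis using that[of I] I by auto
qed

lemma integrable_weight: "integrable lborel (weight :: real ^ 'n::finite \<Rightarrow> real)"
  using nn_integral_weight_finite[where 'n='n] by (intro integrableI_nonneg) auto

text \<open>On either side of \<open>m\<close> the map from k to |k - m| is injective into the
  naturals, so each side is dominated by the full series, whatever \<open>K\<close> and
  \<open>m\<close> are.\<close>

lemma sum_inverse_squares_bound:
  obtains S where "0 < S"
    "\<And>(K :: int set) m. finite K \<Longrightarrow> m \<notin> K \<Longrightarrow> (\<Sum>k\<in>K. 1 / (of_int (k - m))\<^sup>2) \<le> (S::real)"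
proof -
  \<comment> \<open>The term for \<open>n = 0\<close> is 1 / 0 = 0.\<close>
  define s where "s = (\<Sum>n. 1 / (real n)\<^sup>2)"
  have sm: "summable (\<lambda>n. 1 / (real n)\<^sup>2)"
    using inverse_power_summable[of 2, where 'a=real] by (simp add: inverse_eq_divide)
  have half: "(\<Sum>k\<in>K. 1 / (of_int (k - m))\<^sup>2) \<le> s"
    if K: "finite K" "inj_on (\<lambda>k. nat \<bar>k - m\<bar>) K" for K :: "int set" and m
  proof -
    have "(\<Sum>k\<in>K. 1 / (of_int (k - m))\<^sup>2) = (\<Sum>n\<in>(\<lambda>k. nat \<bar>k - m\<bar>) ` K. 1 / (real n)\<^sup>2)"
      using K(2) by (subst sum.reindex) (auto simp: )
    also have "\<dots> \<le> s" unfolding s_def using sm K(1) by (intro sum_le_suminf) auto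
    finally show ?thesis .
  qed
  \<comment> \<open>The extra 1 only makes the final constant strictly positive.\<close>
  have "(\<Sum>k\<in>K. 1 / (of_int (k - m))\<^sup>2) \<le> s + s + 1" if K: "finite K" "m \<notin> K" for K :: "int set" and m
  proof -
    have "(\<Sum>k\<in>K. 1 / (of_int (k - m))\<^sup>2) = (\<Sum>k\<in>{k\<in>K. m < k} \<union> {k\<in>K. k < m}. 1 / (of_int (k - m))\<^sup>2)"
      using K by (intro sum.cong) (auto simp: not_less order_le_less)
    also have "\<dots> = (\<Sum>k\<in>{k\<in>K. m < k}. 1 / (of_int (k - m))\<^sup>2) + (\<Sum>k\<in>{k\<in>K. k < m}. 1 / (of_int (k - m))\<^sup>2)"
      using K by (intro sum.union_disjoint) auto
    also have "\<dots> \<le> s + s" using K by (intro add_mono half) (auto simp: inj_on_def)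
    finally show ?thesis by simp
  qed
  moreover have "0 \<le> s" unfolding s_def by (intro suminf_nonneg sm) auto
  ultimately show ?thesis using that[of "s + s + 1"] by auto
qed

section \<open>Differentiation under the integral\<close>

text \<open>Difference quotients are the form in which dominated convergence can be applied along
  sequences.\<close>

lemma has_vector_derivative_iff_quotient:
  "(f has_vector_derivative D) (at x) \<longleftrightarrow> (\<lambda>h. (f (x + h) - f x) /\<^sub>R h) \<midarrow>0\<rightarrow> D"
proof -
  have "(\<lambda>h. norm (f (x + h) - f x - h *\<^sub>R D) / norm h) \<midarrow>0\<rightarrow> 0
      \<longleftrightarrow> (\<lambda>h. norm ((f (x + h) - f x) /\<^sub>R h - D)) \<midarrow>0\<rightarrow> 0"
  proof (rule LIM_cong)
    fix h :: real assume "h \<noteq> 0"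
    then have "(f (x + h) - f x) /\<^sub>R h - D = (f (x + h) - f x - h *\<^sub>R D) /\<^sub>R h"
      by (simp add: scaleR_right_diff_distrib)
    then show "norm (f (x + h) - f x - h *\<^sub>R D) / norm h = norm ((f (x + h) - f x) /\<^sub>R h - D)"
      by (simp add: divide_inverse_commute)
  qed auto
  then show ?thesis
    unfolding has_vector_derivative_def has_derivative_at
    by (simp add: bounded_linear_scaleR_left tendsto_norm_zero_iff LIM_zero_iff)
qed

lemma norm_diff_le_vector_derivative:
  fixes f :: "real \<Rightarrow> 'b::real_normed_vector"
  assumes "\<And>s. s \<in> {a..b} \<Longrightarrow> (f has_vector_derivative f' s) (at s)"
    and "\<And>s. s \<in> {a..b} \<Longrightarrow> norm (f' s) \<le> B" and "x \<in> {a..b}" "y \<in> {a..b}"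
  shows "norm (f x - f y) \<le> B * \<bar>x - y\<bar>"
proof -
  have "norm (f x - f y) \<le> B * norm (x - y)"
  proof (rule differentiable_bound[of "{a..b}" f "\<lambda>s h. h *\<^sub>R f' s"])
    fix s assume "s \<in> {a..b}"
    then show "(f has_derivative (\<lambda>h. h *\<^sub>R f' s)) (at s within {a..b})"
      using assms(1) unfolding has_vector_derivative_def by (blast intro: has_derivative_at_withinI)
    show "onorm (\<lambda>h. h *\<^sub>R f' s) \<le> B"
      using assms(2)[OF \<open>s \<in> {a..b}\<close>] by (intro onorm_le) (simp add: mult.commute[of B] mult_left_mono)
  qed (use assms in auto)
  then show ?thesis by simp
qed

text \<open>By the mean value inequality \<open>w\<close> dominates the difference quotients, so
  dominated convergence applies. Measurability of the derivative comes for free, as it is a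
  pointwise limit of these quotients.\<close>

lemma has_vector_derivative_integral:
  fixes f f' :: "real \<Rightarrow> 'a::euclidean_space \<Rightarrow> complex"
  assumes der: "\<And>s y. s \<in> {s0 - 1..s0 + 1} \<Longrightarrow> ((\<lambda>s. f s y) has_vector_derivative f' s y) (at s)"
    and bound: "\<And>s y. s \<in> {s0 - 1..s0 + 1} \<Longrightarrow> norm (f' s y) \<le> w y"
    and int: "\<And>s. integrable lborel (f s)" "integrable lborel w"
  shows "((\<lambda>s. \<integral>y. f s y \<partial>lborel) has_vector_derivative (\<integral>y. f' s0 y \<partial>lborel)) (at s0)"
  unfolding has_vector_derivative_iff_quotient tendsto_at_iff_sequentially
proof (intro allI impI, unfold comp_def)
  fix X :: "nat \<Rightarrow> real" assume X: "\<forall>i. X i \<in> UNIV - {0}" "X \<longlonglongrightarrow> 0"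
  obtain N where N: "\<And>n. n \<ge> N \<Longrightarrow> \<bar>X n\<bar> < 1"
    using X(2) by (auto simp: lim_sequentially dist_norm dest!: spec[of _ "1::real"])
  \<comment> \<open>The bounds are available only on \<open>{s0 - 1..s0 + 1}\<close>, so the first
    increments of the sequence are dropped.\<close>
  define Y where "Y n = X (n + N)" for n
  have Y: "Y \<longlonglongrightarrow> 0" "\<And>n. Y n \<noteq> 0" "\<And>n. \<bar>Y n\<bar> < 1"
    using X N LIMSEQ_ignore_initial_segment[OF X(2), of N] by (auto simp: Y_def[abs_def])
  define Q where "Q n y = (f (s0 + Y n) y - f s0 y) /\<^sub>R Y n" for n y
  have lim: "(\<lambda>n. Q n y) \<longlonglongrightarrow> f' s0 y" for y
    using der[of s0 y] Y unfolding has_vector_derivative_iff_quotient Q_def tendsto_at_iff_sequentially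
    by (auto simp: comp_def)
  have Qm [measurable]: "Q n \<in> borel_measurable lborel" for n
    unfolding Q_def using int(1)[THEN borel_measurable_integrable] by measurable
  have f'm: "f' s0 \<in> borel_measurable lborel"
    by (rule borel_measurable_LIMSEQ_metric[OF Qm]) (rule lim)
  have Qb: "norm (Q n y) \<le> w y" for n y
  proof -
    have "norm (f (s0 + Y n) y - f s0 y) \<le> w y * \<bar>(s0 + Y n) - s0\<bar>"
      using Y(3)[of n] by (intro norm_diff_le_vector_derivative[of "s0 - 1" "s0 + 1" _ "\<lambda>s. f' s y"] der bound) auto
    then have "norm (f (s0 + Y n) y - f s0 y) / \<bar>Y n\<bar> \<le> w y"
      using Y(2)[of n] by (simp add: pos_divide_le_eq)
    then show ?thesis by (simp add: Q_def divide_inverse_commute)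
  qed
  have "(\<lambda>n. \<integral>y. Q n y \<partial>lborel) \<longlonglongrightarrow> (\<integral>y. f' s0 y \<partial>lborel)"
    by (rule integral_dominated_convergence[where w = w]) (use int lim Qb f'm in auto)
  moreover have "(\<integral>y. Q n y \<partial>lborel) = ((\<integral>y. f (s0 + X (n + N)) y \<partial>lborel) - (\<integral>y. f s0 y \<partial>lborel)) /\<^sub>R X (n + N)" for n
    unfolding Q_def Y_def using int(1) by simp
  ultimately show "(\<lambda>n. ((\<integral>y. f (s0 + X n) y \<partial>lborel) - (\<integral>y. f s0 y \<partial>lborel)) /\<^sub>R X n) \<longlonglongrightarrow> (\<integral>y. f' s0 y \<partial>lborel)"
    by - (rule LIMSEQ_offset[of _ N], simp)
qed

section \<open>Polynomial decay\<close>

text \<open>Seminorms with monomials and integration by parts both produce powers of single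
  coordinates; this turns them into decay in the norm. The coordinate of largest modulus controls
  the norm up to the dimension.\<close>

lemma norm_power_bound:
  obtains K where "0 < K"
    "\<And>x :: real ^ 'n::finite. (1 + norm x) ^ M \<le> K * (1 + (\<Sum>i\<in>UNIV. \<bar>x $ i\<bar> ^ M))"
proof -
  define d where "d = real CARD('n)"
  have d: "1 \<le> d" by (simp add: d_def Suc_le_eq)
  have "(1 + norm x) ^ M \<le> (2 * d) ^ M * (1 + (\<Sum>i\<in>UNIV. \<bar>x $ i\<bar> ^ M))" for x :: "real ^ 'n"
  proof -
    obtain i where i: "\<And>j. \<bar>x $ j\<bar> \<le> \<bar>x $ i\<bar>"
      using finite_imageI[of UNIV "\<lambda>i. \<bar>x $ i\<bar>"] Max_in[of "range (\<lambda>i. \<bar>x $ i\<bar>)"] Max_ge[of "range (\<lambda>i. \<bar>x $ i\<bar>)"]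
      by fastforce
    have "norm x \<le> (\<Sum>j\<in>UNIV. \<bar>x $ j\<bar>)" by (rule norm_le_l1_cart)
    also have "\<dots> \<le> d * \<bar>x $ i\<bar>" unfolding d_def by (rule sum_bounded_above) (rule i)
    finally have n: "norm x \<le> d * \<bar>x $ i\<bar>" .
    have s: "\<bar>x $ i\<bar> ^ M \<le> (\<Sum>i\<in>UNIV. \<bar>x $ i\<bar> ^ M)" by (rule member_le_sum) auto
    have s0: "0 \<le> (\<Sum>i\<in>UNIV. \<bar>x $ i\<bar> ^ M)" by (rule sum_nonneg) simp
    show ?thesis
    proof (cases "\<bar>x $ i\<bar> \<le> 1")
      case True
      then have "d * \<bar>x $ i\<bar> \<le> d" using d by (simp add: mult_left_le)
      then have "1 + norm x \<le> 2 * d" using n d by linarith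
      then have "(1 + norm x) ^ M \<le> (2 * d) ^ M" by (intro power_mono) auto
      also have "\<dots> \<le> (2 * d) ^ M * (1 + (\<Sum>i\<in>UNIV. \<bar>x $ i\<bar> ^ M))" using s0 d by (simp add: mult_left_mono)
      finally show ?thesis .
    next
      case False
      then have "1 \<le> d * \<bar>x $ i\<bar>" using mult_mono[of 1 d 1 "\<bar>x $ i\<bar>"] d by simp
      then have "(1 + norm x) ^ M \<le> (2 * d * \<bar>x $ i\<bar>) ^ M" using n by (intro power_mono) auto
      also have "\<dots> = (2 * d) ^ M * \<bar>x $ i\<bar> ^ M" by (simp add: power_mult_distrib)
      also have "\<dots> \<le> (2 * d) ^ M * (1 + (\<Sum>i\<in>UNIV. \<bar>x $ i\<bar> ^ M))" using s d by (intro mult_left_mono) auto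
      finally show ?thesis .
    qed
  qed
  then show ?thesis using that[of "(2 * d) ^ M"] d by auto
qed

text \<open>Origin of the exponent \<open>2 * CARD('n)\<close> used throughout: each of the
  \<open>CARD('n)\<close> factors 1 + x_i^2 is at most (1 + |x|)^2.\<close>

lemma power_decay_le_weight: "inverse ((1 + norm x) ^ (2 * CARD('n))) \<le> weight (x :: real ^ 'n::finite)"
proof -
  have "(\<Prod>i\<in>UNIV. 1 + (x $ i)\<^sup>2) \<le> (\<Prod>i\<in>(UNIV :: 'n set). (1 + norm x)\<^sup>2)"
  proof (intro prod_mono conjI)
    fix i
    have "(x $ i)\<^sup>2 \<le> (norm x)\<^sup>2" using component_le_norm_cart[of x i] by (metis abs_ge_zero power2_abs power_mono)
    then show "1 + (x $ i)\<^sup>2 \<le> (1 + norm x)\<^sup>2" by (simp add: power2_sum add_increasing2)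
  qed (simp add: add_nonneg_nonneg)
  also have "\<dots> = (1 + norm x) ^ (2 * CARD('n))" by (simp add: power_mult)
  finally have "inverse ((1 + norm x) ^ (2 * CARD('n))) \<le> inverse (\<Prod>i\<in>UNIV. 1 + (x $ i)\<^sup>2)"
    by (intro le_imp_inverse_le prod_pos add_pos_nonneg) auto
  then show ?thesis using prod_inversef[of "\<lambda>i. 1 + (x $ i)\<^sup>2" UNIV] by (simp add: weight_def comp_def)
qed

lemma decay_le_weight:
  fixes x :: "real ^ 'n::finite"
  assumes "a * (1 + norm x) ^ (2 * CARD('n)) \<le> C" "0 \<le> C"
  shows "a \<le> C * weight x"
proof -
  have "a \<le> C * inverse ((1 + norm x) ^ (2 * CARD('n)))"
    using assms by (simp add: field_simps add_pos_nonneg)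
  also have "\<dots> \<le> C * weight x" by (intro mult_left_mono power_decay_le_weight assms)
  finally show ?thesis .
qed

lemma integrable_decay:
  fixes F :: "real ^ 'n::finite \<Rightarrow> complex"
  assumes "F \<in> borel_measurable borel" "\<And>y. norm (F y) * (1 + norm y) ^ (2 * CARD('n)) \<le> C"
  shows "integrable lborel F"
proof (rule Bochner_Integration.integrable_bound)
  have C: "0 \<le> C" using order_trans[OF norm_ge_zero[of "F 0"], of C] assms(2)[of 0] by simp
  show "integrable lborel (\<lambda>y :: real ^ 'n. C * weight y)" using integrable_weight[where 'n='n] by simp
  show "AE y in lborel. norm (F y) \<le> norm (C * weight y)"
    using decay_le_weight[OF assms(2)] C by (intro AE_I2) simp
qed (use assms in simp)

text \<open>Peetre's inequality: polynomial weights are moved by a translation at the cost of a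
  factor depending on the translation only.\<close>

lemma one_plus_norm_power_shift:
  fixes y v :: "'a::real_normed_vector"
  shows "(1 + norm y) ^ M \<le> (1 + norm (y - v)) ^ M * (1 + norm v) ^ M"
proof -
  have "0 \<le> norm (y - v) * norm v" by simp
  then have "1 + norm y \<le> (1 + norm (y - v)) * (1 + norm v)"
    using norm_triangle_ineq[of "y - v" v] unfolding distrib_left distrib_right diff_add_cancel by linarith
  then show ?thesis by (simp add: power_mono power_mult_distrib[symmetric])
qed

lemma lborel_integral_shift:
  fixes f :: "'a::euclidean_space \<Rightarrow> 'b::{banach, second_countable_topology}"
  assumes [measurable]: "f \<in> borel_measurable borel"
  shows "(\<integral>y. f (y + v) \<partial>lborel) = (\<integral>y. f y \<partial>lborel)"
proof -
  have "(\<integral>y. f y \<partial>lborel) = (\<integral>y. f y \<partial>distr lborel borel ((+) v))" by (simp add: lborel_distr_plus)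
  also have "\<dots> = (\<integral>y. f (v + y) \<partial>lborel)" by (subst integral_distr) auto
  finally show ?thesis by (simp add: add.commute)
qed

text \<open>The substitute for integration by parts, without iterated integrals: the integral of
  \<open>H (y + s *\<^sub>R v)\<close> does not depend on \<open>s\<close> by translation
  invariance, and its derivative at \<open>s = 0\<close> may be taken under the integral.\<close>

lemma integral_directional_derivative_eq_0:
  fixes H :: "real ^ 'n::finite \<Rightarrow> complex"
  assumes der: "\<And>y. (H has_derivative H' y) (at y)"
    and H: "\<And>y. norm (H y) * (1 + norm y) ^ (2 * CARD('n)) \<le> C"
    and H': "\<And>y. norm (H' y v) * (1 + norm y) ^ (2 * CARD('n)) \<le> C"
  shows "(\<integral>y. H' y v \<partial>lborel) = 0"
proof -
  let ?M = "2 * CARD('n)"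
  have C: "0 \<le> C" using order_trans[OF norm_ge_zero[of "H 0"], of C] H[of 0] by simp
  have "continuous_on UNIV H"
    using der by (auto intro!: continuous_at_imp_continuous_on has_derivative_continuous)
  then have Hm [measurable]: "H \<in> borel_measurable borel" by (rule borel_measurable_continuous_onI)
  \<comment> \<open>Peetre's inequality and |s v| <= |v| bound all these translates by one multiple
    of the weight, which serves as dominating function.\<close>
  have shift: "norm (F (y + s *\<^sub>R v)) \<le> (C * (1 + norm v) ^ ?M) * weight y"
    if s: "\<bar>s\<bar> \<le> 1" and F: "\<And>y. norm (F y) * (1 + norm y) ^ ?M \<le> C" for s and F :: "real ^ 'n \<Rightarrow> complex" and y
  proof (rule decay_le_weight)
    have "norm (s *\<^sub>R v) \<le> norm v" using s by (simp add: mult_left_le_one_le)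
    then have "(1 + norm y) ^ ?M \<le> (1 + norm (y + s *\<^sub>R v)) ^ ?M * (1 + norm v) ^ ?M"
      using one_plus_norm_power_shift[where v = "- (s *\<^sub>R v)" and y = y and M = ?M]
        power_mono[of "1 + norm (s *\<^sub>R v)" "1 + norm v" ?M]
      by (smt (verit, ccfv_SIG) diff_minus_eq_add mult_left_mono norm_ge_zero norm_minus_cancel zero_le_power)
    then have "norm (F (y + s *\<^sub>R v)) * (1 + norm y) ^ ?M
        \<le> norm (F (y + s *\<^sub>R v)) * ((1 + norm (y + s *\<^sub>R v)) ^ ?M * (1 + norm v) ^ ?M)"
      by (rule mult_left_mono) simp
    also have "\<dots> \<le> C * (1 + norm v) ^ ?M"
      using mult_right_mono[OF F[of "y + s *\<^sub>R v"], of "(1 + norm v) ^ ?M"] by (simp add: mult.assoc)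
    finally show "norm (F (y + s *\<^sub>R v)) * (1 + norm y) ^ ?M \<le> C * (1 + norm v) ^ ?M" .
  qed (use C in simp)
  have "((\<lambda>s. \<integral>y. H (y + s *\<^sub>R v) \<partial>lborel) has_vector_derivative (\<integral>y. H' (y + 0 *\<^sub>R v) v \<partial>lborel)) (at 0)"
  proof (rule has_vector_derivative_integral)
    fix s :: real and y
    have "((\<lambda>s. H (y + s *\<^sub>R v)) has_derivative (\<lambda>h. H' (y + s *\<^sub>R v) (h *\<^sub>R v))) (at s)"
      by (rule has_derivative_compose[OF _ der]) (auto intro!: derivative_eq_intros)
    moreover have "H' (y + s *\<^sub>R v) (h *\<^sub>R v) = h *\<^sub>R H' (y + s *\<^sub>R v) v" for h
      using linear_cmul[OF has_derivative_linear[OF der]] by simp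
    ultimately show "((\<lambda>s. H (y + s *\<^sub>R v)) has_vector_derivative H' (y + s *\<^sub>R v) v) (at s)"
      by (simp add: has_vector_derivative_def)
  next
    fix s :: real and y :: "real ^ 'n" assume "s \<in> {0 - 1..0 + 1}"
    then show "norm (H' (y + s *\<^sub>R v) v) \<le> (C * (1 + norm v) ^ ?M) * weight y"
      using shift[of s "\<lambda>y. H' y v" y] H' by auto
  next
    fix s :: real
    have "integrable (distr lborel borel ((+) (s *\<^sub>R v))) H"
      using integrable_decay[OF Hm H] by (simp add: lborel_distr_plus)
    then have "integrable lborel (\<lambda>y. H (s *\<^sub>R v + y))"
      by (subst (asm) integrable_distr_eq) auto
    then show "integrable lborel (\<lambda>y. H (y + s *\<^sub>R v))" by (simp add: add.commute)
  next
    show "integrable lborel (\<lambda>y :: real ^ 'n. (C * (1 + norm v) ^ ?M) * weight y)" using integrable_weight[where 'n='n] by simp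
  qed
  moreover have "((\<lambda>s. \<integral>y. H (y + s *\<^sub>R v) \<partial>lborel) has_vector_derivative 0) (at 0)"
    by (simp add: lborel_integral_shift)
  ultimately show ?thesis using vector_derivative_unique_at by fastforce
qed

section \<open>Schwartz functions\<close>

lemma schwartz_differentiable: "schwartz F \<Longrightarrow> iter_partial is F differentiable (at x)"
  by (simp add: schwartz_def)

text \<open>By \<open>norm_power_bound\<close> the multi-index 0 and the multi-indices equal to
  \<open>M\<close> in one coordinate suffice. The constants form a function of the list, so that a
  single choice serves all derivatives.\<close>

lemma schwartz_decay:
  assumes "schwartz (F :: real ^ 'n::finite \<Rightarrow> complex)"
  shows "\<exists>C. \<forall>is y. norm (iter_partial is F y) * (1 + norm y) ^ M \<le> C is"
proof (intro choice allI)
  fix "is" :: "'n list"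
  obtain K where K: "0 < K" "\<And>x :: real ^ 'n. (1 + norm x) ^ M \<le> K * (1 + (\<Sum>i\<in>UNIV. \<bar>x $ i\<bar> ^ M))"
    using norm_power_bound by blast
  have "\<exists>C. \<forall>x. \<bar>\<Prod>i\<in>UNIV. (x $ i) ^ \<alpha> i\<bar> * norm (iter_partial is F x) \<le> C" for \<alpha> :: "'n \<Rightarrow> nat"
    using assms by (auto simp: schwartz_def)
  then obtain C where C: "\<And>\<alpha> x. \<bar>\<Prod>i\<in>UNIV. (x $ i) ^ \<alpha> i\<bar> * norm (iter_partial is F x) \<le> C \<alpha>" by metis
  let ?e = "\<lambda>i j. if j = i then M else 0"
  have "norm (iter_partial is F y) * (1 + norm y) ^ M \<le> K * (C (\<lambda>_. 0) + (\<Sum>i\<in>UNIV. C (?e i)))" for y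
  proof -
    have e: "\<bar>y $ i\<bar> ^ M * norm (iter_partial is F y) \<le> C (?e i)" for i
    proof -
      have "(\<Prod>j\<in>UNIV. (y $ j) ^ ?e i j) = (\<Prod>j\<in>UNIV. if j = i then (y $ i) ^ M else 1)"
        by (intro prod.cong) auto
      then show ?thesis using C[of y "?e i"] by (simp add: power_abs)
    qed
    have "norm (iter_partial is F y) * (1 + norm y) ^ M
        \<le> norm (iter_partial is F y) * (K * (1 + (\<Sum>i\<in>UNIV. \<bar>y $ i\<bar> ^ M)))"
      by (intro mult_left_mono K) simp
    also have "\<dots> = K * (norm (iter_partial is F y) + (\<Sum>i\<in>UNIV. \<bar>y $ i\<bar> ^ M * norm (iter_partial is F y)))"
      by (simp add: algebra_simps sum_distrib_left)
    also have "\<dots> \<le> K * (C (\<lambda>_. 0) + (\<Sum>i\<in>UNIV. C (?e i)))"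
      using K(1) C[of y "\<lambda>_. 0"] by (intro mult_left_mono add_mono sum_mono e) auto
    finally show ?thesis .
  qed
  then show "\<exists>C. \<forall>y. norm (iter_partial is F y) * (1 + norm y) ^ M \<le> C" by blast
qed

lemma partial_derivI:
  assumes "(F has_derivative D) (at x)" shows "partial_deriv i F x = D (axis i 1)"
  using frechet_derivative_at[OF assms] by (simp add: partial_deriv_def)

lemma schwartz_has_derivative:
  "schwartz F \<Longrightarrow> (iter_partial is F has_derivative frechet_derivative (iter_partial is F) (at x)) (at x)"
  by (metis frechet_derivative_works schwartz_differentiable)

lemma schwartz_continuous: "schwartz F \<Longrightarrow> continuous_on A (iter_partial is F)"
  by (meson continuous_at_imp_continuous_on differentiable_imp_continuous_within schwartz_differentiable)

lemma measurable_iter_partial: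
  assumes "\<And>is x. iter_partial is F differentiable (at x)"
  shows "iter_partial is F \<in> borel_measurable borel"
  by (intro borel_measurable_continuous_onI continuous_at_imp_continuous_on ballI differentiable_imp_continuous_within assms)

lemma schwartz_measurable: "schwartz F \<Longrightarrow> F \<in> borel_measurable borel"
  using measurable_iter_partial[of F "[]"] schwartz_differentiable by auto

text \<open>The Leibniz rule for derivatives given by lists: every way to distribute the entries
  over two factors with the order kept, listed with repetition in place of binomial
  coefficients.\<close>

fun splits :: "'a list \<Rightarrow> ('a list \<times> 'a list) list" where
  "splits [] = [([], [])]"
| "splits (i # is) = map (\<lambda>(a, b). (i # a, b)) (splits is) @ map (\<lambda>(a, b). (a, i # b)) (splits is)"

lemma has_derivative_sum_list:
  assumes "\<And>a. a \<in> set l \<Longrightarrow> (f a has_derivative f' a) F"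
  shows "((\<lambda>x. \<Sum>a\<leftarrow>l. f a x) has_derivative (\<lambda>h. \<Sum>a\<leftarrow>l. f' a h)) F"
  using assms by (induction l) (auto intro!: derivative_eq_intros)

lemma iter_partial_mult:
  assumes F: "\<And>is x. iter_partial is F differentiable (at x)" and G: "\<And>is x. iter_partial is G differentiable (at x)"
  shows "iter_partial is (\<lambda>y. F y * G y) = (\<lambda>y. \<Sum>(a, b)\<leftarrow>splits is. iter_partial a F y * iter_partial b G y)"
proof (induction "is")
  case (Cons i "is")
  show ?case
  proof
    fix y
    let ?t = "\<lambda>(a, b) y. iter_partial a F y * iter_partial b G y"
    let ?d = "\<lambda>(a, b) h. iter_partial a F y * frechet_derivative (iter_partial b G) (at y) h
      + frechet_derivative (iter_partial a F) (at y) h * iter_partial b G y"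
    have 1: "((\<lambda>y. \<Sum>p\<leftarrow>splits is. ?t p y) has_derivative (\<lambda>h. \<Sum>p\<leftarrow>splits is. ?d p h)) (at y)"
    proof (rule has_derivative_sum_list, clarify)
      fix a b
      show "((\<lambda>y. iter_partial a F y * iter_partial b G y) has_derivative
          (\<lambda>h. iter_partial a F y * frechet_derivative (iter_partial b G) (at y) h
           + frechet_derivative (iter_partial a F) (at y) h * iter_partial b G y)) (at y)"
        using F G by (intro has_derivative_mult frechet_derivative_works[THEN iffD1])
    qed
    have "iter_partial (i # is) (\<lambda>y. F y * G y) y = partial_deriv i (\<lambda>y. \<Sum>p\<leftarrow>splits is. ?t p y) y"
      using Cons.IH by (simp add: case_prod_unfold)
    also have "\<dots> = (\<Sum>p\<leftarrow>splits is. ?d p (axis i 1))"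
      by (rule partial_derivI[OF 1])
    also have "\<dots> = (\<Sum>(a, b)\<leftarrow>splits (i # is). iter_partial a F y * iter_partial b G y)"
      by (simp add: case_prod_unfold comp_def sum_list_addf partial_deriv_def add.commute)
    finally show "iter_partial (i # is) (\<lambda>y. F y * G y) y = (\<Sum>(a, b)\<leftarrow>splits (i # is). iter_partial a F y * iter_partial b G y)" .
  qed
qed simp

lemma sum_list_differentiable:
  assumes "\<And>a. a \<in> set l \<Longrightarrow> f a differentiable F"
  shows "(\<lambda>x. \<Sum>a\<leftarrow>l. f a x) differentiable F"
  using assms by (induction l) (auto intro!: derivative_intros)

lemma iter_partial_cnj_shift:
  fixes G :: "real ^ 'n::finite \<Rightarrow> complex"
  assumes G: "\<And>is x. iter_partial is G differentiable (at x)"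
  shows "iter_partial is (\<lambda>y. cnj (G (y - z))) = (\<lambda>y. cnj (iter_partial is G (y - z)))"
    and "(\<lambda>y. cnj (iter_partial is G (y - z))) differentiable (at x)"
proof -
  have d: "((\<lambda>y. cnj (iter_partial is G (y - z))) has_derivative
      (\<lambda>h. cnj (frechet_derivative (iter_partial is G) (at (y - z)) h))) (at y)" for "is" y
  proof -
    have "((\<lambda>y. y - z) has_derivative (\<lambda>h. h)) (at y)" by (auto intro!: derivative_eq_intros)
    from has_derivative_compose[OF this frechet_derivative_works[THEN iffD1, OF G]]
    show ?thesis by (rule has_derivative_cnj)
  qed
  show "(\<lambda>y. cnj (iter_partial is G (y - z))) differentiable (at x)" using d by (auto simp: differentiable_def)
  show "iter_partial is (\<lambda>y. cnj (G (y - z))) = (\<lambda>y. cnj (iter_partial is G (y - z)))"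
  proof (induction "is")
    case (Cons i "is")
    show ?case using partial_derivI[OF d[of "is"]] by (simp add: Cons.IH fun_eq_iff) (simp add: partial_deriv_def)
  qed simp
qed

text \<open>Decay in \<open>z\<close> is bought from both factors: (1 + |z|)^M is at most (1 + |y -
  z|)^M (1 + |y|)^M, where the window pays for the first factor. This is why \<open>F\<close> is
  asked for \<open>2 * M\<close> powers, half of them for the decay in \<open>y\<close>.\<close>

lemma stft_product_decay:
  fixes F G :: "real ^ 'n::finite \<Rightarrow> complex"
  assumes F: "schwartz F" and G: "schwartz G"
  shows "\<exists>C. \<forall>is y z. norm (iter_partial is (\<lambda>y. F y * cnj (G (y - z))) y) * (1 + norm y) ^ M * (1 + norm z) ^ M \<le> C is"
proof (intro choice allI)
  fix "is" :: "'n list"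
  have dF: "iter_partial is F differentiable (at x)" and dG: "iter_partial is G differentiable (at x)" for "is" x
    using F G schwartz_differentiable by auto
  have dG': "iter_partial is (\<lambda>y. cnj (G (y - z))) differentiable (at x)" for "is" x z
    unfolding iter_partial_cnj_shift(1)[OF dG] by (rule iter_partial_cnj_shift(2)[OF dG])
  obtain CF where CF: "\<And>a y. norm (iter_partial a F y) * (1 + norm y) ^ (2 * M) \<le> CF a"
    using schwartz_decay[OF F, of "2 * M"] by blast
  obtain CG where CG: "\<And>a y. norm (iter_partial a G y) * (1 + norm y) ^ M \<le> CG a"
    using schwartz_decay[OF G, of M] by blast
  have nn: "0 \<le> CG a" for a
    using order_trans[OF norm_ge_zero[of "iter_partial a G 0"], of "CG a"] CG[of a 0] by simp
  have t: "norm (iter_partial a F y * cnj (iter_partial b G (y - z))) * (1 + norm y) ^ M * (1 + norm z) ^ M \<le> CF a * CG b"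
    for a b y z
  proof -
    have "(1 + norm z) ^ M \<le> (1 + norm (y - z)) ^ M * (1 + norm y) ^ M"
      using one_plus_norm_power_shift[of z M y] by (simp add: norm_minus_commute)
    then have "norm (iter_partial a F y * cnj (iter_partial b G (y - z))) * (1 + norm y) ^ M * (1 + norm z) ^ M
      \<le> norm (iter_partial a F y * cnj (iter_partial b G (y - z))) * (1 + norm y) ^ M * ((1 + norm (y - z)) ^ M * (1 + norm y) ^ M)"
      by (intro mult_left_mono) auto
    also have "\<dots> = (norm (iter_partial a F y) * (1 + norm y) ^ (2 * M)) * (norm (iter_partial b G (y - z)) * (1 + norm (y - z)) ^ M)"
      by (simp add: norm_mult mult_2 mult_2_right power_add mult_ac)
    also have "\<dots> \<le> CF a * CG b"
      using nn by (intro mult_mono' CF CG) auto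
    finally show ?thesis .
  qed
  have "norm (iter_partial is (\<lambda>y. F y * cnj (G (y - z))) y) * (1 + norm y) ^ M * (1 + norm z) ^ M
      \<le> (\<Sum>(a, b)\<leftarrow>splits is. CF a * CG b)" for y z
  proof -
    have "norm (\<Sum>(a, b)\<leftarrow>l. iter_partial a F y * cnj (iter_partial b G (y - z))) * (1 + norm y) ^ M * (1 + norm z) ^ M
        \<le> (\<Sum>(a, b)\<leftarrow>l. CF a * CG b)" for l
    proof (induction l)
      case (Cons p l)
      let ?W = "(1 + norm y) ^ M * (1 + norm z) ^ M"
      obtain a b where p: "p = (a, b)" by force
      have "norm (iter_partial a F y * cnj (iter_partial b G (y - z))
          + (\<Sum>(a, b)\<leftarrow>l. iter_partial a F y * cnj (iter_partial b G (y - z)))) * ?W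
        \<le> (norm (iter_partial a F y * cnj (iter_partial b G (y - z)))
          + norm (\<Sum>(a, b)\<leftarrow>l. iter_partial a F y * cnj (iter_partial b G (y - z)))) * ?W"
        by (intro mult_right_mono norm_triangle_ineq) auto
      also have "\<dots> \<le> CF a * CG b + (\<Sum>(a, b)\<leftarrow>l. CF a * CG b)"
        using t[of a y b z] Cons.IH by (simp add: distrib_right mult.assoc)
      finally show ?case by (simp add: p mult.assoc)
    qed simp
    then show ?thesis
      by (simp add: iter_partial_mult[OF dF dG'] iter_partial_cnj_shift(1)[OF dG])
  qed
  then show "\<exists>C. \<forall>y z. norm (iter_partial is (\<lambda>y. F y * cnj (G (y - z))) y) * (1 + norm y) ^ M * (1 + norm z) ^ M \<le> C"
    by blast
qed

section \<open>Integration by parts and joint decay of the short-time Fourier transform\<close>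

lemma measurable_cis [measurable]: "cis \<in> borel_measurable borel"
  by (intro borel_measurable_continuous_onI continuous_intros)

lemma measurable_cnj [measurable]: "cnj \<in> borel_measurable borel"
  by (intro borel_measurable_continuous_onI continuous_intros)

lemma has_derivative_cis_inner:
  "((\<lambda>y. cis (- 2 * pi * (\<zeta> \<bullet> y))) has_derivative
    (\<lambda>h. - 2 * pi * \<i> * of_real (\<zeta> \<bullet> h) * cis (- 2 * pi * (\<zeta> \<bullet> y)))) (at y)"
proof -
  have "((\<lambda>y. - 2 * pi * (\<zeta> \<bullet> y)) has_derivative (\<lambda>h. - 2 * pi * (\<zeta> \<bullet> h))) (at y)"
    by (auto intro!: derivative_eq_intros)
  from has_derivative_cis[OF this] show ?thesis
    by (rule has_derivative_eq_rhs) (auto simp: fun_eq_iff scaleR_conv_of_real)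
qed

text \<open>The derivative of the exponential times the previous iterate has integral zero, so every
  further derivative releases one factor 2 pi i \<zeta>_i.\<close>

lemma integral_iter_partial_cis:
  fixes F :: "real ^ 'n::finite \<Rightarrow> complex"
  assumes d: "\<And>is x. iter_partial is F differentiable (at x)"
    and b: "\<And>is. \<exists>C. \<forall>y. norm (iter_partial is F y) * (1 + norm y) ^ (2 * CARD('n)) \<le> C"
  shows "(\<integral>y. cis (- 2 * pi * (\<zeta> \<bullet> y)) * iter_partial (replicate m i) F y \<partial>lborel)
    = (2 * pi * \<i> * of_real (\<zeta> $ i)) ^ m * (\<integral>y. cis (- 2 * pi * (\<zeta> \<bullet> y)) * F y \<partial>lborel)"
proof (induction m)
  case (Suc m)
  let ?D = "iter_partial (replicate m i) F" and ?D' = "iter_partial (replicate (Suc m) i) F"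
  let ?e = "\<lambda>y. cis (- 2 * pi * (\<zeta> \<bullet> y))"
  let ?H' = "\<lambda>y h. ?e y * frechet_derivative ?D (at y) h + (- 2 * pi * \<i> * of_real (\<zeta> \<bullet> h) * ?e y) * ?D y"
  obtain C1 where C1: "\<And>y. norm (?D y) * (1 + norm y) ^ (2 * CARD('n)) \<le> C1" using b by blast
  obtain C2 where C2: "\<And>y. norm (?D' y) * (1 + norm y) ^ (2 * CARD('n)) \<le> C2" using b by blast
  have C10: "0 \<le> C1" using order_trans[OF norm_ge_zero[of "?D 0"], of C1] C1[of 0] by simp
  have C20: "0 \<le> C2" using order_trans[OF norm_ge_zero[of "?D' 0"], of C2] C2[of 0] by simp
  note [measurable] = measurable_iter_partial[OF d]
  have der: "((\<lambda>y. ?e y * ?D y) has_derivative ?H' y) (at y)" for y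
    by (intro has_derivative_mult has_derivative_cis_inner frechet_derivative_works[THEN iffD1] d)
  have eq: "?H' y (axis i 1) = ?e y * ?D' y - (2 * pi * \<i> * of_real (\<zeta> $ i)) * (?e y * ?D y)" for y
    by (simp add: partial_deriv_def inner_axis algebra_simps)
  have i1: "integrable lborel (\<lambda>y. ?e y * ?D y)"
    by (rule integrable_decay[where C = C1]) (use C1 in \<open>simp_all add: norm_mult\<close>)
  have i2: "integrable lborel (\<lambda>y. ?e y * ?D' y)"
    by (rule integrable_decay[where C = C2]) (use C2 in \<open>simp_all add: norm_mult del: iter_partial.simps replicate_Suc\<close>)
  have "(\<integral>y. ?H' y (axis i 1) \<partial>lborel) = 0"
  proof (rule integral_directional_derivative_eq_0[OF der, where C = "C2 + 2 * pi * \<bar>\<zeta> $ i\<bar> * C1 + C1"])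
    fix y
    show "norm (?e y * ?D y) * (1 + norm y) ^ (2 * CARD('n)) \<le> C2 + 2 * pi * \<bar>\<zeta> $ i\<bar> * C1 + C1"
      using C1[of y] C10 C20 by (simp add: norm_mult add_increasing)
    have "norm (?H' y (axis i 1)) \<le> norm (?D' y) + 2 * pi * \<bar>\<zeta> $ i\<bar> * norm (?D y)"
      unfolding eq by (rule order_trans[OF norm_triangle_ineq4]) (simp add: norm_mult)
    then have "norm (?H' y (axis i 1)) * (1 + norm y) ^ (2 * CARD('n))
        \<le> (norm (?D' y) + 2 * pi * \<bar>\<zeta> $ i\<bar> * norm (?D y)) * (1 + norm y) ^ (2 * CARD('n))"
      by (rule mult_right_mono) simp
    also have "\<dots> = norm (?D' y) * (1 + norm y) ^ (2 * CARD('n)) + 2 * pi * \<bar>\<zeta> $ i\<bar> * (norm (?D y) * (1 + norm y) ^ (2 * CARD('n)))"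
      by (simp only: distrib_right mult.assoc)
    also have "\<dots> \<le> C2 + 2 * pi * \<bar>\<zeta> $ i\<bar> * C1" by (intro add_mono C2 mult_left_mono C1) simp
    finally show "norm (?H' y (axis i 1)) * (1 + norm y) ^ (2 * CARD('n)) \<le> C2 + 2 * pi * \<bar>\<zeta> $ i\<bar> * C1 + C1"
      using C10 by simp
  qed
  then have "(\<integral>y. ?e y * ?D' y \<partial>lborel) = (2 * pi * \<i> * of_real (\<zeta> $ i)) * (\<integral>y. ?e y * ?D y \<partial>lborel)"
    unfolding eq using i1 i2 by (simp del: iter_partial.simps replicate_Suc)
  then show ?case using Suc.IH by (simp del: iter_partial.simps replicate_Suc)
qed simp

text \<open>The decay in \<open>z\<close> comes from the product of function and shifted window, the
  decay in \<zeta> from \<open>2 * CARD('n)\<close> integrations by parts in each coordinate. This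
  is the only decay estimate for wave packets that the later counting uses.\<close>

lemma stft_weight_bound:
  fixes F G :: "real ^ 'n::finite \<Rightarrow> complex"
  assumes F: "schwartz F" and G: "schwartz G"
  obtains C where "0 < C" "\<And>z \<zeta>. norm (stft G F z \<zeta>) \<le> C * (weight z * weight \<zeta>)"
proof -
  let ?M = "2 * CARD('n)"
  let ?P = "\<lambda>z y. F y * cnj (G (y - z))"
  have dF: "iter_partial is F differentiable (at x)" and dG: "iter_partial is G differentiable (at x)" for "is" x
    using F G schwartz_differentiable by auto
  have d: "iter_partial is (?P z) differentiable (at x)" for "is" x z
  proof -
    have dG': "iter_partial is (\<lambda>y. cnj (G (y - z))) differentiable (at x)" for "is" x
      unfolding iter_partial_cnj_shift(1)[OF dG] by (rule iter_partial_cnj_shift(2)[OF dG])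
    show ?thesis unfolding iter_partial_mult[OF dF dG']
      by (intro sum_list_differentiable) (auto simp: case_prod_unfold intro!: differentiable_mult dF dG')
  qed
  obtain C where C: "\<And>is y z. norm (iter_partial is (?P z) y) * (1 + norm y) ^ ?M * (1 + norm z) ^ ?M \<le> C is"
    using stft_product_decay[OF F G, of ?M] by blast
  have C0: "0 \<le> C is" for "is"
    by (rule order_trans[OF _ C[of "is" 0 0]]) simp
  have b: "norm (iter_partial is (?P z) y) * (1 + norm y) ^ ?M \<le> C is" for "is" y z
    using C[of "is" z y] mult_left_mono[of 1 "(1 + norm z) ^ ?M" "norm (iter_partial is (?P z) y) * (1 + norm y) ^ ?M"]
    by simp
  have b': "\<exists>C. \<forall>y. norm (iter_partial is (?P z) y) * (1 + norm y) ^ ?M \<le> C" for "is" z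
    using b by blast
  obtain I where I: "0 < I" "(\<integral>\<^sup>+x. ennreal (weight (x - 0 :: real ^ 'n)) \<partial>lborel) = ennreal I"
    using weight_shift_integral[where 'n='n] by metis
  have wI: "(\<integral>x. weight (x :: real ^ 'n) \<partial>lborel) = I"
    using I integral_eq_nn_integral[of weight "lborel :: (real ^ 'n) measure"] by simp
  have int: "integrable lborel (\<lambda>y. cis (- 2 * pi * (\<zeta> \<bullet> y)) * iter_partial is (?P z) y)" for z \<zeta> "is"
    by (rule integrable_decay[where C = "C is"]) (use b measurable_iter_partial[OF d] in \<open>simp_all add: norm_mult\<close>)
  have Q: "norm (\<integral>y. cis (- 2 * pi * (\<zeta> \<bullet> y)) * iter_partial is (?P z) y \<partial>lborel) * (1 + norm z) ^ ?M \<le> C is * I" for z \<zeta> "is"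
  proof -
    have pos: "0 < (1 + norm z) ^ ?M" by (simp add: add_pos_nonneg)
    have "norm (iter_partial is (?P z) y) \<le> (C is / (1 + norm z) ^ ?M) * weight y" for y
      using C[of "is" z y] pos C0 by (intro decay_le_weight) (simp_all add: field_simps)
    then have "norm (\<integral>y. cis (- 2 * pi * (\<zeta> \<bullet> y)) * iter_partial is (?P z) y \<partial>lborel) \<le> (\<integral>y. (C is / (1 + norm z) ^ ?M) * weight (y :: real ^ 'n) \<partial>lborel)"
      using integrable_weight[where 'n='n] C0 int
      by (intro Bochner_Integration.integral_norm_bound_integral) (simp_all add: norm_mult)
    also have "\<dots> = C is / (1 + norm z) ^ ?M * I" using wI by simp
    finally show ?thesis using pos by (simp add: field_simps)
  qed
  have V: "stft G F z \<zeta> = (\<integral>y. cis (- 2 * pi * (\<zeta> \<bullet> y)) * ?P z y \<partial>lborel)" for z \<zeta>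
    by (simp add: stft_def mult.assoc)
  have D: "\<bar>\<zeta> $ i\<bar> ^ m * (norm (stft G F z \<zeta>) * (1 + norm z) ^ ?M) \<le> C (replicate m i) * I" for z \<zeta> i m
  proof -
    have "\<bar>\<zeta> $ i\<bar> ^ m \<le> (2 * pi * \<bar>\<zeta> $ i\<bar>) ^ m"
      using pi_ge_two by (intro power_mono) (auto simp: mult_le_cancel_right1)
    then have "\<bar>\<zeta> $ i\<bar> ^ m * (norm (stft G F z \<zeta>) * (1 + norm z) ^ ?M) \<le> (2 * pi * \<bar>\<zeta> $ i\<bar>) ^ m * (norm (stft G F z \<zeta>) * (1 + norm z) ^ ?M)"
      by (rule mult_right_mono) simp
    also have "\<dots> = norm (\<integral>y. cis (- 2 * pi * (\<zeta> \<bullet> y)) * iter_partial (replicate m i) (?P z) y \<partial>lborel) * (1 + norm z) ^ ?M"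
      using integral_iter_partial_cis[where \<zeta> = \<zeta> and m = m and i = i and F = "?P z", OF d b']
      by (simp add: V norm_mult norm_power)
    also have "\<dots> \<le> C (replicate m i) * I" by (rule Q)
    finally show ?thesis .
  qed
  obtain K where K: "0 < K" "\<And>x :: real ^ 'n. (1 + norm x) ^ ?M \<le> K * (1 + (\<Sum>i\<in>UNIV. \<bar>x $ i\<bar> ^ ?M))"
    using norm_power_bound by blast
  define B where "B = K * (C [] * I + (\<Sum>i\<in>UNIV. C (replicate ?M i) * I))"
  have B: "0 \<le> B" using K C0 I by (simp add: B_def sum_nonneg)
  have "norm (stft G F z \<zeta>) \<le> (B + 1) * (weight z * weight \<zeta>)" for z \<zeta>
  proof -
    let ?v = "norm (stft G F z \<zeta>) * (1 + norm z) ^ ?M"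
    have "?v * (1 + norm \<zeta>) ^ ?M \<le> ?v * (K * (1 + (\<Sum>i\<in>UNIV. \<bar>\<zeta> $ i\<bar> ^ ?M)))"
      by (intro mult_left_mono K) simp
    also have "\<dots> = K * (?v + (\<Sum>i\<in>UNIV. \<bar>\<zeta> $ i\<bar> ^ ?M * ?v))"
      unfolding sum_distrib_right[symmetric] by (simp only: distrib_left distrib_right mult_1_right mult.commute mult.left_commute)
    \<comment> \<open>For the exponent 0 the bound \<open>D\<close> reads the same on the left for
      every coordinate, hence \<open>undefined\<close>; the list of derivatives is then
      empty.\<close>
    also have "\<dots> \<le> B" unfolding B_def
      using K(1) D[of \<zeta> undefined 0 z] by (intro mult_left_mono add_mono sum_mono D) auto
    finally have "?v \<le> B * weight \<zeta>" by (rule decay_le_weight) (rule B)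
    then have "norm (stft G F z \<zeta>) \<le> (B * weight \<zeta>) * weight z" by (rule decay_le_weight) (use B in simp)
    also have "\<dots> \<le> (B + 1) * (weight z * weight \<zeta>)" by (simp add: algebra_simps)
    finally show ?thesis .
  qed
  then show ?thesis using that[of "B + 1"] B by auto
qed

section \<open>Gaussian wave packets\<close>

text \<open>The complex parameter makes the family closed under both operations at work: the Fourier
  transform replaces \<open>w\<close> by \<open>1 / w\<close>, a quadratic phase shifts its
  imaginary part. Decay depends on \<open>Re w\<close> alone.\<close>

definition gauss :: "complex \<Rightarrow> real ^ 'n::finite \<Rightarrow> complex" where
  "gauss w x = exp (- (of_real pi * w * of_real (x \<bullet> x)))"

definition packet :: "complex \<Rightarrow> real ^ 'n \<Rightarrow> real ^ 'n \<Rightarrow> real ^ 'n::finite \<Rightarrow> complex" where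
  "packet w x0 \<xi>0 x = cis (2 * pi * (\<xi>0 \<bullet> x)) * gauss w (x - x0)"

lemma packet_0: "packet w 0 0 = gauss w"
  by (simp add: packet_def fun_eq_iff)

lemma norm_gauss: "norm (gauss w x) = exp (- (pi * Re w * (x \<bullet> x)))"
  by (simp add: gauss_def)

lemma norm_packet: "norm (packet w x0 \<xi>0 x) = norm (gauss w (x - x0))"
  by (simp add: packet_def norm_mult)

lemma gauss_minus: "gauss w (- x) = gauss w x"
  by (simp add: gauss_def)

lemma continuous_gauss: "continuous_on A (gauss w)"
  unfolding gauss_def by (intro continuous_intros)

lemma measurable_gauss [measurable]: "gauss w \<in> borel_measurable borel"
  by (intro borel_measurable_continuous_onI continuous_gauss)

lemma measurable_packet [measurable]: "packet w x0 \<xi>0 \<in> borel_measurable borel"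
  unfolding packet_def by measurable

lemma packet_decay:
  assumes w: "0 < Re w"
  shows "\<exists>C. \<forall>x. norm (packet w x0 \<xi>0 x) * (1 + norm x) ^ m \<le> C"
proof (intro exI allI)
  fix x
  let ?r = "norm (x - x0)" and ?a = "pi * Re w"
  have a: "0 < ?a" using w by simp
  have "(1 + norm x) ^ m \<le> (1 + ?r) ^ m * (1 + norm x0) ^ m" by (rule one_plus_norm_power_shift)
  also have "(1 + ?r) ^ m \<le> exp ?r ^ m" by (intro power_mono) auto
  finally have 1: "(1 + norm x) ^ m \<le> exp (m * ?r) * (1 + norm x0) ^ m"
    by (simp add: exp_of_nat_mult mult_right_mono)
  \<comment> \<open>Completing the square: the exponent m r - a r^2, left after 1 + r <= exp r, is
    at most m^2 / (4 a).\<close>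
  have "0 \<le> (2 * ?a * ?r - m)\<^sup>2" by simp
  then have "4 * ?a * (m * ?r - ?a * ?r\<^sup>2) \<le> m\<^sup>2" by (simp add: power2_eq_square algebra_simps)
  then have 2: "m * ?r - ?a * ?r\<^sup>2 \<le> m\<^sup>2 / (4 * ?a)" using a by (subst pos_le_divide_eq) (auto simp: mult.commute)
  have "norm (packet w x0 \<xi>0 x) * (1 + norm x) ^ m \<le> exp (- (?a * ?r\<^sup>2)) * (exp (m * ?r) * (1 + norm x0) ^ m)"
    unfolding norm_packet norm_gauss power2_norm_eq_inner by (intro mult_left_mono 1) simp
  also have "\<dots> = exp (m * ?r - ?a * ?r\<^sup>2) * (1 + norm x0) ^ m"
    by (simp add: exp_diff exp_minus field_simps)
  also have "\<dots> \<le> exp (m\<^sup>2 / (4 * ?a)) * (1 + norm x0) ^ m"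
    using 2 by (intro mult_right_mono) auto
  finally show "norm (packet w x0 \<xi>0 x) * (1 + norm x) ^ m \<le> exp (m\<^sup>2 / (4 * ?a)) * (1 + norm x0) ^ m" .
qed

section \<open>Wave packets are Schwartz functions\<close>

lemma has_derivative_gauss:
  "(gauss w has_derivative (\<lambda>h. - (2 * of_real pi * w * of_real (x \<bullet> h)) * gauss w x)) (at x)"
proof -
  have "((\<lambda>x. - (of_real pi * w * of_real (x \<bullet> x))) has_derivative (\<lambda>h. - (2 * of_real pi * w * of_real (x \<bullet> h)))) (at x)"
    by (auto intro!: derivative_eq_intros simp: inner_commute algebra_simps)
  from has_derivative_compose[OF this DERIV_exp[THEN has_field_derivative_imp_has_derivative]]
  show ?thesis unfolding gauss_def
    by (rule has_derivative_eq_rhs) (simp add: fun_eq_iff mult_ac)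
qed

lemma has_derivative_packet:
  "(packet w x0 \<xi>0 has_derivative
    (\<lambda>h. (2 * pi * \<i> * of_real (\<xi>0 \<bullet> h) - 2 * of_real pi * w * of_real ((x - x0) \<bullet> h)) * packet w x0 \<xi>0 x)) (at x)"
proof -
  have "((\<lambda>x. x - x0) has_derivative (\<lambda>h. h)) (at x)" by (auto intro!: derivative_eq_intros)
  from has_derivative_compose[OF this has_derivative_gauss]
  have 1: "((\<lambda>x. gauss w (x - x0)) has_derivative
    (\<lambda>h. - (2 * of_real pi * w * of_real ((x - x0) \<bullet> h)) * gauss w (x - x0))) (at x)" .
  have 2: "((\<lambda>x. cis (2 * pi * (\<xi>0 \<bullet> x))) has_derivative
      (\<lambda>h. 2 * pi * \<i> * of_real (\<xi>0 \<bullet> h) * cis (2 * pi * (\<xi>0 \<bullet> x)))) (at x)"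
    using has_derivative_cis_inner[of "- \<xi>0" x] by simp
  show ?thesis unfolding packet_def
    by (rule has_derivative_eq_rhs[OF has_derivative_mult[OF 2 1]]) (simp add: fun_eq_iff algebra_simps)
qed

text \<open>Polynomials, described only by how they are generated. What is needed is closure under
  partial derivatives and polynomial growth, and both follow by rule induction.\<close>

inductive_set poly_funs :: "(real ^ 'n::finite \<Rightarrow> complex) set" where
  const: "(\<lambda>x. c) \<in> poly_funs"
| coord: "(\<lambda>x. of_real (x $ i)) \<in> poly_funs"
| add: "P \<in> poly_funs \<Longrightarrow> Q \<in> poly_funs \<Longrightarrow> (\<lambda>x. P x + Q x) \<in> poly_funs"
| mult: "P \<in> poly_funs \<Longrightarrow> Q \<in> poly_funs \<Longrightarrow> (\<lambda>x. P x * Q x) \<in> poly_funs"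

lemma poly_funs_derivative:
  "P \<in> poly_funs \<Longrightarrow> \<exists>D. \<forall>x. (P has_derivative D x) (at x) \<and> (\<forall>i. (\<lambda>x. D x (axis i 1)) \<in> poly_funs)"
proof (induction rule: poly_funs.induct)
  case (const c)
  show ?case by (rule exI[of _ "\<lambda>x h. 0"]) (auto intro: poly_funs.const)
next
  case (coord i)
  show ?case
    by (rule exI[of _ "\<lambda>x h. of_real (h $ i)"])
      (auto intro!: poly_funs.const bounded_linear_imp_has_derivative bounded_linear_compose[OF bounded_linear_of_real bounded_linear_vec_nth])
next
  case (add P Q)
  then obtain D D' where "\<And>x. (P has_derivative D x) (at x)" "\<And>i. (\<lambda>x. D x (axis i 1)) \<in> poly_funs"
    "\<And>x. (Q has_derivative D' x) (at x)" "\<And>i. (\<lambda>x. D' x (axis i 1)) \<in> poly_funs" by blast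
  then show ?case
    by (intro exI[of _ "\<lambda>x h. D x h + D' x h"] allI conjI has_derivative_add poly_funs.add) auto
next
  case (mult P Q)
  then obtain D D' where "\<And>x. (P has_derivative D x) (at x)" "\<And>i. (\<lambda>x. D x (axis i 1)) \<in> poly_funs"
    "\<And>x. (Q has_derivative D' x) (at x)" "\<And>i. (\<lambda>x. D' x (axis i 1)) \<in> poly_funs" by blast
  with mult show ?case
    by (intro exI[of _ "\<lambda>x h. P x * D' x h + D x h * Q x"] allI conjI has_derivative_mult poly_funs.add poly_funs.mult) auto
qed

lemma poly_funs_bound:
  "P \<in> poly_funs \<Longrightarrow> \<exists>C m. \<forall>x. norm (P x) \<le> C * (1 + norm x) ^ m"
proof (induction rule: poly_funs.induct)
  case (const c)
  show ?case by (rule exI[of _ "norm c"], rule exI[of _ 0]) simp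
next
  case (coord i)
  show ?case by (rule exI[of _ 1], rule exI[of _ 1]) (auto intro: order_trans[OF component_le_norm_cart])
next
  case (add P Q)
  then obtain C m C' m' where P: "\<And>x. norm (P x) \<le> C * (1 + norm x) ^ m" and Q: "\<And>x. norm (Q x) \<le> C' * (1 + norm x) ^ m'"
    by blast
  have "norm (P x + Q x) \<le> (\<bar>C\<bar> + \<bar>C'\<bar>) * (1 + norm x) ^ (max m m')" for x
  proof -
    have "norm (P x) \<le> \<bar>C\<bar> * (1 + norm x) ^ max m m'"
      by (rule order_trans[OF P]) (intro mult_mono power_increasing, auto)
    moreover have "norm (Q x) \<le> \<bar>C'\<bar> * (1 + norm x) ^ max m m'"
      by (rule order_trans[OF Q]) (intro mult_mono power_increasing, auto)
    ultimately show ?thesis using norm_triangle_ineq[of "P x" "Q x"] by (simp add: distrib_right)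
  qed
  then show ?case by blast
next
  case (mult P Q)
  then obtain C m C' m' where P: "\<And>x. norm (P x) \<le> C * (1 + norm x) ^ m" and Q: "\<And>x. norm (Q x) \<le> C' * (1 + norm x) ^ m'"
    by blast
  have "norm (P x * Q x) \<le> (C * C') * (1 + norm x) ^ (m + m')" for x
    using mult_mono'[OF P[of x] Q[of x]] by (simp add: norm_mult power_add mult_ac)
  then show ?case by blast
qed

lemma iter_partial_packet:
  "\<exists>P\<in>poly_funs. iter_partial is (packet w x0 \<xi>0) = (\<lambda>x. P x * packet w x0 \<xi>0 x)"
proof (induction "is")
  case Nil
  show ?case by (rule bexI[OF _ poly_funs.const[of 1]]) simp
next
  case (Cons i "is")
  then obtain P where P: "P \<in> poly_funs" and eq: "iter_partial is (packet w x0 \<xi>0) = (\<lambda>x. P x * packet w x0 \<xi>0 x)" by blast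
  obtain D where D: "\<And>x. (P has_derivative D x) (at x)" "\<And>i. (\<lambda>x. D x (axis i 1)) \<in> poly_funs"
    using poly_funs_derivative[OF P] by blast
  \<comment> \<open>The factor multiplying \<open>P x\<close> is the logarithmic derivative of the
    packet in direction \<open>i\<close>, an affine function of \<open>x\<close>.\<close>
  let ?Q = "\<lambda>x. D x (axis i 1) + P x * ((2 * pi * \<i> * of_real (\<xi>0 $ i) + 2 * of_real pi * w * of_real (x0 $ i))
      + - (2 * of_real pi * w) * of_real (x $ i))"
  have "?Q \<in> poly_funs" by (intro poly_funs.intros P D)
  moreover have "iter_partial (i # is) (packet w x0 \<xi>0) x = ?Q x * packet w x0 \<xi>0 x" for x
    unfolding iter_partial.simps eq
    by (subst partial_derivI[OF has_derivative_mult[OF D(1) has_derivative_packet]])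
      (simp add: inner_axis algebra_simps)
  ultimately show ?case by (intro bexI[of _ ?Q] ext)
qed

lemma abs_prod_coordinates_le: "\<bar>\<Prod>i\<in>UNIV. (x $ i) ^ \<alpha> i\<bar> \<le> (1 + norm x) ^ (\<Sum>i\<in>UNIV. \<alpha> i)" for x :: "real ^ 'n::finite"
proof -
  have "\<bar>\<Prod>i\<in>UNIV. (x $ i) ^ \<alpha> i\<bar> = (\<Prod>i\<in>UNIV. \<bar>x $ i\<bar> ^ \<alpha> i)" by (simp add: abs_prod power_abs)
  also have "\<dots> \<le> (\<Prod>i\<in>UNIV. (1 + norm x) ^ \<alpha> i)"
    by (intro prod_mono conjI power_mono) (auto intro: order_trans[OF component_le_norm_cart])
  finally show ?thesis by (simp add: power_sum)
qed

lemma schwartz_packet: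
  fixes x0 :: "real ^ 'n::finite"
  assumes "0 < Re w" shows "schwartz (packet w x0 \<xi>0)"
  unfolding schwartz_def
proof (intro conjI allI)
  fix "is" :: "'n list" and x :: "real ^ 'n" and \<alpha> :: "'n \<Rightarrow> nat"
  obtain P where P: "P \<in> poly_funs" and eq: "iter_partial is (packet w x0 \<xi>0) = (\<lambda>x. P x * packet w x0 \<xi>0 x)"
    using iter_partial_packet by blast
  obtain D where "\<And>x. (P has_derivative D x) (at x)" using poly_funs_derivative[OF P] by blast
  then show "iter_partial is (packet w x0 \<xi>0) differentiable (at x)"
    unfolding eq differentiable_def using has_derivative_mult has_derivative_packet by blast
  obtain C m where C: "\<And>x. norm (P x) \<le> C * (1 + norm x) ^ m" using poly_funs_bound[OF P] by blast
  obtain C' where C': "\<And>x. norm (packet w x0 \<xi>0 x) * (1 + norm x) ^ ((\<Sum>i\<in>UNIV. \<alpha> i) + m) \<le> C'"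
    using packet_decay[OF assms] by blast
  have "C \<ge> 0" using order_trans[OF norm_ge_zero C[of 0]] by simp
  have "\<bar>\<Prod>i\<in>UNIV. (x $ i) ^ \<alpha> i\<bar> * norm (iter_partial is (packet w x0 \<xi>0) x) \<le> C * C'" for x
  proof -
    have "\<bar>\<Prod>i\<in>UNIV. (x $ i) ^ \<alpha> i\<bar> * norm (iter_partial is (packet w x0 \<xi>0) x)
      \<le> (1 + norm x) ^ (\<Sum>i\<in>UNIV. \<alpha> i) * ((C * (1 + norm x) ^ m) * norm (packet w x0 \<xi>0 x))"
      unfolding eq norm_mult by (intro mult_mono abs_prod_coordinates_le mult_right_mono C) auto
    also have "\<dots> = C * (norm (packet w x0 \<xi>0 x) * (1 + norm x) ^ ((\<Sum>i\<in>UNIV. \<alpha> i) + m))"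
      by (simp add: power_add mult_ac)
    also have "\<dots> \<le> C * C'" by (intro mult_left_mono C' \<open>C \<ge> 0\<close>)
    finally show ?thesis .
  qed
  then show "\<exists>C. \<forall>x. \<bar>\<Prod>i\<in>UNIV. (x $ i) ^ \<alpha> i\<bar> * norm (iter_partial is (packet w x0 \<xi>0) x) \<le> C" by blast
qed

lemma schwartz_sum:
  fixes F :: "'k \<Rightarrow> real ^ 'n::finite \<Rightarrow> complex"
  assumes K: "finite K" and F: "\<And>k. k \<in> K \<Longrightarrow> schwartz (F k)"
  shows "schwartz (\<lambda>x. \<Sum>k\<in>K. F k x)"
proof -
  have eq: "iter_partial is (\<lambda>x. \<Sum>k\<in>K. F k x) = (\<lambda>x. \<Sum>k\<in>K. iter_partial is (F k) x)" for "is"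
  proof (induction "is")
    case (Cons i "is")
    have "((\<lambda>x. \<Sum>k\<in>K. iter_partial is (F k) x) has_derivative
        (\<lambda>h. \<Sum>k\<in>K. frechet_derivative (iter_partial is (F k)) (at x) h)) (at x)" for x
      using F by (intro has_derivative_sum schwartz_has_derivative)
    from partial_derivI[OF this] show ?case
      unfolding iter_partial.simps Cons.IH by (simp add: fun_eq_iff partial_deriv_def)
  qed simp
  show ?thesis unfolding schwartz_def eq
  proof (intro conjI allI)
    fix "is" :: "'n list" and x :: "real ^ 'n"
    show "(\<lambda>x. \<Sum>k\<in>K. iter_partial is (F k) x) differentiable (at x)"
      using K by (intro differentiable_sum) (auto intro!: schwartz_differentiable F)
  next
    fix \<alpha> :: "'n \<Rightarrow> nat" and "is" :: "'n list"
    have "\<forall>k\<in>K. \<exists>C. \<forall>x. \<bar>\<Prod>i\<in>UNIV. (x $ i) ^ \<alpha> i\<bar> * norm (iter_partial is (F k) x) \<le> C"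
      using F by (auto simp: schwartz_def)
    then obtain C where C: "\<And>k x. k \<in> K \<Longrightarrow> \<bar>\<Prod>i\<in>UNIV. (x $ i) ^ \<alpha> i\<bar> * norm (iter_partial is (F k) x) \<le> C k"
      by metis
    have "\<bar>\<Prod>i\<in>UNIV. (x $ i) ^ \<alpha> i\<bar> * norm (\<Sum>k\<in>K. iter_partial is (F k) x) \<le> (\<Sum>k\<in>K. C k)" for x
    proof -
      have "\<bar>\<Prod>i\<in>UNIV. (x $ i) ^ \<alpha> i\<bar> * norm (\<Sum>k\<in>K. iter_partial is (F k) x)
          \<le> \<bar>\<Prod>i\<in>UNIV. (x $ i) ^ \<alpha> i\<bar> * (\<Sum>k\<in>K. norm (iter_partial is (F k) x))"
        by (intro mult_left_mono norm_sum) simp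
      also have "\<dots> \<le> (\<Sum>k\<in>K. C k)" unfolding sum_distrib_left by (intro sum_mono C)
      finally show ?thesis .
    qed
    then show "\<exists>C. \<forall>x. \<bar>\<Prod>i\<in>UNIV. (x $ i) ^ \<alpha> i\<bar> * norm (\<Sum>k\<in>K. iter_partial is (F k) x) \<le> C" by blast
  qed
qed

section \<open>Fourier transforms of Gaussians\<close>

text \<open>Mathematically the branch of w^(-d/2) that is positive for positive \<open>w\<close>.
  The type argument fixes the dimension, which \<open>w\<close> does not determine.\<close>

definition gauss_mass :: "'n::finite itself \<Rightarrow> complex \<Rightarrow> complex" where
  "gauss_mass _ w = (\<integral>y. gauss w (y :: real ^ 'n) \<partial>lborel)"

lemma gauss_decay:
  assumes "0 < Re w" shows "\<exists>C. \<forall>x. norm (gauss w x) * (1 + norm x) ^ m \<le> C"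
  using packet_decay[OF assms, of 0 0 m] by (simp add: packet_0)

lemma integrable_poly_gauss:
  fixes P :: "real ^ 'n::finite \<Rightarrow> complex"
  assumes w: "0 < Re w" and P: "P \<in> borel_measurable borel" "\<And>x. norm (P x) \<le> B * (1 + norm x) ^ m"
  shows "integrable lborel (\<lambda>y. P y * gauss w y)"
    and "\<exists>C. \<forall>y. norm (P y * gauss w y) * (1 + norm y) ^ (2 * CARD('n)) \<le> C"
proof -
  obtain C where C: "\<And>x :: real ^ 'n. norm (gauss w x) * (1 + norm x) ^ (m + 2 * CARD('n)) \<le> C"
    using gauss_decay[OF w] by blast
  have B: "0 \<le> B" using order_trans[OF norm_ge_zero P(2)[of 0]] by simp
  have b: "norm (P y * gauss w y) * (1 + norm y) ^ (2 * CARD('n)) \<le> B * C" for y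
  proof -
    have "norm (P y * gauss w y) * (1 + norm y) ^ (2 * CARD('n))
        \<le> (B * (1 + norm y) ^ m * norm (gauss w y)) * (1 + norm y) ^ (2 * CARD('n))"
      unfolding norm_mult by (intro mult_right_mono P) auto
    also have "\<dots> = B * (norm (gauss w y) * (1 + norm y) ^ (m + 2 * CARD('n)))" by (simp add: power_add mult_ac)
    also have "\<dots> \<le> B * C" by (intro mult_left_mono C B)
    finally show ?thesis .
  qed
  show "integrable lborel (\<lambda>y. P y * gauss w y)" using P(1) by (intro integrable_decay[OF _ b]) simp
  show "\<exists>C. \<forall>y. norm (P y * gauss w y) * (1 + norm y) ^ (2 * CARD('n)) \<le> C" using b by blast
qed

lemma integrable_gauss: "0 < Re w \<Longrightarrow> integrable lborel (gauss w)"
  using integrable_poly_gauss(1)[of w "\<lambda>_. 1" 1 0] by simp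

text \<open>Restriction to the ray through \<xi> reduces the transform in all dimensions to a linear
  differential equation in one real variable. Differentiation in \<open>s\<close> produces the
  factor \<open>\<xi> \<bullet> y\<close>; the integral of the derivative of the integrand in
  direction \<xi> vanishes, which expresses the new integral by the old one.\<close>

lemma gauss_fourier_ray:
  fixes \<xi> :: "real ^ 'n::finite" and w :: complex
  assumes w: "0 < Re w"
  defines "J \<equiv> (\<lambda>s::real. \<integral>y. cis (- 2 * pi * ((s *\<^sub>R \<xi>) \<bullet> y)) * gauss w y \<partial>lborel)"
  shows "(J has_vector_derivative - (2 * pi * s * (\<xi> \<bullet> \<xi>) / w) * J s) (at s)"
proof -
  let ?e = "\<lambda>s y. cis (- 2 * pi * ((s *\<^sub>R \<xi>) \<bullet> y))"
  let ?H = "\<lambda>y. ?e s y * gauss w y"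
  let ?L = "\<lambda>y. of_real (\<xi> \<bullet> y) * ?H y"
  have w0: "w \<noteq> 0" using w by auto
  have lin: "\<bar>\<xi> \<bullet> y\<bar> \<le> norm \<xi> * (1 + norm y) ^ 1" for y
    using Cauchy_Schwarz_ineq2[of \<xi> y] by (simp add: distrib_left add_increasing)
  have iL: "integrable lborel (\<lambda>y. of_real (\<xi> \<bullet> y) * ?e s y * gauss w y)"
    and dL: "\<exists>C. \<forall>y. norm (of_real (\<xi> \<bullet> y) * ?e s y * gauss w y) * (1 + norm y) ^ (2 * CARD('n)) \<le> C" for s
    by (rule integrable_poly_gauss[OF w, of _ "norm \<xi>" 1]; use lin in \<open>simp add: norm_mult\<close>)+
  have iH: "integrable lborel (\<lambda>y. ?e s y * gauss w y)"
    and dH: "\<exists>C. \<forall>y. norm (?e s y * gauss w y) * (1 + norm y) ^ (2 * CARD('n)) \<le> C" for s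
    by (rule integrable_poly_gauss[OF w, of _ 1 0]; simp)+
  have "(J has_vector_derivative (\<integral>y. - 2 * pi * \<i> * of_real (\<xi> \<bullet> y) * ?H y \<partial>lborel)) (at s)"
    unfolding J_def
  proof (rule has_vector_derivative_integral)
    fix s :: real and y
    have "((\<lambda>s. - 2 * pi * ((s *\<^sub>R \<xi>) \<bullet> y)) has_derivative (\<lambda>h. - 2 * pi * (\<xi> \<bullet> y) * h)) (at s)"
      by (auto intro!: derivative_eq_intros)
    then have "((\<lambda>s. ?e s y) has_derivative (\<lambda>h. (- 2 * pi * (\<xi> \<bullet> y) * h) *\<^sub>R (\<i> * ?e s y))) (at s)"
      by (rule has_derivative_cis)
    then have "((\<lambda>s. ?e s y) has_vector_derivative (- 2 * pi * (\<xi> \<bullet> y)) *\<^sub>R (\<i> * ?e s y)) (at s)"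
      unfolding has_vector_derivative_def by (rule has_derivative_eq_rhs) (simp add: fun_eq_iff)
    then have "((\<lambda>s. ?e s y * gauss w y) has_vector_derivative (- 2 * pi * (\<xi> \<bullet> y)) *\<^sub>R (\<i> * ?e s y) * gauss w y) (at s)"
      by (rule has_vector_derivative_mult_left)
    then show "((\<lambda>s. ?e s y * gauss w y) has_vector_derivative - 2 * pi * \<i> * of_real (\<xi> \<bullet> y) * (?e s y * gauss w y)) (at s)"
      by (simp add: scaleR_conv_of_real mult_ac)
    show "norm (- 2 * pi * \<i> * of_real (\<xi> \<bullet> y) * (?e s y * gauss w y)) \<le> 2 * pi * norm (of_real (\<xi> \<bullet> y) * ?e 0 y * gauss w y)"
      by (simp add: norm_mult)
  next
    show "integrable lborel (\<lambda>y. 2 * pi * norm (of_real (\<xi> \<bullet> y) * ?e 0 y * gauss w y))"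
      by (intro integrable_mult_right integrable_norm iL)
  qed (rule iH)
  moreover have "(\<integral>y. ?L y \<partial>lborel) = - \<i> * s * (\<xi> \<bullet> \<xi>) / w * (\<integral>y. ?H y \<partial>lborel)"
  proof -
    let ?H' = "\<lambda>y h. ?e s y * (- (2 * of_real pi * w * of_real (y \<bullet> h)) * gauss w y) + (- 2 * pi * \<i> * of_real ((s *\<^sub>R \<xi>) \<bullet> h) * ?e s y) * gauss w y"
    have eq: "?H' y \<xi> = - (2 * of_real pi * w) * ?L y - (2 * pi * \<i> * s * (\<xi> \<bullet> \<xi>)) * ?H y" for y
      by (simp add: inner_commute algebra_simps)
    have der: "(?H has_derivative ?H' y) (at y)" for y
      by (intro has_derivative_mult has_derivative_cis_inner has_derivative_gauss)
    obtain C1 where C1: "\<And>y. norm (of_real (\<xi> \<bullet> y) * ?e s y * gauss w y) * (1 + norm y) ^ (2 * CARD('n)) \<le> C1"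
      using dL by blast
    obtain C2 where C2: "\<And>y. norm (?e s y * gauss w y) * (1 + norm y) ^ (2 * CARD('n)) \<le> C2"
      using dH by blast
    have C20: "0 \<le> C2" by (rule order_trans[OF _ C2[of 0]]) simp
    have C10: "0 \<le> C1" by (rule order_trans[OF _ C1[of 0]]) simp
    let ?a = "norm (2 * of_real pi * w)" and ?b = "norm (2 * pi * \<i> * s * (\<xi> \<bullet> \<xi>))"
    have "(\<integral>y. ?H' y \<xi> \<partial>lborel) = 0"
    proof (rule integral_directional_derivative_eq_0[OF der, where C = "?a * C1 + ?b * C2 + C2"])
      fix y
      have "0 \<le> ?a * C1 + ?b * C2" using C10 C20 by simp
      then show "norm (?H y) * (1 + norm y) ^ (2 * CARD('n)) \<le> ?a * C1 + ?b * C2 + C2" using C2[of y] by linarith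
      have "norm (?H' y \<xi>) \<le> ?a * norm (?L y) + ?b * norm (?H y)"
        unfolding eq by (rule order_trans[OF norm_triangle_ineq4]) (simp add: norm_mult)
      then have "norm (?H' y \<xi>) * (1 + norm y) ^ (2 * CARD('n)) \<le> (?a * norm (?L y) + ?b * norm (?H y)) * (1 + norm y) ^ (2 * CARD('n))"
        by (rule mult_right_mono) simp
      also have "\<dots> = ?a * (norm (of_real (\<xi> \<bullet> y) * ?e s y * gauss w y) * (1 + norm y) ^ (2 * CARD('n)))
          + ?b * (norm (?H y) * (1 + norm y) ^ (2 * CARD('n)))"
        by (simp only: distrib_right mult.assoc)
      also have "\<dots> \<le> ?a * C1 + ?b * C2" by (intro add_mono mult_left_mono C1 C2) auto
      finally show "norm (?H' y \<xi>) * (1 + norm y) ^ (2 * CARD('n)) \<le> ?a * C1 + ?b * C2 + C2" using C20 by simp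
    qed
    moreover have "(\<integral>y. ?H' y \<xi> \<partial>lborel) = - (2 * of_real pi * w) * (\<integral>y. ?L y \<partial>lborel) - (2 * pi * \<i> * s * (\<xi> \<bullet> \<xi>)) * (\<integral>y. ?H y \<partial>lborel)"
      unfolding eq using iL[of s] iH[of s] by (simp add: mult.assoc)
    ultimately have "(2 * of_real pi * w) * (\<integral>y. ?L y \<partial>lborel) = - (2 * pi * \<i> * s * (\<xi> \<bullet> \<xi>)) * (\<integral>y. ?H y \<partial>lborel)"
      by (simp add: algebra_simps eq_neg_iff_add_eq_0)
    then have "(2 * of_real pi) * (w * (\<integral>y. ?L y \<partial>lborel)) = (2 * of_real pi) * (- \<i> * s * (\<xi> \<bullet> \<xi>) * (\<integral>y. ?H y \<partial>lborel))"
      by (simp only: of_real_mult of_real_numeral mult_ac) simp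
    then have "w * (\<integral>y. ?L y \<partial>lborel) = - \<i> * s * (\<xi> \<bullet> \<xi>) * (\<integral>y. ?H y \<partial>lborel)"
      by (subst (asm) mult_cancel_left) simp
    then show ?thesis using w0 by (simp add: field_simps)
  qed
  moreover have "(\<integral>y. - 2 * pi * \<i> * of_real (\<xi> \<bullet> y) * ?H y \<partial>lborel) = - 2 * pi * \<i> * (\<integral>y. ?L y \<partial>lborel)"
    by (simp add: mult.assoc)
  ultimately show ?thesis by (simp add: J_def mult_ac)
qed

text \<open>Multiplication by the integrating factor \<open>?E\<close> makes the solution of the ray
  equation constant. Comparing \<open>s = 1\<close> with \<open>s = 0\<close>, where the integral is
  the mass, gives the formula.\<close>

lemma fourier_gauss:
  fixes \<xi> :: "real ^ 'n::finite"
  assumes w: "0 < Re w"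
  shows "(\<integral>y. cis (- 2 * pi * (\<xi> \<bullet> y)) * gauss w y \<partial>lborel) = gauss_mass TYPE('n) w * gauss (1 / w) \<xi>"
proof -
  define J where "J = (\<lambda>s::real. \<integral>y. cis (- 2 * pi * ((s *\<^sub>R \<xi>) \<bullet> y)) * gauss w y \<partial>lborel)"
  let ?E = "\<lambda>s::real. exp (of_real (s\<^sup>2) * (pi * (\<xi> \<bullet> \<xi>) / w))"
  have w0: "w \<noteq> 0" using w by auto
  have "((\<lambda>s. ?E s * J s) has_vector_derivative 0) (at s within UNIV)" for s
  proof -
    have E: "(?E has_vector_derivative (2 * s * (pi * (\<xi> \<bullet> \<xi>) / w)) * ?E s) (at s)"
    proof -
      have "((\<lambda>s. of_real (s\<^sup>2) * (pi * (\<xi> \<bullet> \<xi>) / w)) has_vector_derivative 2 * s * (pi * (\<xi> \<bullet> \<xi>) / w)) (at s)"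
        by (rule has_vector_derivative_mult_left, rule has_vector_derivative_of_real)
          (auto intro!: derivative_eq_intros)
      from field_vector_diff_chain_at[OF this DERIV_exp] show ?thesis by (simp add: comp_def)
    qed
    have "(J has_vector_derivative - (2 * pi * s * (\<xi> \<bullet> \<xi>) / w) * J s) (at s)"
      unfolding J_def by (rule gauss_fourier_ray[OF w])
    from has_vector_derivative_mult[OF E this] show ?thesis by (simp add: mult_ac)
  qed
  then obtain c where c: "\<And>s. ?E s * J s = c"
    using has_vector_derivative_zero_constant[of UNIV "\<lambda>s. ?E s * J s"] by auto
  have "?E 1 * J 1 = J 0" using c[of 0] c[of 1] by simp
  then have "J 1 = J 0 / ?E 1" by (simp add: field_simps)
  then have "J 1 = J 0 * gauss (1 / w) \<xi>" by (simp add: gauss_def exp_minus field_simps)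
  then show ?thesis by (simp add: J_def gauss_mass_def)
qed

text \<open>Differentiation in the imaginary part of the parameter brings down -pi i |y|^2. The
  second moment in each coordinate equals the mass divided by 2 pi w, because the derivative of y_i
  times the Gaussian integrates to zero; summing over coordinates produces
  \<open>CARD('n)\<close>.\<close>

lemma has_vector_derivative_gauss_mass:
  fixes a b :: real
  assumes a: "0 < a"
  shows "((\<lambda>b. gauss_mass TYPE('n::finite) (Complex a b)) has_vector_derivative
    - (\<i> * CARD('n) / (2 * Complex a b)) * gauss_mass TYPE('n) (Complex a b)) (at b)"
proof -
  let ?w = "\<lambda>b. Complex a b"
  have w: "0 < Re (?w b)" for b using a by simp
  have w0: "?w b \<noteq> 0" for b using a by (simp add: complex_eq_iff)
  have coord: "\<bar>y $ i\<bar> ^ k \<le> 1 * (1 + norm y) ^ k" for y :: "real ^ 'n" and i k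
    using component_le_norm_cart[of y i] by (auto intro!: power_mono)
  have "\<bar>y \<bullet> y\<bar> \<le> 1 * (1 + norm y) ^ 2" for y :: "real ^ 'n"
    unfolding power2_norm_eq_inner[symmetric] by (auto intro!: power_mono)
  then have iN: "integrable lborel (\<lambda>y :: real ^ 'n. of_real (y \<bullet> y) * gauss (?w b) y)" for b
    by (intro integrable_poly_gauss(1)[OF w, of _ 1 2]) simp_all
  have D: "((\<lambda>b. \<integral>y. gauss (?w b) (y :: real ^ 'n) \<partial>lborel) has_vector_derivative
      (\<integral>y. - (pi * \<i>) * (of_real (y \<bullet> y) * gauss (?w b) (y :: real ^ 'n)) \<partial>lborel)) (at b)"
  proof (rule has_vector_derivative_integral)
    fix b :: real and y :: "real ^ 'n"
    have wb: "?w b = of_real a + of_real b * \<i>" for b by (simp add: complex_eq_iff)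
    have "((\<lambda>b. - (of_real pi * ?w b * of_real (y \<bullet> y))) has_vector_derivative - (pi * \<i> * of_real (y \<bullet> y))) (at b)"
      unfolding wb by (auto intro!: derivative_eq_intros simp: algebra_simps)
    from field_vector_diff_chain_at[OF this DERIV_exp]
    show "((\<lambda>b. gauss (?w b) y) has_vector_derivative - (pi * \<i>) * (of_real (y \<bullet> y) * gauss (?w b) y)) (at b)"
      by (simp add: comp_def gauss_def mult_ac)
    show "norm (- (pi * \<i>) * (of_real (y \<bullet> y) * gauss (?w b) y)) \<le> pi * norm (of_real (y \<bullet> y) * gauss (?w 0) y)"
      by (simp add: norm_mult norm_gauss)
  next
    show "integrable lborel (\<lambda>y :: real ^ 'n. pi * norm (of_real (y \<bullet> y) * gauss (?w 0) y))"
      by (intro integrable_mult_right integrable_norm iN)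
  qed (intro integrable_gauss w)
  have sq: "(\<integral>y. of_real ((y $ i)\<^sup>2) * gauss (?w b) y \<partial>lborel) = gauss_mass TYPE('n) (?w b) / (2 * pi * ?w b)"
    and isq: "integrable lborel (\<lambda>y. of_real ((y $ i)\<^sup>2) * gauss (?w b) y)" for i :: 'n
  proof -
    show i2: "integrable lborel (\<lambda>y. of_real ((y $ i)\<^sup>2) * gauss (?w b) y)"
      using coord[of _ i 2] by (intro integrable_poly_gauss(1)[OF w, of _ 1 2]) (simp_all add: norm_power)
    let ?H' = "\<lambda>y h. of_real (y $ i) * (- (2 * of_real pi * ?w b * of_real (y \<bullet> h)) * gauss (?w b) y) + of_real (h $ i) * gauss (?w b) y"
    have der: "((\<lambda>y. of_real (y $ i) * gauss (?w b) y) has_derivative ?H' y) (at y)" for y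
      by (intro has_derivative_mult has_derivative_gauss has_derivative_of_real bounded_linear_imp_has_derivative) auto
    have eq: "?H' y (axis i 1) = gauss (?w b) y - (2 * of_real pi * ?w b) * (of_real ((y $ i)\<^sup>2) * gauss (?w b) y)" for y
      by (simp add: inner_axis power2_eq_square mult_ac)
    obtain C1 where C1: "\<And>y. norm (of_real (y $ i) * gauss (?w b) y) * (1 + norm y) ^ (2 * CARD('n)) \<le> C1"
      using integrable_poly_gauss(2)[OF w[of b], of "\<lambda>y. of_real (y $ i)" 1 1] coord[of _ i 1] by auto
    obtain C2 where C2: "\<And>y :: real ^ 'n. norm (of_real ((y $ i)\<^sup>2) * gauss (?w b) y) * (1 + norm y) ^ (2 * CARD('n)) \<le> C2"
      using integrable_poly_gauss(2)[OF w[of b], of "\<lambda>y. of_real ((y $ i)\<^sup>2)" 1 2] coord[of _ i 2] by (auto simp: norm_power)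
    obtain C3 where C3: "\<And>y :: real ^ 'n. norm (gauss (?w b) y) * (1 + norm y) ^ (2 * CARD('n)) \<le> C3"
      using gauss_decay[OF w] by blast
    have C0: "0 \<le> C1" "0 \<le> C2" "0 \<le> C3"
      by (rule order_trans[OF _ C1[of 0]] order_trans[OF _ C2[of 0]] order_trans[OF _ C3[of 0]]; simp)+
    let ?a = "norm (2 * of_real pi * ?w b)"
    have "(\<integral>y. ?H' y (axis i 1) \<partial>lborel) = 0"
    proof (rule integral_directional_derivative_eq_0[OF der, where C = "C1 + (C3 + ?a * C2)"])
      fix y :: "real ^ 'n"
      have "0 \<le> C3 + ?a * C2" using C0 by simp
      then show "norm (of_real (y $ i) * gauss (?w b) y) * (1 + norm y) ^ (2 * CARD('n)) \<le> C1 + (C3 + ?a * C2)"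
        using C1[of y] by linarith
      have "norm (?H' y (axis i 1)) \<le> norm (gauss (?w b) y) + ?a * norm (of_real ((y $ i)\<^sup>2) * gauss (?w b) y)"
        unfolding eq by (rule order_trans[OF norm_triangle_ineq4]) (simp add: norm_mult)
      then have "norm (?H' y (axis i 1)) * (1 + norm y) ^ (2 * CARD('n))
          \<le> (norm (gauss (?w b) y) + ?a * norm (of_real ((y $ i)\<^sup>2) * gauss (?w b) y)) * (1 + norm y) ^ (2 * CARD('n))"
        by (rule mult_right_mono) simp
      also have "\<dots> = norm (gauss (?w b) y) * (1 + norm y) ^ (2 * CARD('n))
          + ?a * (norm (of_real ((y $ i)\<^sup>2) * gauss (?w b) y) * (1 + norm y) ^ (2 * CARD('n)))"
        by (simp only: distrib_right mult.assoc)
      also have "\<dots> \<le> C3 + ?a * C2" by (intro add_mono mult_left_mono C2 C3) auto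
      finally show "norm (?H' y (axis i 1)) * (1 + norm y) ^ (2 * CARD('n)) \<le> C1 + (C3 + ?a * C2)" using C0 by simp
    qed
    then have "gauss_mass TYPE('n) (?w b) = (2 * of_real pi * ?w b) * (\<integral>y. of_real ((y $ i)\<^sup>2) * gauss (?w b) y \<partial>lborel)"
      unfolding eq using i2 integrable_gauss[OF w[of b], where 'a = 'n] by (simp add: gauss_mass_def)
    then show "(\<integral>y. of_real ((y $ i)\<^sup>2) * gauss (?w b) y \<partial>lborel) = gauss_mass TYPE('n) (?w b) / (2 * pi * ?w b)"
      using w0[of b] by simp
  qed
  have "(\<integral>y. of_real (y \<bullet> y) * gauss (?w b) (y :: real ^ 'n) \<partial>lborel)
      = (\<integral>y. (\<Sum>i\<in>UNIV. of_real ((y $ i)\<^sup>2) * gauss (?w b) (y :: real ^ 'n)) \<partial>lborel)"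
    by (simp add: inner_vec_def power2_eq_square sum_distrib_right)
  also have "\<dots> = (\<Sum>i\<in>(UNIV :: 'n set). gauss_mass TYPE('n) (?w b) / (2 * pi * ?w b))"
    using isq sq by (subst Bochner_Integration.integral_sum) auto
  also have "\<dots> = CARD('n) * gauss_mass TYPE('n) (?w b) / (2 * pi * ?w b)" by simp
  finally have "(\<integral>y. - (pi * \<i>) * (of_real (y \<bullet> y) * gauss (?w b) (y :: real ^ 'n)) \<partial>lborel)
      = - (\<i> * CARD('n) / (2 * Complex a b)) * gauss_mass TYPE('n) (Complex a b)"
    using w0[of b] by (simp add: field_simps)
  with D show ?thesis by (simp add: gauss_mass_def)
qed

text \<open>The square of the mass times \<open>w ^ CARD('n)\<close> is constant on vertical lines, so only real
  \<open>w\<close> need to be considered, where the integrand is positive.\<close>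

lemma gauss_mass_nonzero:
  assumes w: "0 < Re w" shows "gauss_mass TYPE('n::finite) w \<noteq> 0"
proof -
  define a b0 where "a = Re w" and "b0 = Im w"
  have a: "0 < a" using w by (simp add: a_def)
  let ?w = "\<lambda>b. Complex a b" and ?H = "\<lambda>b. gauss_mass TYPE('n) (Complex a b)"
  have w0: "?w b \<noteq> 0" for b using a by (simp add: complex_eq_iff)
  obtain d where d: "CARD('n) = Suc d" by (metis card_gt_0_iff finite UNIV_not_empty gr0_implies_Suc)
  \<comment> \<open>Squaring doubles the logarithmic derivative -i d / (2 w), and the result cancels
    against that of the integer power w^d; no complex root is involved.\<close>
  have "((\<lambda>b. (?H b * ?H b) * ?w b ^ Suc d) has_vector_derivative 0) (at b within UNIV)" for b
  proof -
    have H: "(?H has_vector_derivative - (\<i> * CARD('n) / (2 * ?w b)) * ?H b) (at b)"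
      by (rule has_vector_derivative_gauss_mass[OF a])
    have wb: "?w b = of_real a + of_real b * \<i>" for b by (simp add: complex_eq_iff)
    have "(?w has_vector_derivative \<i>) (at b)"
      unfolding wb by (auto intro!: derivative_eq_intros)
    moreover have "((\<lambda>x::complex. x ^ Suc d) has_field_derivative of_nat (Suc d) * x ^ d) (at x)" for x
      using DERIV_power_Suc[OF DERIV_ident, of d x UNIV] by simp
    ultimately
    have W: "((\<lambda>b. ?w b ^ Suc d) has_vector_derivative \<i> * (of_nat (Suc d) * ?w b ^ d)) (at b)"
      using field_vector_diff_chain_at[of ?w \<i> b "\<lambda>x. x ^ Suc d"] by (simp add: comp_def)
    show ?thesis
      by (rule has_vector_derivative_eq_rhs[OF has_vector_derivative_mult[OF has_vector_derivative_mult[OF H H] W]])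
        (use w0[of b] d in \<open>simp add: field_simps\<close>)
  qed
  then obtain c where c: "\<And>b. (?H b * ?H b) * ?w b ^ Suc d = c"
    using has_vector_derivative_zero_constant[of UNIV "\<lambda>b. (?H b * ?H b) * ?w b ^ Suc d"] by auto
  have "?H 0 \<noteq> 0"
  proof
    assume "?H 0 = 0"
    let ?g = "\<lambda>y :: real ^ 'n. exp (- (pi * a * (y \<bullet> y)))"
    have g: "gauss (?w 0) y = of_real (?g y)" for y :: "real ^ 'n"
      by (simp add: gauss_def Complex_eq exp_of_real[symmetric])
    have int: "integrable lborel ?g"
      using integrable_gauss[of "?w 0", where 'a = 'n] a unfolding g by (simp only: complex_of_real_integrable_eq) simp
    have "(\<integral>y. ?g y \<partial>lborel) = 0" using \<open>?H 0 = 0\<close> by (simp add: gauss_mass_def g)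
    then have "AE y in lborel. ?g y = 0"
      using int by (subst (asm) integral_nonneg_eq_0_iff_AE) auto
    then show False using AE_iff_measurable[of UNIV lborel "\<lambda>x :: real ^ 'n. False"] by simp
  qed
  then have "c \<noteq> 0" using c[of 0] w0[of 0] by auto
  then have "?H b0 \<noteq> 0" using c[of b0] by auto
  then show ?thesis by (simp add: a_def b0_def)
qed

section \<open>Chirps acting on wave packets\<close>

lemma fourier_packet:
  fixes x0 \<xi>0 \<xi> :: "real ^ 'n::finite"
  assumes w: "0 < Re w"
  shows "fourier (packet w x0 \<xi>0) \<xi>
    = cis (- 2 * pi * (x0 \<bullet> (\<xi> - \<xi>0))) * gauss_mass TYPE('n) w * gauss (1 / w) (\<xi> - \<xi>0)"
proof -
  let ?f = "\<lambda>y. cis (- 2 * pi * ((\<xi> - \<xi>0) \<bullet> y)) * gauss w (y - x0)"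
  have "fourier (packet w x0 \<xi>0) \<xi> = (\<integral>y. ?f y \<partial>lborel)"
    unfolding fourier_def packet_def
    by (intro Bochner_Integration.integral_cong refl)
      (simp add: cis_mult inner_diff_left inner_commute algebra_simps)
  also have "\<dots> = (\<integral>y. ?f (y + x0) \<partial>lborel)" by (rule lborel_integral_shift[symmetric]) simp
  also have "\<dots> = (\<integral>y. cis (- 2 * pi * (x0 \<bullet> (\<xi> - \<xi>0))) * (cis (- 2 * pi * ((\<xi> - \<xi>0) \<bullet> y)) * gauss w y) \<partial>lborel)"
  proof (intro Bochner_Integration.integral_cong refl)
    fix y
    have "- 2 * pi * ((\<xi> - \<xi>0) \<bullet> (y + x0)) = - 2 * pi * (x0 \<bullet> (\<xi> - \<xi>0)) + - 2 * pi * ((\<xi> - \<xi>0) \<bullet> y)"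
      by (simp add: inner_add_right inner_commute distrib_left)
    then show "?f (y + x0) = cis (- 2 * pi * (x0 \<bullet> (\<xi> - \<xi>0))) * (cis (- 2 * pi * ((\<xi> - \<xi>0) \<bullet> y)) * gauss w y)"
      by (simp only: mult.assoc[symmetric] cis_mult add_diff_cancel_right')
  qed
  also have "\<dots> = cis (- 2 * pi * (x0 \<bullet> (\<xi> - \<xi>0))) * (\<integral>y. cis (- 2 * pi * ((\<xi> - \<xi>0) \<bullet> y)) * gauss w y \<partial>lborel)"
    by (rule Bochner_Integration.integral_mult_right_zero)
  also have "\<dots> = cis (- 2 * pi * (x0 \<bullet> (\<xi> - \<xi>0))) * gauss_mass TYPE('n) w * gauss (1 / w) (\<xi> - \<xi>0)"
    unfolding fourier_gauss[OF w] by (simp only: mult.assoc)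
  finally show ?thesis .
qed

lemma cis_mult_gauss:
  "cis (\<sigma> * (x \<bullet> x)) * gauss v x = gauss (v - \<i> * of_real (\<sigma> / pi)) x"
proof -
  have "complex_of_real pi * (v - \<i> * of_real (\<sigma> / pi)) = of_real pi * v - \<i> * of_real \<sigma>"
    by (simp add: right_diff_distrib)
  then show ?thesis
    by (simp add: gauss_def cis_conv_exp exp_add[symmetric] left_diff_distrib mult.assoc)
qed

text \<open>With \<xi> = \<eta> + \<xi>0 the phase \<sigma> |\<xi>|^2 splits into three parts: the
  constant one is the outer phase, the linear one moves the position by -(\<sigma> / pi) \<xi>0, and
  the quadratic one is absorbed by the Gaussian parameter, giving \<open>v\<close>.\<close>

lemma inverse_fourier_chirp_packet:
  fixes x x0 \<xi>0 :: "real ^ 'n::finite" and \<sigma> :: real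
  assumes w: "0 < Re w"
  defines "v \<equiv> 1 / w - \<i> * of_real (\<sigma> / pi)"
  shows "integrable lborel (\<lambda>\<xi>. cis (2 * pi * (x \<bullet> \<xi>)) * cis (\<sigma> * (\<xi> \<bullet> \<xi>)) * fourier (packet w x0 \<xi>0) \<xi>)"
    and "(\<integral>\<xi>. cis (2 * pi * (x \<bullet> \<xi>)) * cis (\<sigma> * (\<xi> \<bullet> \<xi>)) * fourier (packet w x0 \<xi>0) \<xi> \<partial>lborel)
      = cis (\<sigma> * (\<xi>0 \<bullet> \<xi>0)) * (gauss_mass TYPE('n) w * gauss_mass TYPE('n) v)
        * packet (1 / v) (x0 - (\<sigma> / pi) *\<^sub>R \<xi>0) \<xi>0 x"
proof -
  have w': "0 < Re (1 / w)" using w by (auto simp: Re_divide power2_eq_square intro!: divide_pos_pos add_pos_nonneg)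
  then have v: "0 < Re v" by (simp add: v_def)
  let ?F = "\<lambda>\<xi>. cis (2 * pi * (x \<bullet> \<xi>)) * cis (\<sigma> * (\<xi> \<bullet> \<xi>)) * fourier (packet w x0 \<xi>0) \<xi>"
  let ?x = "x - (x0 - (\<sigma> / pi) *\<^sub>R \<xi>0)"
  let ?c = "cis (2 * pi * (\<xi>0 \<bullet> x)) * cis (\<sigma> * (\<xi>0 \<bullet> \<xi>0)) * gauss_mass TYPE('n) w"
  \<comment> \<open>The point is written as \<open>- ?x\<close> so that the inverse transform
    becomes a forward one, to which \<open>fourier_gauss\<close> applies; the Gaussian is
    even.\<close>
  let ?G = "\<lambda>\<eta>. ?c * (cis (- 2 * pi * ((- ?x) \<bullet> \<eta>)) * gauss v \<eta>)"
  have [measurable]: "?F \<in> borel_measurable borel"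
    unfolding fourier_packet[OF w] by measurable
  have eq: "?F (\<eta> + \<xi>0) = ?G \<eta>" for \<eta>
  proof -
    have "2 * pi * (x \<bullet> (\<eta> + \<xi>0)) + \<sigma> * ((\<eta> + \<xi>0) \<bullet> (\<eta> + \<xi>0)) + - 2 * pi * (x0 \<bullet> \<eta>)
      = (2 * pi * (\<xi>0 \<bullet> x) + \<sigma> * (\<xi>0 \<bullet> \<xi>0) + - 2 * pi * ((- ?x) \<bullet> \<eta>)) + \<sigma> * (\<eta> \<bullet> \<eta>)"
      by (simp add: inner_add_left inner_add_right inner_diff_left inner_diff_right inner_commute algebra_simps)
    then have "cis (2 * pi * (x \<bullet> (\<eta> + \<xi>0))) * cis (\<sigma> * ((\<eta> + \<xi>0) \<bullet> (\<eta> + \<xi>0))) * cis (- 2 * pi * (x0 \<bullet> \<eta>))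
      = cis (2 * pi * (\<xi>0 \<bullet> x)) * cis (\<sigma> * (\<xi>0 \<bullet> \<xi>0)) * cis (- 2 * pi * ((- ?x) \<bullet> \<eta>)) * cis (\<sigma> * (\<eta> \<bullet> \<eta>))"
      by (simp only: cis_mult)
    then have "?F (\<eta> + \<xi>0) = cis (2 * pi * (\<xi>0 \<bullet> x)) * cis (\<sigma> * (\<xi>0 \<bullet> \<xi>0)) * cis (- 2 * pi * ((- ?x) \<bullet> \<eta>)) * cis (\<sigma> * (\<eta> \<bullet> \<eta>))
        * gauss_mass TYPE('n) w * gauss (1 / w) \<eta>"
      unfolding fourier_packet[OF w] add_diff_cancel_right' by (simp only: mult.assoc[symmetric])
    also have "\<dots> = ?c * (cis (- 2 * pi * ((- ?x) \<bullet> \<eta>)) * (cis (\<sigma> * (\<eta> \<bullet> \<eta>)) * gauss (1 / w) \<eta>))"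
      by (simp only: mult_ac)
    finally show ?thesis unfolding cis_mult_gauss v_def .
  qed
  have iG: "integrable lborel (\<lambda>\<eta>. ?F (\<eta> + \<xi>0))" unfolding eq
    by (intro integrable_mult_right integrable_poly_gauss(1)[OF v, of _ 1 0]) simp_all
  then have "integrable (distr lborel borel ((+) \<xi>0)) ?F"
    by (subst integrable_distr_eq) (auto simp: add.commute)
  then show "integrable lborel ?F" by (simp only: lborel_distr_plus)
  have "(\<integral>\<xi>. ?F \<xi> \<partial>lborel) = (\<integral>\<eta>. ?F (\<eta> + \<xi>0) \<partial>lborel)" by (rule lborel_integral_shift[symmetric]) simp
  also have "\<dots> = ?c * (\<integral>\<eta>. cis (- 2 * pi * ((- ?x) \<bullet> \<eta>)) * gauss v \<eta> \<partial>lborel)"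
    unfolding eq by (rule Bochner_Integration.integral_mult_right_zero)
  also have "\<dots> = ?c * (gauss_mass TYPE('n) v * gauss (1 / v) ?x)"
    by (simp only: fourier_gauss[OF v] gauss_minus)
  also have "\<dots> = cis (\<sigma> * (\<xi>0 \<bullet> \<xi>0)) * (gauss_mass TYPE('n) w * gauss_mass TYPE('n) v)
        * packet (1 / v) (x0 - (\<sigma> / pi) *\<^sub>R \<xi>0) \<xi>0 x"
    by (simp add: packet_def mult_ac)
  finally show "(\<integral>\<xi>. ?F \<xi> \<partial>lborel) = cis (\<sigma> * (\<xi>0 \<bullet> \<xi>0)) * (gauss_mass TYPE('n) w * gauss_mass TYPE('n) v)
        * packet (1 / v) (x0 - (\<sigma> / pi) *\<^sub>R \<xi>0) \<xi>0 x" .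
qed

lemma integrable_packet:
  fixes x0 :: "real ^ 'n::finite"
  assumes "0 < Re w" shows "integrable lborel (packet w x0 \<xi>0)"
proof -
  obtain C where "\<And>y. norm (packet w x0 \<xi>0 y) * (1 + norm y) ^ (2 * CARD('n)) \<le> C"
    using packet_decay[OF assms] by blast
  then show ?thesis by (rule integrable_decay[rotated]) simp
qed

text \<open>Euler's formula writes the symbol as the mean of two chirps with \<sigma> = 4 pi^2 t and
  \<sigma> = -4 pi^2 t. The halves move by opposite vectors, but their parameters \<open>v1\<close>
  and \<open>v2\<close> differ, so they need not have the same shape; the choice of \<open>w\<close>
  exploits this.\<close>

lemma plate_multiplier_packets:
  fixes X \<Xi> :: "'k \<Rightarrow> real ^ 'n::finite" and t :: real
  assumes w: "0 < Re w" and K: "finite K"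
  defines "v1 \<equiv> 1 / w - \<i> * of_real (4 * pi * t)" and "v2 \<equiv> 1 / w + \<i> * of_real (4 * pi * t)"
  shows "fourier_multiplier (plate_symbol t) (\<lambda>x. \<Sum>k\<in>K. packet w (X k) (\<Xi> k) x) x
    = (\<Sum>k\<in>K. cis (4 * pi\<^sup>2 * t * (\<Xi> k \<bullet> \<Xi> k)) * (gauss_mass TYPE('n) w * gauss_mass TYPE('n) v1 / 2)
          * packet (1 / v1) (X k - (4 * pi * t) *\<^sub>R \<Xi> k) (\<Xi> k) x
        + cis (- (4 * pi\<^sup>2 * t * (\<Xi> k \<bullet> \<Xi> k))) * (gauss_mass TYPE('n) w * gauss_mass TYPE('n) v2 / 2)
          * packet (1 / v2) (X k + (4 * pi * t) *\<^sub>R \<Xi> k) (\<Xi> k) x)"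
proof -
  let ?\<tau> = "4 * pi\<^sup>2 * t"
  have \<tau>: "?\<tau> / pi = 4 * pi * t" "- ?\<tau> / pi = - (4 * pi * t)" by (simp_all add: power2_eq_square)
  let ?F = "\<lambda>\<sigma> k \<xi>. cis (2 * pi * (x \<bullet> \<xi>)) * cis (\<sigma> * (\<xi> \<bullet> \<xi>)) * fourier (packet w (X k) (\<Xi> k)) \<xi>"
  have int: "integrable lborel (?F \<sigma> k)" for \<sigma> k
    by (rule inverse_fourier_chirp_packet(1)[OF w])
  have f: "fourier (\<lambda>x. \<Sum>k\<in>K. packet w (X k) (\<Xi> k) x) \<xi> = (\<Sum>k\<in>K. fourier (packet w (X k) (\<Xi> k)) \<xi>)" for \<xi>
  proof -
    have "integrable lborel (\<lambda>y. packet w (X k) (\<Xi> k) y * cis (- 2 * pi * (y \<bullet> \<xi>)))" for k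
      by (rule Bochner_Integration.integrable_bound[OF integrable_packet[OF w, of "X k" "\<Xi> k"]]) (auto simp: norm_mult)
    then show ?thesis unfolding fourier_def sum_distrib_right
      by (intro Bochner_Integration.integral_sum)
  qed
  have pc: "plate_symbol t \<xi> = (cis (?\<tau> * (\<xi> \<bullet> \<xi>)) + cis (- ?\<tau> * (\<xi> \<bullet> \<xi>))) / 2" for \<xi> :: "real ^ 'n"
    by (simp add: plate_symbol_def complex_eq_iff power2_norm_eq_inner)
  have "fourier_multiplier (plate_symbol t) (\<lambda>x. \<Sum>k\<in>K. packet w (X k) (\<Xi> k) x) x
    = (\<integral>\<xi>. (\<Sum>k\<in>K. (?F ?\<tau> k \<xi> + ?F (- ?\<tau>) k \<xi>) / 2) \<partial>lborel)"
    unfolding fourier_multiplier_def f pc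
    by (intro Bochner_Integration.integral_cong refl)
      (subst sum_distrib_left, intro sum.cong refl, simp only: distrib_left distrib_right add_divide_distrib times_divide_eq_left times_divide_eq_right)
  also have "\<dots> = (\<Sum>k\<in>K. ((\<integral>\<xi>. ?F ?\<tau> k \<xi> \<partial>lborel) + (\<integral>\<xi>. ?F (- ?\<tau>) k \<xi> \<partial>lborel)) / 2)"
    using int[of ?\<tau>] int[of "- ?\<tau>"] by (subst Bochner_Integration.integral_sum) auto
  also have "\<dots> = (\<Sum>k\<in>K. cis (?\<tau> * (\<Xi> k \<bullet> \<Xi> k)) * (gauss_mass TYPE('n) w * gauss_mass TYPE('n) v1 / 2)
          * packet (1 / v1) (X k - (4 * pi * t) *\<^sub>R \<Xi> k) (\<Xi> k) x
        + cis (- (?\<tau> * (\<Xi> k \<bullet> \<Xi> k))) * (gauss_mass TYPE('n) w * gauss_mass TYPE('n) v2 / 2)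
          * packet (1 / v2) (X k + (4 * pi * t) *\<^sub>R \<Xi> k) (\<Xi> k) x)"
    unfolding inverse_fourier_chirp_packet(2)[OF w] \<tau> v1_def v2_def
    by (intro sum.cong refl) (simp add: add_divide_distrib)
  finally show ?thesis .
qed

section \<open>The short-time Fourier transform\<close>

lemma stft_integrable:
  fixes F G :: "real ^ 'n::finite \<Rightarrow> complex"
  assumes F: "schwartz F" and G: "schwartz G"
  shows "integrable lborel (\<lambda>y. cis (- 2 * pi * (\<zeta> \<bullet> y)) * F y * cnj (G (y - z)))"
proof -
  note [measurable] = schwartz_measurable[OF F] schwartz_measurable[OF G]
  obtain C where C: "\<And>is y z. norm (iter_partial is (\<lambda>y. F y * cnj (G (y - z))) y) * (1 + norm y) ^ (2 * CARD('n)) * (1 + norm z) ^ (2 * CARD('n)) \<le> C is"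
    using stft_product_decay[OF F G] by blast
  have "norm (cis (- 2 * pi * (\<zeta> \<bullet> y)) * F y * cnj (G (y - z))) * (1 + norm y) ^ (2 * CARD('n)) \<le> C []" for y
  proof -
    have "norm (F y * cnj (G (y - z))) * (1 + norm y) ^ (2 * CARD('n)) * 1
      \<le> norm (F y * cnj (G (y - z))) * (1 + norm y) ^ (2 * CARD('n)) * (1 + norm z) ^ (2 * CARD('n))"
      by (intro mult_left_mono) auto
    also have "\<dots> \<le> C []" using C[of "[]" z y] by simp
    finally show ?thesis by (simp add: norm_mult)
  qed
  then show ?thesis by (intro integrable_decay) measurable
qed

text \<open>Two families at once, matching the two halves that the multiplier makes of each
  packet.\<close>

lemma stft_sum:
  assumes "\<And>k. k \<in> K \<Longrightarrow> schwartz (P k)" "\<And>k. k \<in> K \<Longrightarrow> schwartz (Q k)" and G: "schwartz G"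
  shows "stft G (\<lambda>x. \<Sum>k\<in>K. a k * P k x + b k * Q k x) z \<zeta>
    = (\<Sum>k\<in>K. a k * stft G (P k) z \<zeta> + b k * stft G (Q k) z \<zeta>)"
proof -
  let ?T = "\<lambda>F y. cis (- 2 * pi * (\<zeta> \<bullet> y)) * F y * cnj (G (y - z))"
  have "stft G (\<lambda>x. \<Sum>k\<in>K. a k * P k x + b k * Q k x) z \<zeta>
      = (\<integral>y. (\<Sum>k\<in>K. a k * ?T (P k) y + b k * ?T (Q k) y) \<partial>lborel)"
    unfolding stft_def by (simp add: sum_distrib_left sum_distrib_right distrib_left distrib_right mult_ac)
  also have "\<dots> = (\<Sum>k\<in>K. \<integral>y. a k * ?T (P k) y + b k * ?T (Q k) y \<partial>lborel)"
    by (intro Bochner_Integration.integral_sum Bochner_Integration.integrable_add integrable_mult_right stft_integrable assms)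
  also have "\<dots> = (\<Sum>k\<in>K. a k * stft G (P k) z \<zeta> + b k * stft G (Q k) z \<zeta>)"
    unfolding stft_def
    by (intro sum.cong refl, subst Bochner_Integration.integral_add)
      (intro integrable_mult_right stft_integrable assms, assumption | simp)+
  finally show ?thesis .
qed

text \<open>Covariance: a time-frequency shift of the function translates its short-time Fourier
  transform up to a unimodular factor. One bound for the centred Gaussian thus serves all packets of
  a train, with the same constant.\<close>

lemma norm_stft_packet:
  assumes G [measurable]: "G \<in> borel_measurable borel"
  shows "norm (stft G (packet w x0 \<xi>0) z \<zeta>) = norm (stft G (gauss w) (z - x0) (\<zeta> - \<xi>0))"
proof -
  let ?f = "\<lambda>y. cis (- 2 * pi * (\<zeta> \<bullet> y)) * packet w x0 \<xi>0 y * cnj (G (y - z))"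
  let ?c = "cis (- 2 * pi * ((\<zeta> - \<xi>0) \<bullet> x0))"
  have e: "?f (y + x0) = ?c * (cis (- 2 * pi * ((\<zeta> - \<xi>0) \<bullet> y)) * gauss w y * cnj (G (y - (z - x0))))" for y
  proof -
    have "- 2 * pi * (\<zeta> \<bullet> (y + x0)) + 2 * pi * (\<xi>0 \<bullet> (y + x0))
      = - 2 * pi * ((\<zeta> - \<xi>0) \<bullet> x0) + - 2 * pi * ((\<zeta> - \<xi>0) \<bullet> y)"
      by (simp add: inner_add_right inner_diff_left algebra_simps)
    then have "cis (- 2 * pi * (\<zeta> \<bullet> (y + x0))) * cis (2 * pi * (\<xi>0 \<bullet> (y + x0))) = ?c * cis (- 2 * pi * ((\<zeta> - \<xi>0) \<bullet> y))"
      by (simp only: cis_mult)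
    moreover have "y + x0 - z = y - (z - x0)" by simp
    ultimately show ?thesis unfolding packet_def add_diff_cancel_right' by (simp only: mult.assoc[symmetric])
  qed
  have "stft G (packet w x0 \<xi>0) z \<zeta> = (\<integral>y. ?f (y + x0) \<partial>lborel)"
    unfolding stft_def by (rule lborel_integral_shift[symmetric]) simp
  also have "\<dots> = ?c * stft G (gauss w) (z - x0) (\<zeta> - \<xi>0)"
    unfolding e stft_def by (rule Bochner_Integration.integral_mult_right_zero)
  finally show ?thesis by (simp add: norm_mult)
qed

text \<open>Dominated convergence with a bounded continuous window and an integrable function. Joint
  continuity is used twice: for measurability of the norms and to spread a nonzero value over a
  neighbourhood.\<close>

lemma continuous_stft:
  fixes F G :: "real ^ 'n::finite \<Rightarrow> complex"
  assumes F: "schwartz F" and G: "schwartz G"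
  shows "continuous_on UNIV (\<lambda>p. stft G F (fst p) (snd p))"
  unfolding continuous_on_sequentially comp_def
proof (intro allI ballI impI, elim conjE)
  fix X :: "nat \<Rightarrow> (real ^ 'n) \<times> (real ^ 'n)" and p assume X: "X \<longlonglongrightarrow> p"
  note [measurable] = schwartz_measurable[OF F] schwartz_measurable[OF G]
  obtain C where C: "\<And>is y. norm (iter_partial is G y) * (1 + norm y) ^ 0 \<le> C is"
    using schwartz_decay[OF G, of 0] by blast
  obtain C' where C': "\<And>is y. norm (iter_partial is F y) * (1 + norm y) ^ (2 * CARD('n)) \<le> C' is"
    using schwartz_decay[OF F] by blast
  have iF: "integrable lborel F"
    by (rule integrable_decay[where C = "C' []"]) (use C'[of "[]"] in auto)
  show "(\<lambda>n. stft G F (fst (X n)) (snd (X n))) \<longlonglongrightarrow> stft G F (fst p) (snd p)"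
    unfolding stft_def
  proof (rule integral_dominated_convergence[where w = "\<lambda>y. norm (F y) * C []"])
    show "integrable lborel (\<lambda>y. norm (F y) * C [])" using iF by simp
    show "AE y in lborel. (\<lambda>n. cis (- 2 * pi * (snd (X n) \<bullet> y)) * F y * cnj (G (y - fst (X n))))
        \<longlonglongrightarrow> cis (- 2 * pi * (snd p \<bullet> y)) * F y * cnj (G (y - fst p))"
    proof (rule AE_I2)
      fix y
      have "isCont G (y - fst p)"
        using schwartz_continuous[OF G, of UNIV "[]"] by (simp add: continuous_on_eq_continuous_at)
      moreover have "isCont cis (- 2 * pi * (snd p \<bullet> y))"
        using continuous_on_eq_continuous_at[of UNIV cis] by (auto intro!: continuous_intros)
      ultimately show "(\<lambda>n. cis (- 2 * pi * (snd (X n) \<bullet> y)) * F y * cnj (G (y - fst (X n))))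
        \<longlonglongrightarrow> cis (- 2 * pi * (snd p \<bullet> y)) * F y * cnj (G (y - fst p))"
        using X by (intro tendsto_mult tendsto_cnj isCont_tendsto_compose[of _ cis] isCont_tendsto_compose[of _ G] tendsto_intros) auto
    qed
    show "AE y in lborel. norm (cis (- 2 * pi * (snd (X n) \<bullet> y)) * F y * cnj (G (y - fst (X n)))) \<le> norm (F y) * C []" for n
      using C[of "[]"] by (intro AE_I2) (simp add: norm_mult mult_left_mono)
  qed measurable
qed

text \<open>At position \<open>- y0\<close> the centre of the Gaussian meets the window at
  \<open>y0\<close>. For the parameter (n + 1)^2, scaling by 1 / (n + 1) leaves a fixed Gaussian
  against \<open>cnj (G (y / (n + 1) + y0))\<close>, whose integral tends to the nonzero mass times
  \<open>cnj (G y0)\<close>.\<close>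

lemma stft_gauss_nonzero:
  fixes G :: "real ^ 'n::finite \<Rightarrow> complex"
  assumes G: "schwartz G" and nz: "G y0 \<noteq> 0"
  obtains r :: real where "0 < r" "stft G (gauss (of_real r)) (- y0) 0 \<noteq> 0"
proof -
  note [measurable] = schwartz_measurable[OF G]
  obtain C where C: "\<And>is y. norm (iter_partial is G y) * (1 + norm y) ^ 0 \<le> C is"
    using schwartz_decay[OF G, of 0] by blast
  let ?c = "\<lambda>n. inverse (real (Suc n))"
  let ?h = "\<lambda>n y. gauss 1 y * cnj (G (?c n *\<^sub>R y + y0))"
  have lim: "(\<lambda>n. \<integral>y. ?h n y \<partial>lborel) \<longlonglongrightarrow> (\<integral>y. gauss 1 (y :: real ^ 'n) * cnj (G y0) \<partial>lborel)"
  proof (rule integral_dominated_convergence[where w = "\<lambda>y. norm (gauss 1 y) * C []"])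
    show "integrable lborel (\<lambda>y :: real ^ 'n. norm (gauss 1 y) * C [])" using integrable_gauss[of 1, where 'a = 'n] by simp
    show "AE y in lborel. (\<lambda>n. ?h n y) \<longlonglongrightarrow> gauss 1 y * cnj (G y0)"
    proof (rule AE_I2)
      fix y
      have "(\<lambda>n. ?c n *\<^sub>R y + y0) \<longlonglongrightarrow> 0 *\<^sub>R y + y0"
        by (intro tendsto_intros LIMSEQ_inverse_real_of_nat)
      moreover have "isCont G y0"
        using schwartz_continuous[OF G, of UNIV "[]"] by (simp add: continuous_on_eq_continuous_at)
      ultimately show "(\<lambda>n. ?h n y) \<longlonglongrightarrow> gauss 1 y * cnj (G y0)"
        by (intro tendsto_mult tendsto_cnj isCont_tendsto_compose[of _ G] tendsto_const) auto
    qed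
    show "AE y in lborel. norm (?h n y) \<le> norm (gauss 1 y) * C []" for n
      using C[of "[]"] by (intro AE_I2) (simp add: norm_mult mult_left_mono)
  qed measurable
  have "(\<integral>y. gauss 1 (y :: real ^ 'n) * cnj (G y0) \<partial>lborel) = gauss_mass TYPE('n) 1 * cnj (G y0)"
    unfolding gauss_mass_def by (rule Bochner_Integration.integral_mult_left_zero)
  also have "\<dots> \<noteq> 0" using nz gauss_mass_nonzero[of 1, where 'n = 'n] by simp
  finally have "eventually (\<lambda>n. (\<integral>y. ?h n y \<partial>lborel) \<noteq> 0) sequentially"
    by (rule tendsto_imp_eventually_ne[OF lim])
  then obtain n where n: "(\<integral>y. ?h n y \<partial>lborel) \<noteq> 0" by (auto simp: eventually_sequentially)
  let ?l = "(real (Suc n))\<^sup>2"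
  let ?f = "\<lambda>y. gauss (of_real ?l) y * cnj (G (y + y0))"
  have scale: "gauss (of_real ?l) (?c n *\<^sub>R y) = gauss 1 y" for y :: "real ^ 'n"
  proof -
    have "?l * ((?c n *\<^sub>R y) \<bullet> (?c n *\<^sub>R y)) = y \<bullet> y" by (simp add: power2_eq_square field_simps del: of_nat_Suc)
    then have "complex_of_real ?l * of_real ((?c n *\<^sub>R y) \<bullet> (?c n *\<^sub>R y)) = of_real (y \<bullet> y)"
      by (metis of_real_mult)
    then show ?thesis by (simp only: gauss_def mult.assoc mult_1_left)
  qed
  have "stft G (gauss (of_real ?l)) (- y0) 0 = (\<integral>y. ?f y \<partial>lborel)" by (simp add: stft_def)
  also have "\<dots> = (\<integral>y. ?f y \<partial>density (distr lborel borel (\<lambda>x. 0 + ?c n *\<^sub>R x)) (\<lambda>_. ennreal (\<bar>?c n\<bar> ^ DIM(real ^ 'n))))"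
    by (subst lborel_affine[of "?c n" 0]) simp_all
  also have "\<dots> = (\<integral>y. \<bar>?c n\<bar> ^ DIM(real ^ 'n) *\<^sub>R ?f (0 + ?c n *\<^sub>R y) \<partial>lborel)"
    by (subst integral_density) (simp_all add: integral_distr)
  also have "\<dots> = \<bar>?c n\<bar> ^ DIM(real ^ 'n) *\<^sub>R (\<integral>y. ?h n y \<partial>lborel)"
    by (simp only: add_0_left scale integral_scaleR_right)
  finally have "stft G (gauss (of_real ?l)) (- y0) 0 \<noteq> 0" using n by simp
  then show ?thesis using that[of ?l] by simp
qed

section \<open>Trains of wave packets\<close>

text \<open>For finite \<open>p\<close> the inner norm is a power of an integral over \<zeta> of a
  jointly measurable function, hence measurable in \<open>z\<close>. Measurability in
  \<open>z\<close> is demanded later only when \<open>q = \<infinity>\<close>, and then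
  \<open>p \<noteq> q\<close> makes \<open>p\<close> finite.\<close>

lemma measurable_stft:
  fixes F G :: "real ^ 'n::finite \<Rightarrow> complex"
  assumes F: "schwartz F" and G: "schwartz G"
  shows "(\<lambda>\<zeta>. ennreal (norm (stft G F z \<zeta>))) \<in> borel_measurable lborel"
    and "p \<noteq> \<infinity> \<Longrightarrow> (\<lambda>z. Lp_norm p (\<lambda>\<zeta>. ennreal (norm (stft G F z \<zeta>)))) \<in> borel_measurable lborel"
proof -
  have "(\<lambda>x. stft G F (fst x) (snd x)) \<in> borel_measurable (borel :: ((real ^ 'n) \<times> (real ^ 'n)) measure)"
    by (intro borel_measurable_continuous_onI continuous_stft F G)
  then have m [measurable]: "(\<lambda>x. stft G F (fst x) (snd x)) \<in> borel_measurable (borel \<Otimes>\<^sub>M borel)"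
    by (simp add: borel_prod)
  have "(\<lambda>\<zeta>. stft G F (fst (z, \<zeta>)) (snd (z, \<zeta>))) \<in> borel_measurable borel"
    by (rule measurable_compose[OF _ m]) measurable
  then show "(\<lambda>\<zeta>. ennreal (norm (stft G F z \<zeta>))) \<in> borel_measurable lborel" by simp
  assume "p \<noteq> \<infinity>"
  then show "(\<lambda>z. Lp_norm p (\<lambda>\<zeta>. ennreal (norm (stft G F z \<zeta>)))) \<in> borel_measurable lborel"
    by (simp add: Lp_norm_def)
qed

lemma nn_integral_weight_sum:
  fixes X :: "'k \<Rightarrow> real ^ 'n::finite"
  assumes I: "\<And>a. (\<integral>\<^sup>+x. ennreal (weight (x - a :: real ^ 'n)) \<partial>lborel) = ennreal I" "0 < I"
    and K: "finite K" and a: "\<And>k. k \<in> K \<Longrightarrow> 0 \<le> a k"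
  shows "(\<integral>\<^sup>+x. ennreal (\<Sum>k\<in>K. a k * weight (x - X k)) \<partial>lborel) = ennreal ((\<Sum>k\<in>K. a k) * I)"
proof -
  have "(\<integral>\<^sup>+x. ennreal (\<Sum>k\<in>K. a k * weight (x - X k)) \<partial>lborel)
      = (\<integral>\<^sup>+x. (\<Sum>k\<in>K. ennreal (a k) * ennreal (weight (x - X k))) \<partial>lborel)"
    using a by (intro nn_integral_cong) (simp add: sum_ennreal[symmetric] ennreal_mult)
  also have "\<dots> = (\<Sum>k\<in>K. ennreal (a k) * ennreal I)"
    by (simp add: nn_integral_sum nn_integral_cmult I)
  also have "\<dots> = ennreal ((\<Sum>k\<in>K. a k) * I)"
    using a I(2) by (simp add: sum_distrib_right sum_ennreal[symmetric] ennreal_mult)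
  finally show ?thesis .
qed

text \<open>For fixed \<open>z\<close> the sum over frequencies is bounded by \<open>B\<close> and
  has integral proportional to \<open>N\<close>, hence the factor N^(1/p). The outer norm sees a
  single weight in \<open>z\<close> and adds no power of \<open>N\<close>.\<close>

lemma amalgam_norm_upper_common_position:
  fixes F G :: "real ^ 'n::finite \<Rightarrow> complex" and \<Xi> :: "nat \<Rightarrow> real ^ 'n"
  assumes p: "1 \<le> p" "1 \<le> q" "p \<noteq> q" and F: "schwartz F" and G: "schwartz G"
    and I: "\<And>a. (\<integral>\<^sup>+x. ennreal (weight (x - a :: real ^ 'n)) \<partial>lborel) = ennreal I" "0 < I"
    and C: "0 \<le> C" "\<And>z \<zeta>. norm (stft G F z \<zeta>) \<le> C * (\<Sum>k\<in>{1..N}. weight z * weight (\<zeta> - \<Xi> k))"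
    and B: "1 \<le> B" "\<And>\<zeta>. (\<Sum>k\<in>{1..N}. weight (\<zeta> - \<Xi> k)) \<le> B" and N: "1 \<le> N"
  shows "amalgam_norm G p q F \<le> ennreal (C * B * (I powr recip_exp p * I powr recip_exp q) * N powr recip_exp p)"
proof -
  let ?D = "C * B * (N * I) powr recip_exp p"
  have D: "0 \<le> ?D" using C B by simp
  have inner: "Lp_norm p (\<lambda>\<zeta>. ennreal (norm (stft G F z \<zeta>))) \<le> ennreal (?D * weight z)" for z
  proof -
    have "Lp_norm p (\<lambda>\<zeta>. ennreal (norm (stft G F z \<zeta>))) \<le> ennreal ((C * weight z * B) * (N * I) powr recip_exp p)"
    proof (rule Lp_norm_upper[where H = "\<lambda>\<zeta>. \<Sum>k\<in>{1..N}. (C * weight z) * weight (\<zeta> - \<Xi> k)"])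
      show "ennreal (norm (stft G F z \<zeta>)) \<le> ennreal (\<Sum>k\<in>{1..N}. (C * weight z) * weight (\<zeta> - \<Xi> k))" for \<zeta>
        using C(2)[of z \<zeta>] by (intro ennreal_leI) (simp add: sum_distrib_left mult_ac)
      show "(\<Sum>k\<in>{1..N}. (C * weight z) * weight (\<zeta> - \<Xi> k)) \<le> C * weight z * B" for \<zeta>
        unfolding sum_distrib_left[symmetric] using C(1) by (intro mult_left_mono B) auto
      have "(\<integral>\<^sup>+\<zeta>. ennreal (\<Sum>k\<in>{1..N}. (C * weight z) * weight (\<zeta> - \<Xi> k)) \<partial>lborel) = ennreal ((\<Sum>k\<in>{1..N}. C * weight z) * I)"
        using C(1) by (intro nn_integral_weight_sum I) auto
      \<comment> \<open>The factor \<open>B \<ge> 1\<close> is inserted because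
        \<open>Lp_norm_upper\<close> takes the same constant for supremum and integral.\<close>
      also have "\<dots> \<le> ennreal (C * weight z * B * (N * I))"
        using B(1) C(1) I(2) mult_left_mono[of 1 B "C * weight z * (N * I)"] by (intro ennreal_leI) (simp add: mult_ac)
      finally show "(\<integral>\<^sup>+\<zeta>. ennreal (\<Sum>k\<in>{1..N}. (C * weight z) * weight (\<zeta> - \<Xi> k)) \<partial>lborel) \<le> ennreal (C * weight z * B * (N * I))" .
    qed (use p C I N measurable_stft(1)[OF F G] in \<open>auto intro!: sum_nonneg\<close>)
    then show ?thesis by (simp add: mult_ac)
  qed
  have "amalgam_norm G p q F \<le> ennreal (?D * I powr recip_exp q)"
    unfolding amalgam_norm_def
  proof (rule Lp_norm_upper[OF p(2) _ _ inner])
    show "q = \<infinity> \<Longrightarrow> (\<lambda>z. Lp_norm p (\<lambda>\<zeta>. ennreal (norm (stft G F z \<zeta>)))) \<in> borel_measurable lborel"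
      using p(3) by (intro measurable_stft F G) auto
    show "?D * weight z \<le> ?D" for z :: "real ^ 'n" using weight_le_1[of z] D by (simp add: mult_left_le)
    \<comment> \<open>A sum with one term, centred at the origin, puts the single weight into the
      form of \<open>nn_integral_weight_sum\<close>.\<close>
    have "(\<integral>\<^sup>+x. ennreal (\<Sum>k\<in>{0::nat}. ?D * weight (x - 0 :: real ^ 'n)) \<partial>lborel) = ennreal ((\<Sum>k\<in>{0::nat}. ?D) * I)"
      using D by (intro nn_integral_weight_sum[where X = "\<lambda>_. 0"] I) auto
    then show "(\<integral>\<^sup>+x. ennreal (?D * weight (x :: real ^ 'n)) \<partial>lborel) \<le> ennreal (?D * I)" by simp
  qed (use D I in auto)
  also have "?D * I powr recip_exp q = C * B * (I powr recip_exp p * I powr recip_exp q) * N powr recip_exp p"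
    using I by (simp add: powr_mult mult_ac)
  finally show ?thesis .
qed

text \<open>For fixed \<open>z\<close> both the supremum and the integral over frequencies are
  controlled by the sum of the position weights, so the inner norm carries no power of
  \<open>N\<close>. That sum is at most \<open>B\<close> with integral \<open>N * I\<close>, and the
  outer norm yields N^(1/q).\<close>

lemma amalgam_norm_upper_separated_positions:
  fixes F G :: "real ^ 'n::finite \<Rightarrow> complex" and X \<Xi> :: "nat \<Rightarrow> real ^ 'n"
  assumes p: "1 \<le> p" "1 \<le> q" "p \<noteq> q" and F: "schwartz F" and G: "schwartz G"
    and I: "\<And>a. (\<integral>\<^sup>+x. ennreal (weight (x - a :: real ^ 'n)) \<partial>lborel) = ennreal I" "0 < I"
    and C: "0 \<le> C" "\<And>z \<zeta>. norm (stft G F z \<zeta>) \<le> C * (\<Sum>k\<in>{1..N}. weight (z - X k) * weight (\<zeta> - \<Xi> k))"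
    and B: "1 \<le> B" "\<And>z. (\<Sum>k\<in>{1..N}. weight (z - X k)) \<le> B" and N: "1 \<le> N"
  shows "amalgam_norm G p q F \<le> ennreal (C * B * (I powr recip_exp p * I powr recip_exp q) * N powr recip_exp q)"
proof -
  let ?A = "\<lambda>z. \<Sum>k\<in>{1..N}. weight (z - X k)"
  let ?D = "C * I powr recip_exp p"
  have D: "0 \<le> ?D" using C by simp
  have A: "0 \<le> ?A z" for z by (intro sum_nonneg) auto
  have inner: "Lp_norm p (\<lambda>\<zeta>. ennreal (norm (stft G F z \<zeta>))) \<le> ennreal (\<Sum>k\<in>{1..N}. ?D * weight (z - X k))" for z
  proof -
    have "Lp_norm p (\<lambda>\<zeta>. ennreal (norm (stft G F z \<zeta>))) \<le> ennreal ((C * ?A z) * I powr recip_exp p)"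
    proof (rule Lp_norm_upper[where H = "\<lambda>\<zeta>. \<Sum>k\<in>{1..N}. (C * weight (z - X k)) * weight (\<zeta> - \<Xi> k)"])
      show "ennreal (norm (stft G F z \<zeta>)) \<le> ennreal (\<Sum>k\<in>{1..N}. (C * weight (z - X k)) * weight (\<zeta> - \<Xi> k))" for \<zeta>
        using C(2)[of z \<zeta>] by (intro ennreal_leI) (simp add: sum_distrib_left mult_ac)
      show "(\<Sum>k\<in>{1..N}. (C * weight (z - X k)) * weight (\<zeta> - \<Xi> k)) \<le> C * ?A z" for \<zeta>
        unfolding sum_distrib_left using C(1) weight_le_1 by (intro sum_mono mult_left_le) auto
      have "(\<integral>\<^sup>+\<zeta>. ennreal (\<Sum>k\<in>{1..N}. (C * weight (z - X k)) * weight (\<zeta> - \<Xi> k)) \<partial>lborel) = ennreal ((\<Sum>k\<in>{1..N}. C * weight (z - X k)) * I)"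
        using C(1) by (intro nn_integral_weight_sum I) auto
      then show "(\<integral>\<^sup>+\<zeta>. ennreal (\<Sum>k\<in>{1..N}. (C * weight (z - X k)) * weight (\<zeta> - \<Xi> k)) \<partial>lborel) \<le> ennreal (C * ?A z * I)"
        by (simp add: sum_distrib_left)
    qed (use p C I N measurable_stft(1)[OF F G] in \<open>auto intro!: sum_nonneg\<close>)
    then show ?thesis by (simp add: sum_distrib_left mult_ac)
  qed
  have "amalgam_norm G p q F \<le> ennreal ((?D * B) * (N * I) powr recip_exp q)"
    unfolding amalgam_norm_def
  proof (rule Lp_norm_upper[OF p(2) _ _ inner])
    show "q = \<infinity> \<Longrightarrow> (\<lambda>z. Lp_norm p (\<lambda>\<zeta>. ennreal (norm (stft G F z \<zeta>)))) \<in> borel_measurable lborel"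
      using p(3) by (intro measurable_stft F G) auto
    show "(\<Sum>k\<in>{1..N}. ?D * weight (z - X k)) \<le> ?D * B" for z
      unfolding sum_distrib_left[symmetric] using D by (intro mult_left_mono B)
    have "(\<integral>\<^sup>+z. ennreal (\<Sum>k\<in>{1..N}. ?D * weight (z - X k)) \<partial>lborel) = ennreal ((\<Sum>k\<in>{1..N}. ?D) * I)"
      using D by (intro nn_integral_weight_sum I) auto
    also have "\<dots> \<le> ennreal (?D * B * (N * I))"
    proof (rule ennreal_leI)
      have "0 \<le> ?D * (N * I)" using C(1) I(2) by (intro mult_nonneg_nonneg) auto
      from mult_left_mono[OF B(1) this] show "(\<Sum>k\<in>{1..N}. ?D) * I \<le> ?D * B * (N * I)" by (simp add: mult_ac)
    qed
    finally show "(\<integral>\<^sup>+z. ennreal (\<Sum>k\<in>{1..N}. ?D * weight (z - X k)) \<partial>lborel) \<le> ennreal (?D * B * (N * I))" .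
  qed (use D I N in \<open>auto intro!: sum_nonneg\<close>)
  also have "(?D * B) * (N * I) powr recip_exp q = C * B * (I powr recip_exp p * I powr recip_exp q) * N powr recip_exp q"
    using I by (simp add: powr_mult mult_ac)
  finally show ?thesis .
qed

section \<open>Lower bounds and interaction along a train\<close>

lemma emeasure_UN_balls:
  fixes c :: "nat \<Rightarrow> real ^ 'n::finite"
  assumes r: "0 < r" and sep: "\<And>j k. j \<noteq> k \<Longrightarrow> 2 * r \<le> dist (c j) (c k)"
  shows "emeasure lborel (\<Union>j\<in>{1..N}. ball (c j) r) = ennreal (N * (unit_ball_vol CARD('n) * r ^ CARD('n)))"
proof -
  have "disjoint_family_on (\<lambda>j. ball (c j) r) {1..N}"
    unfolding disjoint_family_on_def
  proof (intro ballI impI)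
    fix j k :: nat assume "j \<noteq> k"
    then show "ball (c j) r \<inter> ball (c k) r = {}"
      using sep[of j k] dist_triangle_less_add[of "c j" _ r "c k" r] by (force simp: dist_commute)
  qed
  then have "emeasure lborel (\<Union>j\<in>{1..N}. ball (c j) r) = (\<Sum>j\<in>{1..N}. emeasure lborel (ball (c j) r))"
    by (intro sum_emeasure[symmetric]) auto
  also have "\<dots> = (\<Sum>j\<in>{1..N}. ennreal (unit_ball_vol CARD('n) * r ^ CARD('n)))"
    using r by (intro sum.cong refl) (simp add: emeasure_ball)
  also have "\<dots> = ennreal (N * (unit_ball_vol CARD('n) * r ^ CARD('n)))"
    using r by (subst sum_ennreal) auto
  finally show ?thesis .
qed

text \<open>The frequency set may depend on \<open>z\<close>: when the output positions are
  separated, a point near the j-th position sees only the j-th frequency.\<close>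

lemma amalgam_norm_lower:
  fixes F G :: "real ^ 'n::finite \<Rightarrow> complex"
  assumes p: "1 \<le> p" "1 \<le> q" and \<eta>: "0 \<le> \<eta>"
    and S: "S \<in> sets lborel" "emeasure lborel S = ennreal m" "0 < m"
    and T: "\<And>z. z \<in> S \<Longrightarrow> T z \<in> sets lborel" "\<And>z. z \<in> S \<Longrightarrow> emeasure lborel (T z) = ennreal m'" "0 < m'"
    and low: "\<And>z \<zeta>. z \<in> S \<Longrightarrow> \<zeta> \<in> T z \<Longrightarrow> \<eta> \<le> norm (stft G F z \<zeta>)"
  shows "ennreal (\<eta> * m' powr recip_exp p * m powr recip_exp q) \<le> amalgam_norm G p q F"
  unfolding amalgam_norm_def
proof (rule Lp_norm_lower[OF p(2) S])
  show "ennreal (\<eta> * m' powr recip_exp p) \<le> Lp_norm p (\<lambda>\<zeta>. ennreal (norm (stft G F z \<zeta>)))" if "z \<in> S" for z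
    using that by (intro Lp_norm_lower[OF p(1) T(1,2,3)] \<eta> ennreal_leI low)
qed (use \<eta> in simp)

text \<open>One coordinate suffices: it bounds each weight by 1 / (c (k - m))^2. The gain 1 / c^2 is
  what makes the interference small once the spacing is large.\<close>

lemma weight_sum_separated:
  obtains S where "0 < S"
    "\<And>(K :: nat set) m c i (y :: nat \<Rightarrow> real ^ 'n::finite). finite K \<Longrightarrow> 0 < c \<Longrightarrow>
      (\<And>k. k \<in> K \<Longrightarrow> int k \<noteq> m \<and> c * \<bar>of_int (int k - m)\<bar> \<le> \<bar>y k $ i\<bar>) \<Longrightarrow> (\<Sum>k\<in>K. weight (y k)) \<le> S / c\<^sup>2"
proof -
  obtain S where S: "0 < S"
    "\<And>(K :: int set) m. finite K \<Longrightarrow> m \<notin> K \<Longrightarrow> (\<Sum>k\<in>K. 1 / (of_int (k - m))\<^sup>2) \<le> (S::real)"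
    using sum_inverse_squares_bound by blast
  have "(\<Sum>k\<in>K. weight (y k)) \<le> S / c\<^sup>2"
    if K: "finite K" and c: "0 < c" and sep: "\<And>k. k \<in> K \<Longrightarrow> int k \<noteq> m \<and> c * \<bar>of_int (int k - m)\<bar> \<le> \<bar>y k $ i\<bar>"
    for K :: "nat set" and m c i and y :: "nat \<Rightarrow> real ^ 'n"
  proof -
    have "weight (y k) \<le> (1 / c\<^sup>2) * (1 / (of_int (int k - m))\<^sup>2)" if k: "k \<in> K" for k
    proof -
      have pos: "0 < c * \<bar>of_int (int k - m)\<bar>" using sep[OF k] c by auto
      have "(c * \<bar>of_int (int k - m)\<bar>)\<^sup>2 \<le> (y k $ i)\<^sup>2"
        using power_mono[of "c * \<bar>of_int (int k - m)\<bar>" "\<bar>y k $ i\<bar>" 2] sep[OF k] pos by simp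
      then have "inverse (1 + (y k $ i)\<^sup>2) \<le> inverse ((c * \<bar>of_int (int k - m)\<bar>)\<^sup>2)"
        using pos by (intro le_imp_inverse_le) auto
      then show ?thesis using weight_le[of "y k" i] by (simp add: power_mult_distrib inverse_eq_divide)
    qed
    then have "(\<Sum>k\<in>K. weight (y k)) \<le> (\<Sum>k\<in>K. (1 / c\<^sup>2) * (1 / (of_int (int k - m))\<^sup>2))" by (rule sum_mono)
    also have "\<dots> = (1 / c\<^sup>2) * (\<Sum>k\<in>int ` K. 1 / (of_int (k - m))\<^sup>2)"
      unfolding sum_distrib_left by (subst sum.reindex) auto
    also have "\<dots> \<le> (1 / c\<^sup>2) * S"
      using K sep by (intro mult_left_mono S) auto
    finally show ?thesis by simp
  qed
  then show ?thesis using that[of S] S(1) by blast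
qed

text \<open>Bounded overlap: only the centre nearest to \<open>x\<close> can contribute a term of
  order one, and every other centre is at distance at least |k - m| / 2 in coordinate
  \<open>i\<close>. The step may be negative, as the displacement has the sign of
  \<open>t\<close>.\<close>

lemma weight_train_bound:
  obtains B where "1 \<le> B"
    "\<And>l i N (x :: real ^ 'n::finite). 1 \<le> \<bar>l\<bar> \<Longrightarrow> (\<Sum>k\<in>{1..N::nat}. weight (x - (real k * l) *\<^sub>R axis i 1)) \<le> B"
proof -
  obtain S where S: "0 < S"
    "\<And>(K :: nat set) m c i (y :: nat \<Rightarrow> real ^ 'n::finite). finite K \<Longrightarrow> 0 < c \<Longrightarrow>
      (\<And>k. k \<in> K \<Longrightarrow> int k \<noteq> m \<and> c * \<bar>of_int (int k - m)\<bar> \<le> \<bar>y k $ i\<bar>) \<Longrightarrow> (\<Sum>k\<in>K. weight (y k)) \<le> S / c\<^sup>2"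
    using weight_sum_separated by blast
  have "(\<Sum>k\<in>{1..N}. weight (x - (real k * l) *\<^sub>R axis i 1)) \<le> 1 + S / (1/2)\<^sup>2"
    if l: "1 \<le> \<bar>l\<bar>" for l i N and x :: "real ^ 'n"
  proof -
    let ?w = "\<lambda>k. weight (x - (real k * l) *\<^sub>R axis i 1)"
    \<comment> \<open>Index of the nearest centre on the infinite progression; it may lie outside
      \<open>{1..N}\<close> and may be negative.\<close>
    define m where "m = round (x $ i / l)"
    have "sum ?w {k\<in>{1..N}. int k = m} \<le> 1"
    proof (cases "0 \<le> m")
      case True
      then have "sum ?w {k\<in>{1..N}. int k = m} \<le> sum ?w {nat m}" by (intro sum_mono2) auto
      also have "\<dots> \<le> 1" using weight_le_1 by simp
      finally show ?thesis .
    qed (auto intro: order_trans[OF eq_refl[OF sum.neutral]])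
    moreover have "sum ?w {k\<in>{1..N}. int k \<noteq> m} \<le> S / (1/2)\<^sup>2"
    proof (rule S(2)[where m = m and i = i])
      fix k assume k: "k \<in> {k\<in>{1..N}. int k \<noteq> m}"
      have "\<bar>of_int m - x $ i / l\<bar> \<le> 1 / 2" unfolding m_def by (rule of_int_round_abs_le)
      moreover have "1 \<le> \<bar>int k - m\<bar>" using k by auto
      then have "1 \<le> \<bar>real_of_int (int k - m)\<bar>" by (simp only: of_int_abs[symmetric] of_int_1_le_iff)
      ultimately have "1 / 2 * \<bar>real_of_int (int k - m)\<bar> \<le> \<bar>x $ i / l - real k\<bar>"
        using abs_triangle_ineq[of "x $ i / l - real k" "of_int m - x $ i / l"]
        by (simp add: abs_minus_commute)
      also have "\<dots> \<le> \<bar>l\<bar> * \<bar>x $ i / l - real k\<bar>" using l by (simp add: mult_le_cancel_right1)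
      also have "\<dots> = \<bar>x $ i - real k * l\<bar>" using l by (simp add: abs_mult[symmetric] field_simps)
      finally show "int k \<noteq> m \<and> 1 / 2 * \<bar>real_of_int (int k - m)\<bar> \<le> \<bar>(x - (real k * l) *\<^sub>R axis i 1) $ i\<bar>"
        using k by (simp add: axis_def)
    qed auto
    moreover have "sum ?w {1..N} = sum ?w {k\<in>{1..N}. int k = m} + sum ?w {k\<in>{1..N}. int k \<noteq> m}"
      by (subst sum.union_disjoint[symmetric]) (auto intro!: sum.cong)
    ultimately show ?thesis by linarith
  qed
  then show ?thesis using that[of "1 + S / (1/2)\<^sup>2"] S(1) by auto
qed

lemma powr_growth_contradiction:
  fixes c D r s :: real
  assumes c: "0 < c" and s: "s < r" and le: "\<And>N. 1 \<le> N \<Longrightarrow> c * real N powr r \<le> D * real N powr s"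
  shows False
proof -
  define a where "a = D / c"
  have b: "real N powr (r - s) \<le> a" if "1 \<le> N" for N
    using le[OF that] that c by (simp add: a_def powr_diff field_simps)
  have a: "1 \<le> a" using b[of 1] by simp
  obtain N where N: "a powr (1 / (r - s)) < real N" using reals_Archimedean2 by blast
  then have "(a powr (1 / (r - s))) powr (r - s) < real N powr (r - s)"
    using s by (intro powr_less_mono2) auto
  moreover have "1 \<le> N" using N a by (cases N) auto
  ultimately show False using b[of N] s a by (simp add: powr_powr)
qed

section \<open>The test functions\<close>

text \<open>The parameter \<open>\<theta>\<close> chooses between the two situations: for \<open>\<theta> = 0\<close> the input packets share
  their position and the output packets are separated, for \<open>\<theta> = 1\<close> it is the other way round.\<close>

lemma plate_test_functions:
  fixes G :: "real ^ 'n::finite \<Rightarrow> complex" and t \<theta> :: real and i :: 'n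
  assumes t: "t \<noteq> 0" and G: "schwartz G" and nz: "G \<noteq> (\<lambda>_. 0)"
  defines "\<kappa> \<equiv> 4 * pi * t"
  obtains f \<eta> r C L z0 where "0 < \<eta>" "0 < r" "0 < C" "1 \<le> L" "1 \<le> \<bar>\<kappa>\<bar> * L" "2 * r \<le> L" "2 * r \<le> \<bar>\<kappa>\<bar> * L"
    "\<And>N. schwartz (f N)"
    "\<And>N z \<zeta>. norm (stft G (f N) z \<zeta>)
      \<le> C * (\<Sum>k\<in>{1..N::nat}. weight (z - (real k * (\<theta> * (\<kappa> * L))) *\<^sub>R axis i 1) * weight (\<zeta> - (real k * L) *\<^sub>R axis i 1))"
    "\<And>N j z \<zeta>. j \<in> {1..N} \<Longrightarrow> z \<in> ball (z0 + (real j * ((\<theta> - 1) * (\<kappa> * L))) *\<^sub>R axis i 1) r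
      \<Longrightarrow> \<zeta> \<in> ball ((real j * L) *\<^sub>R axis i 1) r
      \<Longrightarrow> \<eta> \<le> norm (stft G (fourier_multiplier (plate_symbol t) (f N)) z \<zeta>)"
proof -
  have \<kappa>: "\<kappa> \<noteq> 0" using t by (simp add: \<kappa>_def)
  obtain y0 where y0: "G y0 \<noteq> 0" using nz by (auto simp: fun_eq_iff)
  obtain \<rho> :: real where \<rho>: "0 < \<rho>" and V0: "stft G (gauss (of_real \<rho>)) (- y0) 0 \<noteq> 0"
    using stft_gauss_nonzero[OF G y0] by blast
  define z0 where "z0 = - y0"
  \<comment> \<open>chosen such that one of the two chirps turns \<open>gauss w\<close> into a multiple of \<open>gauss \<rho>\<close>\<close>
  define w where "w = 1 / (of_real (1 / \<rho>) + \<i> * of_real \<kappa>)"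
  \<comment> \<open>The other chirp gives the parameter 1 / \<rho> + 2 i \<kappa>, a Gaussian with a
    quadratic phase, for which an upper bound is enough.\<close>
  define v2 where "v2 = 1 / w + \<i> * of_real \<kappa>"
  have iw: "1 / w = of_real (1 / \<rho>) + \<i> * of_real \<kappa>" by (simp add: w_def)
  have Re_inv: "0 < Re (1 / u)" if "0 < Re u" for u :: complex
    using that by (auto simp: Re_divide power2_eq_square intro!: divide_pos_pos add_pos_nonneg)
  have w: "0 < Re w" unfolding w_def using \<rho> by (intro Re_inv) simp
  have v1: "1 / w - \<i> * of_real \<kappa> = of_real (1 / \<rho>)" by (simp add: iw)
  have v2: "0 < Re v2" using \<rho> by (simp add: v2_def iw)
  note u2 = Re_inv[OF v2]
  have \<rho>': "0 < Re (complex_of_real \<rho>)" using \<rho> by simp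
  have sch: "schwartz (gauss u :: real ^ 'n \<Rightarrow> complex)" if "0 < Re u" for u
    using schwartz_packet[OF that, of 0 0] by (simp add: packet_0)
  define a where "a = norm (gauss_mass TYPE('n) w * gauss_mass TYPE('n) (of_real (1 / \<rho>)) / 2)"
  define b where "b = norm (gauss_mass TYPE('n) w * gauss_mass TYPE('n) v2 / 2)"
  have a: "0 < a" using gauss_mass_nonzero[OF w] gauss_mass_nonzero[of "of_real (1 / \<rho>)"] \<rho> by (simp add: a_def)
  have b: "0 \<le> b" by (simp add: b_def)
  note Gm = schwartz_measurable[OF G]

  obtain C1 where C1: "0 < C1" "\<And>z \<zeta>. norm (stft G (gauss (of_real \<rho>)) z \<zeta>) \<le> C1 * (weight z * weight \<zeta>)"
    using stft_weight_bound[OF sch[OF \<rho>'] G] by blast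
  obtain C2 where C2: "0 < C2" "\<And>z \<zeta>. norm (stft G (gauss (1 / v2)) z \<zeta>) \<le> C2 * (weight z * weight \<zeta>)"
    using stft_weight_bound[OF sch[OF u2] G] by blast
  obtain C3 where C3: "0 < C3" "\<And>z \<zeta>. norm (stft G (gauss w) z \<zeta>) \<le> C3 * (weight z * weight \<zeta>)"
    using stft_weight_bound[OF sch[OF w] G] by blast

  \<comment> \<open>The value at the centre is 3 \<delta> in modulus: one \<delta> is given up for
    continuity in \<open>near\<close>, one for interference, and one remains.\<close>
  define \<delta> where "\<delta> = norm (stft G (gauss (of_real \<rho>)) z0 0) / 3"
  have \<delta>: "0 < \<delta>" using V0 by (simp add: \<delta>_def z0_def)
  obtain r where r: "0 < r" and near: "\<And>z \<zeta>. dist z0 z < r \<Longrightarrow> dist 0 \<zeta> < r \<Longrightarrow> 2 * \<delta> \<le> norm (stft G (gauss (of_real \<rho>)) z \<zeta>)"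
  proof -
    have "isCont (\<lambda>p. stft G (gauss (of_real \<rho>)) (fst p) (snd p)) (z0, 0)"
      using continuous_stft[OF sch[OF \<rho>'] G] by (simp add: continuous_on_eq_continuous_at)
    then obtain s where s: "0 < s" "\<And>p. dist p (z0, 0) < s \<Longrightarrow>
        dist (stft G (gauss (of_real \<rho>)) (fst p) (snd p)) (stft G (gauss (of_real \<rho>)) z0 0) < \<delta>"
      using \<delta> by (force simp: continuous_at_eps_delta)
    have "2 * \<delta> \<le> norm (stft G (gauss (of_real \<rho>)) z \<zeta>)" if "dist z0 z < s / 2" "dist 0 \<zeta> < s / 2" for z \<zeta>
    proof -
      have "dist (z, \<zeta>) (z0, 0) \<le> dist z z0 + dist \<zeta> 0"
        unfolding dist_Pair_Pair by (rule sqrt_sum_squares_le_sum) auto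
      then have "dist (z, \<zeta>) (z0, 0) < s" using that by (simp add: dist_commute)
      from s(2)[OF this] show ?thesis
        using norm_triangle_ineq2[of "stft G (gauss (of_real \<rho>)) z0 0" "stft G (gauss (of_real \<rho>)) z \<zeta>"]
        by (simp add: \<delta>_def dist_norm norm_minus_commute)
    qed
    then show ?thesis using that[of "s / 2"] s(1) by auto
  qed

  obtain S where S: "0 < S"
    "\<And>(K :: nat set) m c i (y :: nat \<Rightarrow> real ^ 'n). finite K \<Longrightarrow> 0 < c \<Longrightarrow>
      (\<And>k. k \<in> K \<Longrightarrow> int k \<noteq> m \<and> c * \<bar>of_int (int k - m)\<bar> \<le> \<bar>y k $ i\<bar>) \<Longrightarrow> (\<Sum>k\<in>K. weight (y k)) \<le> S / c\<^sup>2"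
    using weight_sum_separated by blast

  \<comment> \<open>E / L^2 bounds the whole output except the wanted half of the observed packet.
    The first summand accounts for the other frequencies, with \<open>4 * S\<close> coming from S /
    (L / 2)^2, the second one for the unwanted half at the same frequency.\<close>
  define E where "E = (a * C1 + b * C2) * (4 * S) + b * C2 / \<kappa>\<^sup>2"
  have E: "0 \<le> E" unfolding E_def using a b C1 C2 S by (intro add_nonneg_nonneg mult_nonneg_nonneg divide_nonneg_nonneg) auto
  \<comment> \<open>Each summand secures one requirement: disjoint frequency balls, a displacement
    |\<kappa>| L larger than the balls and the offset \<open>z0\<close>, and interference below a
    \<delta>. Nothing here depends on the number of packets.\<close>
  define L where "L = 1 + 2 * r + (1 + 2 * r + norm z0) / \<bar>\<kappa>\<bar> + E / (a * \<delta>)"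
  have L0: "0 \<le> (1 + 2 * r + norm z0) / \<bar>\<kappa>\<bar>" "0 \<le> E / (a * \<delta>)" using r E a \<delta> by auto
  have L: "1 \<le> L" "2 * r \<le> L" "E / (a * \<delta>) \<le> L" "(1 + 2 * r + norm z0) / \<bar>\<kappa>\<bar> \<le> L"
    using L0 r unfolding L_def by linarith+
  have \<kappa>L: "1 + 2 * r + norm z0 \<le> \<bar>\<kappa>\<bar> * L" using L(4) \<kappa> by (simp add: pos_divide_le_eq mult.commute)
  have EL: "E / L\<^sup>2 \<le> a * \<delta>"
  proof -
    have "E \<le> a * \<delta> * L" using L(3) a \<delta> by (simp add: pos_divide_le_eq mult.commute)
    also have "\<dots> \<le> a * \<delta> * L\<^sup>2" using L(1) a \<delta> by (intro mult_left_mono) (auto simp: power2_eq_square)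
    finally show ?thesis using L(1) by (simp add: pos_divide_le_eq)
  qed

  let ?e = "axis i 1 :: real ^ 'n"
  define \<Xi> where "\<Xi> k = (real k * L) *\<^sub>R ?e" for k
  \<comment> \<open>From here the wanted half moves to k (\<theta> - 1) \<kappa> L and the unwanted
    one to k (\<theta> + 1) \<kappa> L, so their distance does not depend on \<theta>.\<close>
  define X where "X k = (real k * (\<theta> * (\<kappa> * L))) *\<^sub>R ?e" for k
  define f where "f N = (\<lambda>x. \<Sum>k\<in>{1..N::nat}. packet w (X k) (\<Xi> k) x)" for N

  have sch_f: "schwartz (f N)" for N
    unfolding f_def by (intro schwartz_sum schwartz_packet w) auto

  have upper: "norm (stft G (f N) z \<zeta>) \<le> C3 * (\<Sum>k\<in>{1..N}. weight (z - X k) * weight (\<zeta> - \<Xi> k))" for N z \<zeta>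
  proof -
    have "stft G (f N) z \<zeta> = (\<Sum>k\<in>{1..N}. stft G (packet w (X k) (\<Xi> k)) z \<zeta>)"
      using stft_sum[OF schwartz_packet[OF w] schwartz_packet[OF w] G,
          where K = "{1..N}" and a = "\<lambda>_. 1" and b = "\<lambda>_. 0"]
      by (simp add: f_def)
    also have "norm \<dots> \<le> (\<Sum>k\<in>{1..N}. C3 * (weight (z - X k) * weight (\<zeta> - \<Xi> k)))"
      by (rule sum_norm_le) (simp add: norm_stft_packet[OF Gm] C3)
    finally show ?thesis by (simp add: sum_distrib_left)
  qed

  have lower: "a * \<delta> \<le> norm (stft G (fourier_multiplier (plate_symbol t) (f N)) z \<zeta>)"
    if j: "j \<in> {1..N}" and z: "z \<in> ball (z0 + (real j * ((\<theta> - 1) * (\<kappa> * L))) *\<^sub>R ?e) r" and \<zeta>: "\<zeta> \<in> ball (\<Xi> j) r"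
    for N j z \<zeta>
  proof -
    let ?P = "\<lambda>k. packet (of_real \<rho>) (X k - \<kappa> *\<^sub>R \<Xi> k) (\<Xi> k)" and ?Q = "\<lambda>k. packet (1 / v2) (X k + \<kappa> *\<^sub>R \<Xi> k) (\<Xi> k)"
    let ?\<tau> = "\<lambda>k. 4 * pi\<^sup>2 * t * (\<Xi> k \<bullet> \<Xi> k)"
    let ?a = "\<lambda>k. cis (?\<tau> k) * (gauss_mass TYPE('n) w * gauss_mass TYPE('n) (of_real (1 / \<rho>)) / 2)"
    let ?b = "\<lambda>k. cis (- ?\<tau> k) * (gauss_mass TYPE('n) w * gauss_mass TYPE('n) v2 / 2)"
    have na: "norm (?a k) = a" and nb: "norm (?b k) = b" for k
      unfolding norm_mult[of "cis _"] norm_cis a_def b_def by simp_all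
    have F: "fourier_multiplier (plate_symbol t) (f N) = (\<lambda>x. \<Sum>k\<in>{1..N}. ?a k * ?P k x + ?b k * ?Q k x)"
      using plate_multiplier_packets[OF w, of "{1..N}" t X \<Xi>] v1 \<rho>
      by (simp add: fun_eq_iff f_def \<kappa>_def[symmetric] v2_def)
    let ?p = "\<lambda>k. ?a k * stft G (?P k) z \<zeta>" and ?q = "\<lambda>k. ?b k * stft G (?Q k) z \<zeta>"
    have split: "stft G (fourier_multiplier (plate_symbol t) (f N)) z \<zeta> = ?p j + (?q j + (\<Sum>k\<in>{1..N} - {j}. ?p k + ?q k))"
    proof -
      have "stft G (fourier_multiplier (plate_symbol t) (f N)) z \<zeta> = (\<Sum>k\<in>{1..N}. ?p k + ?q k)"
        unfolding F by (intro stft_sum schwartz_packet \<rho>' u2 G)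
      also have "\<dots> = (?p j + ?q j) + (\<Sum>k\<in>{1..N} - {j}. ?p k + ?q k)"
        using j by (intro sum.remove) simp_all
      finally show ?thesis by (simp only: add.assoc)
    qed
    have P: "norm (?p k) \<le> a * C1 * weight (\<zeta> - \<Xi> k)" for k
    proof -
      have "norm (stft G (?P k) z \<zeta>) \<le> C1 * (1 * weight (\<zeta> - \<Xi> k))"
        unfolding norm_stft_packet[OF Gm] using C1
        by (intro order_trans[OF C1(2)] mult_left_mono mult_right_mono weight_le_1) auto
      then show ?thesis unfolding norm_mult[of "?a k"] na using a by (simp add: mult.assoc)
    qed
    have Q: "norm (?q k) \<le> b * C2 * (weight (z - (X k + \<kappa> *\<^sub>R \<Xi> k)) * weight (\<zeta> - \<Xi> k))" for k
    proof -
      have "norm (stft G (?Q k) z \<zeta>) \<le> C2 * (weight (z - (X k + \<kappa> *\<^sub>R \<Xi> k)) * weight (\<zeta> - \<Xi> k))"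
        unfolding norm_stft_packet[OF Gm] by (rule C2(2))
      then show ?thesis unfolding norm_mult[of "?b k"] nb using b by (simp add: mult.assoc mult_left_mono)
    qed
    \<comment> \<open>For \<open>k \<noteq> j\<close> separation in frequency alone suffices, and
      the position weights are estimated by 1. Since r <= L / 2, moving \<zeta> within its ball at
      most halves the separation.\<close>
    have off: "norm (\<Sum>k\<in>{1..N} - {j}. ?p k + ?q k) \<le> (a * C1 + b * C2) * (4 * S) / L\<^sup>2"
    proof -
      have "norm (?p k + ?q k) \<le> (a * C1 + b * C2) * weight (\<zeta> - \<Xi> k)" for k
      proof -
        have "b * C2 * (weight (z - (X k + \<kappa> *\<^sub>R \<Xi> k)) * weight (\<zeta> - \<Xi> k)) \<le> b * C2 * (1 * weight (\<zeta> - \<Xi> k))"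
          using b C2 by (intro mult_left_mono mult_right_mono weight_le_1) auto
        then show ?thesis using P[of k] Q[of k] norm_triangle_ineq[of "?p k" "?q k"] by (simp add: distrib_right)
      qed
      then have "norm (\<Sum>k\<in>{1..N} - {j}. ?p k + ?q k) \<le> (\<Sum>k\<in>{1..N} - {j}. (a * C1 + b * C2) * weight (\<zeta> - \<Xi> k))"
        by (rule sum_norm_le)
      also have "\<dots> = (a * C1 + b * C2) * (\<Sum>k\<in>{1..N} - {j}. weight (\<zeta> - \<Xi> k))" by (simp add: sum_distrib_left)
      also have "\<dots> \<le> (a * C1 + b * C2) * (S / (L / 2)\<^sup>2)"
      proof (intro mult_left_mono S(2)[where m = "int j" and i = i])
        fix k assume k: "k \<in> {1..N} - {j}"
        have "\<bar>(\<zeta> - \<Xi> j) $ i\<bar> \<le> r"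
          using \<zeta> component_le_norm_cart[of "\<zeta> - \<Xi> j" i] by (simp add: dist_norm norm_minus_commute)
        moreover have "(\<zeta> - \<Xi> k) $ i = (\<zeta> - \<Xi> j) $ i + (real j - real k) * L"
          by (simp add: \<Xi>_def axis_def left_diff_distrib)
        moreover have "\<bar>(real j - real k) * L\<bar> = L * \<bar>real_of_int (int k - int j)\<bar>"
          using L(1) by (simp add: abs_mult)
        moreover have "1 \<le> \<bar>int k - int j\<bar>" using k by auto
        then have "1 \<le> \<bar>real_of_int (int k - int j)\<bar>" by (simp only: of_int_abs[symmetric] of_int_1_le_iff)
        then have "r \<le> L / 2 * \<bar>real_of_int (int k - int j)\<bar>"
          using L(1,2) mult_left_mono[of 1 "\<bar>real_of_int (int k - int j)\<bar>" "L / 2"] by linarith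
        ultimately have "L / 2 * \<bar>real_of_int (int k - int j)\<bar> \<le> \<bar>(\<zeta> - \<Xi> k) $ i\<bar>"
          by (smt (verit) field_sum_of_halves mult.commute times_divide_eq_right)
        then show "int k \<noteq> int j \<and> L / 2 * \<bar>real_of_int (int k - int j)\<bar> \<le> \<bar>(\<zeta> - \<Xi> k) $ i\<bar>" using k by simp
      qed (use L(1) a b C1 C2 in auto)
      also have "\<dots> = (a * C1 + b * C2) * (4 * S) / L\<^sup>2" by (simp add: power_divide)
      finally show ?thesis .
    qed
    \<comment> \<open>Here the frequencies agree and the positions must separate: relative to the
      unwanted half, \<open>z\<close> is off by 2 j \<kappa> L up to \<open>r\<close> and
      \<open>z0\<close>, which leaves at least |\<kappa>| L because
      \<open>j \<ge> 1\<close>.\<close>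
    have Qj: "norm (?q j) \<le> b * C2 / \<kappa>\<^sup>2 / L\<^sup>2"
    proof -
      let ?u = "z - (z0 + (real j * ((\<theta> - 1) * (\<kappa> * L))) *\<^sub>R ?e)"
      let ?x = "z - (X j + \<kappa> *\<^sub>R \<Xi> j)"
      have "\<bar>?u $ i\<bar> \<le> r"
        using z component_le_norm_cart[of ?u i] by (simp add: dist_norm norm_minus_commute)
      moreover have "\<bar>z0 $ i\<bar> \<le> norm z0" by (rule component_le_norm_cart)
      moreover have "?x $ i = ?u $ i + z0 $ i - 2 * (real j * (\<kappa> * L))"
        by (simp add: X_def \<Xi>_def axis_def algebra_simps)
      moreover have "\<bar>\<kappa>\<bar> * L \<le> \<bar>real j * (\<kappa> * L)\<bar>"
        using j L(1) mult_right_mono[of 1 "real j" "\<bar>\<kappa>\<bar> * L"] by (simp add: abs_mult)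
      ultimately have "\<bar>\<kappa>\<bar> * L \<le> \<bar>?x $ i\<bar>" using \<kappa>L r by linarith
      then have "(\<bar>\<kappa>\<bar> * L)\<^sup>2 \<le> (?x $ i)\<^sup>2"
        using power_mono[of "\<bar>\<kappa>\<bar> * L" "\<bar>?x $ i\<bar>" 2] L(1) by simp
      then have "inverse (1 + (?x $ i)\<^sup>2) \<le> inverse ((\<bar>\<kappa>\<bar> * L)\<^sup>2)"
        using \<kappa> L(1) by (intro le_imp_inverse_le) auto
      then have "weight ?x \<le> inverse (\<kappa>\<^sup>2 * L\<^sup>2)"
        using weight_le[of ?x i] by (simp add: power_mult_distrib)
      then have "weight ?x * weight (\<zeta> - \<Xi> j) \<le> inverse (\<kappa>\<^sup>2 * L\<^sup>2) * 1"
        by (intro mult_mono weight_le_1) auto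
      then have "b * C2 * (weight ?x * weight (\<zeta> - \<Xi> j)) \<le> b * C2 * (inverse (\<kappa>\<^sup>2 * L\<^sup>2) * 1)"
        using b C2 by (intro mult_left_mono) auto
      also have "\<dots> = b * C2 / \<kappa>\<^sup>2 / L\<^sup>2" by (simp add: field_simps)
      finally show ?thesis using Q[of j] by (rule order_trans[rotated])
    qed
    have Pj: "a * (2 * \<delta>) \<le> norm (?p j)"
    proof -
      have "z0 - (z - (X j - \<kappa> *\<^sub>R \<Xi> j)) = (z0 + (real j * ((\<theta> - 1) * (\<kappa> * L))) *\<^sub>R ?e) - z"
        by (simp add: X_def \<Xi>_def algebra_simps)
      then have "dist z0 (z - (X j - \<kappa> *\<^sub>R \<Xi> j)) < r"
        using z by (simp only: dist_norm mem_ball)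
      moreover have "dist 0 (\<zeta> - \<Xi> j) < r" using \<zeta> by (simp add: dist_norm norm_minus_commute)
      ultimately have "2 * \<delta> \<le> norm (stft G (?P j) z \<zeta>)"
        unfolding norm_stft_packet[OF Gm] by (rule near)
      then show ?thesis unfolding norm_mult[of "?a j"] na using a by (intro mult_left_mono) auto
    qed
    have "norm (?q j + (\<Sum>k\<in>{1..N} - {j}. ?p k + ?q k)) \<le> b * C2 / \<kappa>\<^sup>2 / L\<^sup>2 + (a * C1 + b * C2) * (4 * S) / L\<^sup>2"
      by (rule norm_triangle_mono[OF Qj off])
    also have "\<dots> = E / L\<^sup>2" by (simp add: E_def add_divide_distrib)
    finally show ?thesis
      using norm_diff_ineq[of "?p j" "?q j + (\<Sum>k\<in>{1..N} - {j}. ?p k + ?q k)"] Pj EL unfolding split by linarith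
  qed
  have "0 < a * \<delta>" "1 \<le> \<bar>\<kappa>\<bar> * L" "2 * r \<le> \<bar>\<kappa>\<bar> * L"
    using a \<delta> \<kappa>L r norm_ge_zero[of z0] by (simp, linarith+)
  then show ?thesis
    using r C3(1) L(1,2)
    by (intro that[of "a * \<delta>" r C3 L f z0, OF _ _ _ _ _ _ _ sch_f upper[unfolded X_def \<Xi>_def] lower[unfolded \<Xi>_def]])
qed

section \<open>Comparison of the growth in the number of packets\<close>

lemma dist_axis_multiples:
  fixes z0 :: "real ^ 'n::finite"
  assumes "j \<noteq> k" "d \<le> \<bar>l\<bar>" "0 \<le> d"
  shows "d \<le> dist (z0 + (real j * l) *\<^sub>R axis i 1) (z0 + (real k * l) *\<^sub>R axis i 1)"
proof -
  have "1 \<le> \<bar>int j - int k\<bar>" using assms(1) by auto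
  then have "1 \<le> \<bar>real_of_int (int j - int k)\<bar>" by (simp only: of_int_abs[symmetric] of_int_1_le_iff)
  then have "1 * d \<le> \<bar>real j - real k\<bar> * \<bar>l\<bar>" using assms(2,3) by (intro mult_mono) auto
  also have "\<dots> = norm (((real j - real k) * l) *\<^sub>R (axis i 1 :: real ^ 'n))" by (simp add: abs_mult)
  also have "\<dots> = dist (z0 + (real j * l) *\<^sub>R axis i 1) (z0 + (real k * l) *\<^sub>R axis i 1)"
    by (simp add: dist_norm scaleR_left_diff_distrib[symmetric] left_diff_distrib)
  finally show ?thesis by simp
qed

theorem mainTheorem4:
  fixes t :: real and p q :: ennreal and g :: "real ^ 'n::finite \<Rightarrow> complex"
  assumes "t \<noteq> 0"
    and "1 \<le> p" and "1 \<le> q" and "p \<noteq> q"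
    and "schwartz g" and "g \<noteq> (\<lambda>_. 0)"
  shows "\<not> (\<exists>C::real. C > 0 \<and>
    (\<forall>f :: real ^ 'n \<Rightarrow> complex. schwartz f \<longrightarrow>
       amalgam_norm g p q (fourier_multiplier (plate_symbol t) f) \<le> ennreal C * amalgam_norm g p q f))"
proof
  assume "\<exists>C::real. C > 0 \<and>
    (\<forall>f :: real ^ 'n \<Rightarrow> complex. schwartz f \<longrightarrow>
       amalgam_norm g p q (fourier_multiplier (plate_symbol t) f) \<le> ennreal C * amalgam_norm g p q f)"
  then obtain A where A: "0 < A" "\<And>f :: real ^ 'n \<Rightarrow> complex. schwartz f \<Longrightarrow>
       amalgam_norm g p q (fourier_multiplier (plate_symbol t) f) \<le> ennreal A * amalgam_norm g p q f" by blast
  obtain I where I: "0 < I" "\<And>a. (\<integral>\<^sup>+x. ennreal (weight (x - a :: real ^ 'n)) \<partial>lborel) = ennreal I"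
    using weight_shift_integral[where 'n = 'n] by metis
  obtain B where B: "1 \<le> B"
    "\<And>l i N (x :: real ^ 'n). 1 \<le> \<bar>l\<bar> \<Longrightarrow> (\<Sum>k\<in>{1..N::nat}. weight (x - (real k * l) *\<^sub>R axis i 1)) \<le> B"
    using weight_train_bound[where 'n = 'n] by metis
  \<comment> \<open>An arbitrary coordinate direction, along which all trains are placed.\<close>
  define i :: 'n where "i = undefined"
  let ?e = "axis i 1 :: real ^ 'n" and ?\<kappa> = "4 * pi * t"
  let ?P = "recip_exp p" and ?Q = "recip_exp q"
  consider "q < p" | "p < q" using \<open>p \<noteq> q\<close> by fastforce
  then show False
  proof cases
    case 1
    obtain f \<eta> r C L z0 where c: "0 < \<eta>" "0 < r" "0 < C" "1 \<le> L" "2 * r \<le> \<bar>?\<kappa>\<bar> * L"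
      and f: "\<And>N. schwartz (f N)"
      and up: "\<And>N z \<zeta>. norm (stft g (f N) z \<zeta>)
        \<le> C * (\<Sum>k\<in>{1..N::nat}. weight (z - (real k * (0 * (?\<kappa> * L))) *\<^sub>R ?e) * weight (\<zeta> - (real k * L) *\<^sub>R ?e))"
      and low: "\<And>N j z \<zeta>. j \<in> {1..N} \<Longrightarrow> z \<in> ball (z0 + (real j * ((0 - 1) * (?\<kappa> * L))) *\<^sub>R ?e) r
        \<Longrightarrow> \<zeta> \<in> ball ((real j * L) *\<^sub>R ?e) r
        \<Longrightarrow> \<eta> \<le> norm (stft g (fourier_multiplier (plate_symbol t) (f N)) z \<zeta>)"
      by (rule plate_test_functions[OF \<open>t \<noteq> 0\<close> \<open>schwartz g\<close> \<open>g \<noteq> (\<lambda>_. 0)\<close>, of 0 i]) blast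
    define m where "m = unit_ball_vol (real CARD('n)) * r ^ CARD('n)"
    have m: "0 < m" using c by (simp add: m_def)
    let ?z = "\<lambda>j. z0 + (real j * (- (?\<kappa> * L))) *\<^sub>R ?e"
    have "(\<eta> * m powr ?P * m powr ?Q) * real N powr ?Q \<le> (A * (C * B * (I powr ?P * I powr ?Q))) * real N powr ?P"
      if N: "1 \<le> N" for N
    proof -
      let ?S = "\<Union>j\<in>{1..N}. ball (?z j) r"
      \<comment> \<open>The index of a ball containing \<open>z\<close> determines the one frequency
        ball on which the lower bound holds for this \<open>z\<close>. The inner norm therefore sees
        measure \<open>m\<close>, the outer one \<open>N * m\<close>.\<close>
      have "\<forall>z\<in>?S. \<exists>j\<in>{1..N}. z \<in> ball (?z j) r" by blast
      then obtain J where J: "\<And>z. z \<in> ?S \<Longrightarrow> J z \<in> {1..N} \<and> z \<in> ball (?z (J z)) r" by metis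
      have "ennreal (\<eta> * m powr ?P * (N * m) powr ?Q) \<le> amalgam_norm g p q (fourier_multiplier (plate_symbol t) (f N))"
      proof (rule amalgam_norm_lower[where S = ?S and T = "\<lambda>z. ball ((real (J z) * L) *\<^sub>R ?e) r"])
        have "2 * r \<le> \<bar>- (?\<kappa> * L)\<bar>" using c by (simp add: abs_mult)
        then show "emeasure lborel ?S = ennreal (N * m)"
          unfolding m_def using c by (intro emeasure_UN_balls dist_axis_multiples) auto
        show "emeasure lborel (ball ((real (J z) * L) *\<^sub>R ?e) r) = ennreal m" for z
          using c by (simp add: m_def emeasure_ball)
        show "\<eta> \<le> norm (stft g (fourier_multiplier (plate_symbol t) (f N)) z \<zeta>)"
          if "z \<in> ?S" "\<zeta> \<in> ball ((real (J z) * L) *\<^sub>R ?e) r" for z \<zeta>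
          using low[of "J z" N z \<zeta>] J[OF that(1)] that(2) by simp
      qed (use assms c m N in auto)
      also have "\<dots> \<le> ennreal A * amalgam_norm g p q (f N)" by (rule A(2)[OF f])
      also have "\<dots> \<le> ennreal A * ennreal (C * B * (I powr ?P * I powr ?Q) * N powr ?P)"
        using up c B(2)[of L] N
        by (intro mult_left_mono amalgam_norm_upper_common_position[OF assms(2-4) f assms(5) I(2,1), where \<Xi> = "\<lambda>k. (real k * L) *\<^sub>R ?e"] B(1)) auto
      also have "\<dots> = ennreal (A * (C * B * (I powr ?P * I powr ?Q) * N powr ?P))"
        using A(1) c B(1) by (subst ennreal_mult) auto
      finally have "\<eta> * m powr ?P * (N * m) powr ?Q \<le> A * (C * B * (I powr ?P * I powr ?Q) * N powr ?P)"
        using A(1) c B(1) by (subst (asm) ennreal_le_iff) auto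
      then show ?thesis using m by (simp add: powr_mult mult_ac)
    qed
    then show False
      using powr_growth_contradiction[of "\<eta> * m powr ?P * m powr ?Q" ?P ?Q] recip_exp_less[OF assms(3) 1] c m by auto
  next
    case 2
    obtain f \<eta> r C L z0 where c: "0 < \<eta>" "0 < r" "0 < C" "1 \<le> \<bar>?\<kappa>\<bar> * L" "2 * r \<le> L"
      and f: "\<And>N. schwartz (f N)"
      and up: "\<And>N z \<zeta>. norm (stft g (f N) z \<zeta>)
        \<le> C * (\<Sum>k\<in>{1..N::nat}. weight (z - (real k * (1 * (?\<kappa> * L))) *\<^sub>R ?e) * weight (\<zeta> - (real k * L) *\<^sub>R ?e))"
      and low: "\<And>N j z \<zeta>. j \<in> {1..N} \<Longrightarrow> z \<in> ball (z0 + (real j * ((1 - 1) * (?\<kappa> * L))) *\<^sub>R ?e) r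
        \<Longrightarrow> \<zeta> \<in> ball ((real j * L) *\<^sub>R ?e) r
        \<Longrightarrow> \<eta> \<le> norm (stft g (fourier_multiplier (plate_symbol t) (f N)) z \<zeta>)"
      by (rule plate_test_functions[OF \<open>t \<noteq> 0\<close> \<open>schwartz g\<close> \<open>g \<noteq> (\<lambda>_. 0)\<close>, of 1 i]) blast
    define m where "m = unit_ball_vol (real CARD('n)) * r ^ CARD('n)"
    have m: "0 < m" using c by (simp add: m_def)
    have "(\<eta> * m powr ?P * m powr ?Q) * real N powr ?P \<le> (A * (C * B * (I powr ?P * I powr ?Q))) * real N powr ?Q"
      if N: "1 \<le> N" for N
    proof -
      \<comment> \<open>The summand 0 is the base point required by
        \<open>dist_axis_multiples\<close>. Every \<open>z\<close> near the common position sees all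
        frequencies, so the frequency set is the same for all \<open>z\<close> and the factor
        \<open>N\<close> enters the inner norm.\<close>
      let ?T = "\<Union>j\<in>{1..N}. ball (0 + (real j * L) *\<^sub>R ?e) r"
      have "ennreal (\<eta> * (N * m) powr ?P * m powr ?Q) \<le> amalgam_norm g p q (fourier_multiplier (plate_symbol t) (f N))"
      proof (rule amalgam_norm_lower[where S = "ball z0 r" and T = "\<lambda>_. ?T"])
        show "emeasure lborel ?T = ennreal (N * m)"
          unfolding m_def using c by (intro emeasure_UN_balls dist_axis_multiples) auto
        show "emeasure lborel (ball z0 r) = ennreal m" using c by (simp add: m_def emeasure_ball)
        show "\<eta> \<le> norm (stft g (fourier_multiplier (plate_symbol t) (f N)) z \<zeta>)"
          if "z \<in> ball z0 r" "\<zeta> \<in> ?T" for z \<zeta>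
          using low[of _ N z \<zeta>] that by auto
      qed (use assms c m N in auto)
      also have "\<dots> \<le> ennreal A * amalgam_norm g p q (f N)" by (rule A(2)[OF f])
      also have "\<dots> \<le> ennreal A * ennreal (C * B * (I powr ?P * I powr ?Q) * N powr ?Q)"
        using up c B(2)[of "?\<kappa> * L"] N
        by (intro mult_left_mono amalgam_norm_upper_separated_positions[OF assms(2-4) f assms(5) I(2,1),
              where X = "\<lambda>k. (real k * (?\<kappa> * L)) *\<^sub>R ?e" and \<Xi> = "\<lambda>k. (real k * L) *\<^sub>R ?e"] B(1)) (auto simp: abs_mult)
      also have "\<dots> = ennreal (A * (C * B * (I powr ?P * I powr ?Q) * N powr ?Q))"
        using A(1) c B(1) by (subst ennreal_mult) auto
      finally have "\<eta> * (N * m) powr ?P * m powr ?Q \<le> A * (C * B * (I powr ?P * I powr ?Q) * N powr ?Q)"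
        using A(1) c B(1) by (subst (asm) ennreal_le_iff) auto
      then show ?thesis using m by (simp add: powr_mult mult_ac)
    qed
    then show False
      using powr_growth_contradiction[of "\<eta> * m powr ?P * m powr ?Q" ?Q ?P] recip_exp_less[OF assms(2) 2] c m by auto
  qed
qed

end
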